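(* There exist Blaschke products which satisfy both the Sharp Invertibility Property (SIP) and the Weak Embedding Property (WEP) and which are not Carleson--Newman.
   Context: $H^\infty$ is the algebra of bounded analytic functions on the open unit disc $\mathbb{D}$ with the sup norm $\|\cdot\|_\infty$. For an inner function $\Theta$ with zero set $\mathcal{Z}(\Theta)\subset\mathbb{D}$, $H^\infty/\Theta H^\infty$ has the norm $\|[f]\|=\inf\{\|f+g\Theta\|_\infty:g\in H^\infty\}$. SIP: for every $\varepsilon>0$ there exists $\delta>0$ such that for every $f\in H^\infty$, the conditions $\|[f]\|\le1$ and $\inf_{\mathcal{Z}(\Theta)}|f|\ge1-\delta$ imply that $[f]$ is invertible in $H^\infty/\Theta H^\infty$ and $\|[f]^{-1}\|\le1+\varepsilon$. WEP: for every $f\in H^\infty$, $\inf_{\mathcal{Z}(\Theta)}|f|>0$ implies that $[f]$ is invertible in $H^\infty/\Theta H^\infty$. (A known theorem of Gorkin, Mortini and Nikolski: WEP holds iff $\inf\{|\Theta(z)|:\rho(z,\mathcal{Z}(\Theta))\ge t\}>0$ for every $t\in(0,1)$, where $\rho(z,w)=|z-w|/|1-\bar wz|$.) A Blaschke product with zeros $\{a_j\}$ (with multiplicity) is Carleson--Newman if $\mu=\sum_j(1-|a_j|)\delta_{a_j}$ is a Carleson measure, i.e. there is $C>0$ with $\mu(Q(I))\le C|I|$ for every arc $I\subset\partial\mathbb{D}$, where $Q(I)=\{z\in\mathbb{D}: z/|z|\in I,\ 1-|z|\le|I|\}$. *)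

theory Defs
  imports "HOL-Analysis.Analysis"
begin

abbreviation unit_disc :: "complex set" where
  "unit_disc \<equiv> ball 0 1"

section \<open>The algebra of bounded analytic functions and its quotients\<close>

text \<open>Functions are total on the complex plane, but only their values on the unit disc matter:
  all notions below depend on the restriction to the disc only.\<close>

definition Hinf :: "(complex \<Rightarrow> complex) set" where
  "Hinf = {f. f holomorphic_on unit_disc \<and> bounded (f ` unit_disc)}"

definition Hinf_norm :: "(complex \<Rightarrow> complex) \<Rightarrow> real" where
  "Hinf_norm f = (SUP z\<in>unit_disc. norm (f z))"

definition zero_set :: "(complex \<Rightarrow> complex) \<Rightarrow> complex set" where
  "zero_set \<Theta> = {z \<in> unit_disc. \<Theta> z = 0}"

text \<open>Elements of the quotient algebra are handled through representatives in \<^term>\<open>Hinf\<close>;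
  the next relation is equality of the cosets \<open>[f]\<close> and \<open>[g]\<close> modulo \<open>\<Theta> H\<^sup>\<infinity>\<close>.\<close>

definition quotient_eq ::
    "(complex \<Rightarrow> complex) \<Rightarrow> (complex \<Rightarrow> complex) \<Rightarrow> (complex \<Rightarrow> complex) \<Rightarrow> bool" where
  "quotient_eq \<Theta> f g \<longleftrightarrow> (\<exists>k\<in>Hinf. \<forall>z\<in>unit_disc. f z = g z + k z * \<Theta> z)"

definition quotient_norm :: "(complex \<Rightarrow> complex) \<Rightarrow> (complex \<Rightarrow> complex) \<Rightarrow> real" where
  "quotient_norm \<Theta> f = (INF g\<in>Hinf. Hinf_norm (\<lambda>z. f z + g z * \<Theta> z))"

text \<open>\<open>h\<close> represents the (unique) inverse of the coset of \<open>f\<close>.\<close>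

definition quotient_inverse ::
    "(complex \<Rightarrow> complex) \<Rightarrow> (complex \<Rightarrow> complex) \<Rightarrow> (complex \<Rightarrow> complex) \<Rightarrow> bool" where
  "quotient_inverse \<Theta> f h \<longleftrightarrow> h \<in> Hinf \<and> quotient_eq \<Theta> (\<lambda>z. f z * h z) (\<lambda>_. 1)"

text \<open>The infimum is taken in \<^typ>\<open>ereal\<close> so that it is \<open>\<infinity>\<close> if there are no zeros.\<close>

definition inf_on_zeros :: "(complex \<Rightarrow> complex) \<Rightarrow> (complex \<Rightarrow> complex) \<Rightarrow> ereal" where
  "inf_on_zeros \<Theta> f = (INF z\<in>zero_set \<Theta>. ereal (norm (f z)))"

definition SIP :: "(complex \<Rightarrow> complex) \<Rightarrow> bool" where
  "SIP \<Theta> \<longleftrightarrow>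
    (\<forall>\<epsilon>>0. \<exists>\<delta>>0. \<forall>f\<in>Hinf.
       quotient_norm \<Theta> f \<le> 1 \<and> inf_on_zeros \<Theta> f \<ge> ereal (1 - \<delta>) \<longrightarrow>
       (\<exists>h. quotient_inverse \<Theta> f h \<and> quotient_norm \<Theta> h \<le> 1 + \<epsilon>))"

definition WEP :: "(complex \<Rightarrow> complex) \<Rightarrow> bool" where
  "WEP \<Theta> \<longleftrightarrow>
    (\<forall>f\<in>Hinf. inf_on_zeros \<Theta> f > 0 \<longrightarrow> (\<exists>h. quotient_inverse \<Theta> f h))"

section \<open>Blaschke products\<close>

text \<open>The zeros, with multiplicity, are a family \<open>a\<close> indexed by a finite or infinite set \<open>J\<close> of
  natural numbers.\<close>

definition blaschke_zeros :: "nat set \<Rightarrow> (nat \<Rightarrow> complex) \<Rightarrow> bool" where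
  "blaschke_zeros J a \<longleftrightarrow>
    (\<forall>j\<in>J. a j \<in> unit_disc) \<and> (\<lambda>j. 1 - norm (a j)) summable_on J"

definition blaschke_factor :: "complex \<Rightarrow> complex \<Rightarrow> complex" where
  "blaschke_factor w z =
    (if w = 0 then z else of_real (norm w) / w * ((w - z) / (1 - cnj w * z)))"

definition blaschke_product :: "nat set \<Rightarrow> (nat \<Rightarrow> complex) \<Rightarrow> complex \<Rightarrow> complex" where
  "blaschke_product J a z = (\<Prod>j. if j \<in> J then blaschke_factor (a j) z else 1)"

section \<open>The Carleson--Newman condition\<close>

text \<open>The box \<open>Q(I)\<close> over the arc \<open>I\<close> of all \<open>cis t\<close> with \<open>\<alpha> \<le> t \<le> \<beta>\<close>, whose length is
  \<open>\<beta> - \<alpha>\<close> if \<open>\<beta> - \<alpha> \<le> 2 * pi\<close>. Since \<open>0 / 0 = 0\<close>, the origin belongs to no box.\<close>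

definition carleson_box :: "real \<Rightarrow> real \<Rightarrow> complex set" where
  "carleson_box \<alpha> \<beta> =
    {z \<in> unit_disc. z / of_real (norm z) \<in> cis ` {\<alpha>..\<beta>} \<and> 1 - norm z \<le> \<beta> - \<alpha>}"

definition carleson_measure :: "complex measure \<Rightarrow> bool" where
  "carleson_measure \<mu> \<longleftrightarrow>
    (\<exists>C>0. \<forall>\<alpha> \<beta>. \<alpha> < \<beta> \<and> \<beta> - \<alpha> \<le> 2 * pi \<longrightarrow>
       emeasure \<mu> (carleson_box \<alpha> \<beta>) \<le> ennreal (C * (\<beta> - \<alpha>)))"

text \<open>\<open>\<Sum>\<^sub>j (1 - |a\<^sub>j|) \<delta>\<^bsub>a\<^sub>j\<^esub>\<close>, as the image under \<open>a\<close> of a weighted counting measure on \<open>J\<close>.\<close>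

definition zeros_measure :: "nat set \<Rightarrow> (nat \<Rightarrow> complex) \<Rightarrow> complex measure" where
  "zeros_measure J a = distr (point_measure J (\<lambda>j. ennreal (1 - norm (a j)))) borel a"

text \<open>Carleson--Newman property of the Blaschke product with zeros \<open>a\<^sub>j\<close>, \<open>j \<in> J\<close>.\<close>

definition carleson_newman :: "nat set \<Rightarrow> (nat \<Rightarrow> complex) \<Rightarrow> bool" where
  "carleson_newman J a \<longleftrightarrow> carleson_measure (zeros_measure J a)"

end

theory Submission
  imports Defs "HOL-Complex_Analysis.Complex_Analysis"
begin

text \<open>In the upper half-plane take the zeros \<open>j m\<^sup>3 + i m\<^sup>4\<close>, \<open>m \<ge> 1\<close>, \<open>j\<close> an integer. The row at height
  \<open>y = m\<^sup>4\<close> has spacing \<open>m\<^sup>3\<close>, so that the zeros become hyperbolically dense at infinity (hence no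
  Carleson condition), while \<open>\<Theta>\<close> is bounded below in each strip below all the zeros.

  The main tool replaces the corona theorem. Let \<open>e\<close> be bounded and analytic above some height and
  let \<open>\<Theta>\<close> be bounded below up to a greater height. Splitting \<open>e / \<Theta>\<close> on the strip in between into
  a bounded function above minus a bounded function below, \<open>e / \<Theta> = l - u\<close>, the functions
  \<open>e + \<Theta> u\<close> and \<open>\<Theta> l\<close> glue to a bounded function on the half-plane that agrees with \<open>e\<close> modulo
  \<open>\<Theta>\<close>, with norm at most a constant times that of \<open>e\<close>.

  WEP: if \<open>f\<close> is bounded below on the zeros, density makes it bounded below above some height, so
  \<open>1 / f\<close> extends modulo the product over the high zeros. The remaining zeros form an interpolating
  sequence, and inverses \<open>g\<close>, \<open>g'\<close> modulo two factors give the inverse \<open>g + g' - f g g'\<close> modulo the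
  product. SIP: if \<open>f\<close> is almost unimodular on the zeros, it is so above a small height \<open>\<nu>\<close>, hence
  \<open>g(w) = 1 / f(w + i\<nu>)\<close> has norm almost \<open>1\<close>, and \<open>1 - f g\<close> is small above height \<open>1/4\<close>; if \<open>E\<close>
  is its small extension modulo \<open>\<Theta>\<close>, then \<open>g / (1 - E)\<close> is an inverse of \<open>f\<close>.\<close>

section \<open>Normal families\<close>

text \<open>Montel's theorem with the bound carried over to the limit. Truncated objects (partial
  products and quotients, integrals over finite segments, finite interpolation sums) are passed to
  the limit in this way.\<close>

lemma Montel_bounded:
  fixes F :: "nat \<Rightarrow> complex \<Rightarrow> complex"
  assumes S: "open S" and hol: "\<And>n. F n holomorphic_on S"
    and bd: "\<And>n z. z \<in> S \<Longrightarrow> norm (F n z) \<le> M"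
  obtains g r where "g holomorphic_on S" "strict_mono (r :: nat \<Rightarrow> nat)"
    "\<And>z. z \<in> S \<Longrightarrow> (\<lambda>n. F (r n) z) \<longlonglongrightarrow> g z" "\<And>z. z \<in> S \<Longrightarrow> norm (g z) \<le> M"
proof -
  have bound: "\<exists>B. \<forall>h\<in>range F. \<forall>z\<in>K. norm (h z) \<le> B" if "compact K" "K \<subseteq> S" for K
    using bd that by (intro exI[of _ M]) auto
  have hol': "h holomorphic_on S" if "h \<in> range F" for h
    using hol that by auto
  obtain g r where g: "g holomorphic_on S" and r: "strict_mono (r :: nat \<Rightarrow> nat)"
    and lim: "\<And>z. z \<in> S \<Longrightarrow> (\<lambda>n. F (r n) z) \<longlonglongrightarrow> g z"
    by (rule Montel[OF S hol' bound order_refl]) blast+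
  have "norm (g z) \<le> M" if "z \<in> S" for z
    by (rule LIMSEQ_le_const2[OF tendsto_norm[OF lim[OF that]]]) (use bd that in auto)
  with g r lim that show thesis by blast
qed

section \<open>Blaschke factors and division\<close>

lemma one_minus_cnj_mult_nonzero:
  assumes "norm w < 1" "norm z < 1"
  shows "1 - cnj w * z \<noteq> 0"
proof
  assume "1 - cnj w * z = 0"
  then have "norm (cnj w * z) = 1" by simp
  moreover have "norm w * norm z < 1 * 1"
    using assms by (intro mult_strict_mono') auto
  ultimately show False by (simp add: norm_mult)
qed

lemma norm_blaschke_factor:
  "norm (blaschke_factor w z) = norm (w - z) / norm (1 - cnj w * z)"
  by (auto simp: blaschke_factor_def norm_mult norm_divide)

lemma one_minus_norm_blaschke_factor:
  assumes "norm w < 1" "norm z < 1"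
  shows "1 - (norm (blaschke_factor w z))\<^sup>2
    = (1 - (norm w)\<^sup>2) * (1 - (norm z)\<^sup>2) / (norm (1 - cnj w * z))\<^sup>2"
proof -
  have "(norm (1 - cnj w * z))\<^sup>2 - (norm (w - z))\<^sup>2 = (1 - (norm w)\<^sup>2) * (1 - (norm z)\<^sup>2)"
    unfolding cmod_power2 by (simp add: power2_eq_square algebra_simps)
  moreover have "norm (1 - cnj w * z) \<noteq> 0"
    using one_minus_cnj_mult_nonzero[OF assms] by simp
  ultimately show ?thesis
    by (simp add: norm_blaschke_factor power_divide field_simps)
qed

lemma norm_blaschke_factor_le_1:
  assumes "norm w < 1" "norm z < 1"
  shows "norm (blaschke_factor w z) \<le> 1"
proof -
  have "0 \<le> (1 - (norm w)\<^sup>2) * (1 - (norm z)\<^sup>2) / (norm (1 - cnj w * z))\<^sup>2"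
    using assms by (intro divide_nonneg_nonneg mult_nonneg_nonneg) (auto simp: abs_square_le_1)
  then have "(norm (blaschke_factor w z))\<^sup>2 \<le> 1"
    using one_minus_norm_blaschke_factor[OF assms] by linarith
  then show ?thesis by (simp add: abs_square_le_1)
qed

lemma blaschke_factor_eq_0_iff:
  assumes "norm w < 1" "norm z < 1"
  shows "blaschke_factor w z = 0 \<longleftrightarrow> z = w"
  using one_minus_cnj_mult_nonzero[OF assms] by (auto simp: blaschke_factor_def)

lemma blaschke_factor_holomorphic:
  assumes "norm w < 1"
  shows "blaschke_factor w holomorphic_on unit_disc"
proof (cases "w = 0")
  case True
  then show ?thesis by (simp add: blaschke_factor_def[abs_def])
next
  case False
  then have eq: "blaschke_factor w
      = (\<lambda>z. of_real (norm w) / w * ((w - z) / (1 - cnj w * z)))"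
    by (simp add: blaschke_factor_def fun_eq_iff)
  show ?thesis
    unfolding eq using assms one_minus_cnj_mult_nonzero[OF assms]
    by (intro holomorphic_intros) (auto simp: False)
qed

text \<open>The normalising constant \<open>norm w / w\<close> makes \<open>1 - norm w\<close> split
  off from \<open>1 - blaschke_factor w z\<close>. This is how the Blaschke condition enters the
  convergence of the product.\<close>

lemma norm_one_minus_blaschke_factor_le:
  assumes "norm w < 1" "norm z < 1"
  shows "norm (1 - blaschke_factor w z) \<le> (1 - norm w) * ((1 + norm z) / (1 - norm z))"
proof (cases "w = 0")
  case True
  have "norm (1 - z) \<le> 1 + norm z"
    using norm_triangle_ineq4[of 1 z] by simp
  also have "\<dots> \<le> (1 + norm z) / (1 - norm z)"
    using assms by (simp add: field_simps)
  finally show ?thesis using True by (simp add: blaschke_factor_def)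
next
  case False
  let ?r = "complex_of_real (norm w)"
  have nz: "1 - cnj w * z \<noteq> 0" by (rule one_minus_cnj_mult_nonzero[OF assms])
  have sq: "w * cnj w = ?r * ?r"
    by (simp add: complex_norm_square[symmetric] power2_eq_square[symmetric])
  have "1 - blaschke_factor w z = (w * (1 - cnj w * z) - ?r * (w - z)) / (w * (1 - cnj w * z))"
    using False nz by (simp add: blaschke_factor_def diff_divide_distrib[of "w * _"])
  also have "w * (1 - cnj w * z) - ?r * (w - z) = (1 - ?r) * (w + ?r * z)"
  proof -
    have "w * (1 - cnj w * z) = w - (w * cnj w) * z" by (simp add: algebra_simps)
    then show ?thesis unfolding sq by (simp add: algebra_simps)
  qed
  finally have eq: "norm (1 - blaschke_factor w z)
      = norm (1 - ?r) * norm (w + ?r * z) / (norm w * norm (1 - cnj w * z))"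
    by (simp add: norm_mult norm_divide)
  have 1: "norm (1 - ?r) = 1 - norm w"
    using assms by (metis norm_of_real of_real_1 of_real_diff abs_of_nonneg diff_ge_0_iff_ge less_imp_le)
  have 2: "norm (w + ?r * z) \<le> norm w * (1 + norm z)"
    using norm_triangle_ineq[of w "?r * z"] by (simp add: norm_mult algebra_simps)
  have "norm w * norm z \<le> norm z"
    using assms by (simp add: mult_left_le_one_le)
  then have 3: "1 - norm z \<le> norm (1 - cnj w * z)"
    using norm_triangle_ineq2[of 1 "cnj w * z"] by (simp add: norm_mult)
  have "norm (1 - blaschke_factor w z)
      \<le> (1 - norm w) * (norm w * (1 + norm z)) / (norm w * (1 - norm z))"
    unfolding eq 1 using assms False 2 3
    by (intro frac_le mult_left_mono mult_nonneg_nonneg mult_pos_pos) auto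
  also have "\<dots> = (1 - norm w) * ((1 + norm z) / (1 - norm z))"
    using False by simp
  finally show ?thesis .
qed

text \<open>The disc automorphism \<open>\<phi>\<close>, an involution, moves the zero
  \<open>a\<close> to the origin, where the Schwarz lemma allows division by \<open>z\<close>
  without increasing the bound.\<close>

lemma blaschke_factor_divide:
  assumes hol: "F holomorphic_on unit_disc" and bd: "\<And>z. norm z < 1 \<Longrightarrow> norm (F z) \<le> M"
    and a: "norm a < 1" and Fa: "F a = 0"
  obtains K where "K holomorphic_on unit_disc" "\<And>z. norm z < 1 \<Longrightarrow> norm (K z) \<le> M"
    "\<And>z. norm z < 1 \<Longrightarrow> F z = blaschke_factor a z * K z"
proof -
  define \<phi> where "\<phi> z = (a - z) / (1 - cnj a * z)" for z
  have nz: "1 - cnj a * z \<noteq> 0" if "norm z < 1" for z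
    using one_minus_cnj_mult_nonzero[OF a that] .
  have \<phi>_hol: "\<phi> holomorphic_on unit_disc"
    unfolding \<phi>_def using nz by (intro holomorphic_intros) auto
  have norm_\<phi>: "norm (\<phi> z) = norm (blaschke_factor a z)" for z
    by (simp add: norm_blaschke_factor \<phi>_def norm_divide)
  have na: "1 - cnj a * a \<noteq> 0" using nz[OF a] .
  have inv: "\<phi> (\<phi> z) = z" if "norm z < 1" for z
  proof -
    have 1: "a - \<phi> z = z * (1 - cnj a * a) / (1 - cnj a * z)"
      using nz[OF that] by (simp add: \<phi>_def field_simps)
    have 2: "1 - cnj a * \<phi> z = (1 - cnj a * a) / (1 - cnj a * z)"
      using nz[OF that] by (simp add: \<phi>_def field_simps)
    show ?thesis
      unfolding \<phi>_def[of "\<phi> z"] 1 2 using nz[OF that] na by simp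
  qed
  have \<phi>_less: "norm (\<phi> z) < 1" if "norm z < 1" for z
  proof -
    have "0 < (1 - (norm a)\<^sup>2) * (1 - (norm z)\<^sup>2) / (norm (1 - cnj a * z))\<^sup>2"
      using that a nz[OF that] by (intro divide_pos_pos mult_pos_pos) (auto simp: abs_square_less_1)
    then have "(norm (\<phi> z))\<^sup>2 < 1"
      using one_minus_norm_blaschke_factor[OF a that] norm_\<phi> by simp
    then show ?thesis by (simp add: abs_square_less_1)
  qed
  define G where "G z = F (\<phi> z)" for z
  have G_hol: "G holomorphic_on ball 0 1"
    unfolding G_def[abs_def]
    using holomorphic_on_compose_gen[OF \<phi>_hol hol] \<phi>_less by (force simp: o_def)
  have G0: "G 0 = 0" by (simp add: G_def \<phi>_def Fa)
  obtain h where h_hol: "h holomorphic_on ball 0 1"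
    and Gh: "\<And>z. norm z < 1 \<Longrightarrow> G z = z * h z" and h0: "deriv G 0 = h 0"
    using Schwarz3[OF G_hol G0] by auto
  have M: "0 \<le> M" using order_trans[OF norm_ge_zero bd[of 0]] by simp
  have h_bd: "norm (h z) \<le> M" if z: "norm z < 1" for z
  proof (rule field_le_epsilon)
    fix e :: real assume e: "0 < e"
    have pos: "0 < M + e" using M e by simp
    \<comment> \<open>The Schwarz lemma needs values in the open disc, hence the division by
      \<open>M + e\<close>. Away from 0 it bounds the quotient, at 0 the derivative, hence the case
      distinction below.\<close>
    define H where "H z = G z / of_real (M + e)" for z
    have H_hol: "H holomorphic_on ball 0 1"
      unfolding H_def[abs_def] using pos by (intro holomorphic_intros G_hol) (auto simp del: of_real_add)
    have H0: "H 0 = 0" by (simp add: H_def G0)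
    have nH: "norm (H z) < 1" if "norm z < 1" for z
      using bd[OF \<phi>_less[OF that]] pos e
      by (simp add: H_def G_def norm_divide field_simps del: of_real_add)
    note S = Schwarz_Lemma[OF H_hol H0 nH z]
    show "norm (h z) \<le> M + e"
    proof (cases "z = 0")
      case True
      have "deriv H 0 = deriv G 0 / of_real (M + e)"
        unfolding H_def[abs_def]
        by (rule deriv_cdivide_right) (use G_hol holomorphic_on_imp_differentiable_at in auto)
      then have "norm (h 0) = norm (deriv H 0) * (M + e)"
        using h0 pos by (simp add: norm_divide del: of_real_add)
      then show ?thesis using mult_right_mono[OF S(2), of "M + e"] True pos by simp
    next
      case False
      have "norm z * norm (h z) \<le> norm z * (M + e)"
        using S(1) Gh[OF z] pos
        by (simp add: H_def norm_divide norm_mult divide_le_eq del: of_real_add)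
      then show ?thesis by (rule mult_left_le_imp_le) (use False in simp)
    qed
  qed
  \<comment> \<open>The unimodular constant between \<open>\<phi>\<close> and the Blaschke factor.
    It is -1 for \<open>a = 0\<close>, where \<open>\<phi> z = - z\<close> but the factor is
    \<open>z\<close>.\<close>
  define u where "u = (if a = 0 then -1 else of_real (norm a) / a)"
  have u: "norm u = 1" by (simp add: u_def norm_divide)
  have bu: "blaschke_factor a z = u * \<phi> z" for z
    by (simp add: blaschke_factor_def u_def \<phi>_def)
  show thesis
  proof (rule that[of "\<lambda>z. h (\<phi> z) / u"])
    show "(\<lambda>z. h (\<phi> z) / u) holomorphic_on unit_disc"
      using holomorphic_on_compose_gen[OF \<phi>_hol h_hol] \<phi>_less u
      by (intro holomorphic_intros) (force simp: o_def)+
    show "norm (h (\<phi> z) / u) \<le> M" if "norm z < 1" for z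
      using h_bd[OF \<phi>_less[OF that]] u by (simp add: norm_divide)
    show "F z = blaschke_factor a z * (h (\<phi> z) / u)" if "norm z < 1" for z
    proof -
      have "F z = \<phi> z * h (\<phi> z)"
        using Gh[OF \<phi>_less[OF that]] inv[OF that] by (simp add: G_def)
      then show ?thesis using u by (auto simp: bu)
    qed
  qed
qed

section \<open>The Schwarz-Pick inequality\<close>

text \<open>Following \<open>F\<close> by the Moebius map that sends \<open>F a\<close> to 0 gives a
  function vanishing at \<open>a\<close>. Dividing out the Blaschke factor of \<open>a\<close>
  leaves a quotient of modulus at most 1.\<close>

lemma Schwarz_Pick_blaschke_factor:
  assumes hol: "F holomorphic_on unit_disc" and bd: "\<And>z. norm z < 1 \<Longrightarrow> norm (F z) < 1"
    and a: "norm a < 1" and z: "norm z < 1"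
  shows "norm (F z - F a) \<le> norm (blaschke_factor a z) * norm (1 - cnj (F a) * F z)"
proof -
  have nz: "1 - cnj (F a) * F z \<noteq> 0" if "norm z < 1" for z
    using one_minus_cnj_mult_nonzero[OF bd[OF a] bd[OF that]] .
  define H where "H z = (F z - F a) / (1 - cnj (F a) * F z)" for z
  have H_hol: "H holomorphic_on unit_disc"
    unfolding H_def using nz by (intro holomorphic_intros hol) auto
  have H_bd: "norm (H z) \<le> 1" if "norm z < 1" for z
    using norm_blaschke_factor_le_1[OF bd[OF a] bd[OF that]]
    by (simp add: H_def norm_blaschke_factor norm_divide norm_minus_commute)
  have Ha: "H a = 0" by (simp add: H_def)
  obtain K where "\<And>z. norm z < 1 \<Longrightarrow> norm (K z) \<le> 1"
    "\<And>z. norm z < 1 \<Longrightarrow> H z = blaschke_factor a z * K z"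
    by (rule blaschke_factor_divide[OF H_hol H_bd a Ha]) auto
  then have "norm (H z) \<le> norm (blaschke_factor a z)"
    using z by (simp add: norm_mult mult_left_le)
  then show ?thesis using nz[OF z]
    by (simp add: H_def norm_divide field_simps)
qed

lemma Schwarz_Pick_diff:
  assumes hol: "F holomorphic_on unit_disc" and bd: "\<And>z. norm z < 1 \<Longrightarrow> norm (F z) < 1"
    and a: "norm a < 1" and z: "norm z < 1"
  shows "norm (F z - F a) \<le> 2 * norm (blaschke_factor a z)"
proof -
  have "norm (F a) * norm (F z) \<le> 1 * 1"
    using bd[OF a] bd[OF z] by (intro mult_mono) auto
  then have "norm (1 - cnj (F a) * F z) \<le> 2"
    using norm_triangle_ineq4[of 1 "cnj (F a) * F z"] by (simp add: norm_mult)
  then have "norm (blaschke_factor a z) * norm (1 - cnj (F a) * F z) \<le> norm (blaschke_factor a z) * 2"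
    by (intro mult_left_mono) auto
  then show ?thesis using Schwarz_Pick_blaschke_factor[OF hol bd a z] by simp
qed

section \<open>Blaschke products\<close>

definition blaschke_partial :: "nat set \<Rightarrow> (nat \<Rightarrow> complex) \<Rightarrow> nat \<Rightarrow> complex \<Rightarrow> complex" where
  "blaschke_partial J a N z = (\<Prod>j<N. if j \<in> J then blaschke_factor (a j) z else 1)"

context
  fixes J :: "nat set" and a :: "nat \<Rightarrow> complex"
  assumes zeros: "blaschke_zeros J a"
begin

lemma blaschke_zeros_norm_less: "j \<in> J \<Longrightarrow> norm (a j) < 1"
  using zeros by (auto simp: blaschke_zeros_def)

lemma blaschke_product_convergent:
  assumes z: "norm z < 1"
  shows "convergent_prod (\<lambda>j. if j \<in> J then blaschke_factor (a j) z else 1)"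
proof -
  \<comment> \<open>Extension by 0 outside \<open>J\<close> turns unordered summability over
    \<open>J\<close> into convergence of a series.\<close>
  let ?f = "\<lambda>j. if j \<in> J then 1 - norm (a j) else 0"
  have "?f summable_on UNIV"
    using zeros by (subst summable_on_cong_neutral[where T = J]) (auto simp: blaschke_zeros_def)
  then have "summable ?f"
    using blaschke_zeros_norm_less less_imp_le
    by (subst (asm) summable_on_UNIV_nonneg_real_iff) auto
  then have "summable (\<lambda>j. ?f j * ((1 + norm z) / (1 - norm z)))"
    by (rule summable_mult2)
  then have "summable (\<lambda>j. norm ((if j \<in> J then blaschke_factor (a j) z else 1) - 1))"
    by (rule summable_comparison_test'[where N = 0])
      (auto simp: norm_minus_commute[of _ 1] simp del: times_divide_eq_right
        intro!: norm_one_minus_blaschke_factor_le blaschke_zeros_norm_less z)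
  then show ?thesis
    by (intro abs_convergent_prod_imp_convergent_prod summable_imp_abs_convergent_prod)
qed

lemma blaschke_partial_tendsto:
  assumes z: "norm z < 1"
  shows "(\<lambda>N. blaschke_partial J a N z) \<longlonglongrightarrow> blaschke_product J a z"
  using convergent_prod_LIMSEQ[OF blaschke_product_convergent[OF z]]
  unfolding blaschke_partial_def blaschke_product_def by (subst LIMSEQ_lessThan_iff_atMost)

lemma blaschke_partial_holomorphic: "blaschke_partial J a N holomorphic_on unit_disc"
  unfolding blaschke_partial_def
proof (intro holomorphic_intros)
  fix j
  show "(\<lambda>z. if j \<in> J then blaschke_factor (a j) z else 1) holomorphic_on unit_disc"
    using blaschke_factor_holomorphic[OF blaschke_zeros_norm_less[of j]] by (cases "j \<in> J") auto
qed

lemma norm_blaschke_partial_le_1: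
  assumes "norm z < 1"
  shows "norm (blaschke_partial J a N z) \<le> 1"
  unfolding blaschke_partial_def prod_norm[symmetric]
  using assms by (intro prod_le_1) (auto intro!: norm_blaschke_factor_le_1 blaschke_zeros_norm_less)

lemma norm_blaschke_product_le_1:
  assumes "norm z < 1"
  shows "norm (blaschke_product J a z) \<le> 1"
  by (rule LIMSEQ_le_const2[OF tendsto_norm[OF blaschke_partial_tendsto[OF assms]]])
    (use norm_blaschke_partial_le_1[OF assms] in auto)

text \<open>The partial products are bounded by 1, so a subsequence has a holomorphic limit, which
  must be the pointwise limit already known.\<close>

lemma blaschke_product_holomorphic: "blaschke_product J a holomorphic_on unit_disc"
proof -
  have bd: "norm (blaschke_partial J a n z) \<le> 1" if "z \<in> unit_disc" for n z
    using norm_blaschke_partial_le_1 that by simp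
  obtain g r where g: "g holomorphic_on unit_disc" and r: "strict_mono (r :: nat \<Rightarrow> nat)"
    and lim: "\<And>z. z \<in> unit_disc \<Longrightarrow> (\<lambda>n. blaschke_partial J a (r n) z) \<longlonglongrightarrow> g z"
    by (rule Montel_bounded[OF open_ball, where F = "blaschke_partial J a" and M = 1])
      (use blaschke_partial_holomorphic bd in auto)
  have "g z = blaschke_product J a z" if "z \<in> unit_disc" for z
  proof -
    have "(\<lambda>n. blaschke_partial J a (r n) z) \<longlonglongrightarrow> blaschke_product J a z"
      using LIMSEQ_subseq_LIMSEQ[OF blaschke_partial_tendsto r] that by (auto simp: o_def)
    with lim[OF that] show ?thesis by (rule LIMSEQ_unique)
  qed
  then show ?thesis using holomorphic_transform[OF g] by blast
qed

lemma blaschke_product_Hinf: "blaschke_product J a \<in> Hinf"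
  using blaschke_product_holomorphic norm_blaschke_product_le_1
  by (auto simp: Hinf_def bounded_iff intro!: exI[of _ 1])

lemma blaschke_product_zero:
  assumes "j \<in> J"
  shows "blaschke_product J a (a j) = 0"
proof -
  have n: "norm (a j) < 1" using blaschke_zeros_norm_less[OF assms] .
  have "blaschke_partial J a N (a j) = 0" if "N > j" for N
    using that assms n blaschke_factor_eq_0_iff[OF n n]
    by (auto simp: blaschke_partial_def intro!: prod_zero bexI[of _ j])
  then have "(\<lambda>N. blaschke_partial J a N (a j)) \<longlonglongrightarrow> 0"
    by (intro tendsto_eventually eventually_at_top_linorderI[of "Suc j"]) auto
  with blaschke_partial_tendsto[OF n] show ?thesis by (rule LIMSEQ_unique)
qed

lemma blaschke_zero_set: "a ` J \<subseteq> zero_set (blaschke_product J a)"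
  using blaschke_product_zero blaschke_zeros_norm_less by (auto simp: zero_set_def)

text \<open>For a squared modulus \<open>x\<close> with \<open>t \<le> x \<le> 1\<close> one has
  \<open>- ln x \<le> (1 - x) / x \<le> (1 - x) / t\<close>; these terms add up to at most
  \<open>\<sigma> / t\<close>.\<close>

lemma norm_blaschke_product_ge:
  assumes z: "norm z < 1" and t: "t > 0"
    and sep: "\<And>j. j \<in> J \<Longrightarrow> t \<le> (norm (blaschke_factor (a j) z))\<^sup>2"
    and sum: "\<And>I. finite I \<Longrightarrow> I \<subseteq> J \<Longrightarrow>
      (\<Sum>j\<in>I. 1 - (norm (blaschke_factor (a j) z))\<^sup>2) \<le> \<sigma>"
  shows "exp (- \<sigma> / t) \<le> (norm (blaschke_product J a z))\<^sup>2"
proof (rule LIMSEQ_le_const[OF tendsto_power[OF tendsto_norm[OF blaschke_partial_tendsto[OF z]]]])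
  have "exp (- \<sigma> / t) \<le> (norm (blaschke_partial J a N z))\<^sup>2" for N
  proof -
    let ?\<rho> = "\<lambda>j. (norm (blaschke_factor (a j) z))\<^sup>2"
    have fac: "exp (- (1 - ?\<rho> j) / t) \<le> ?\<rho> j" if "j \<in> J" for j
    proof -
      have pos: "0 < ?\<rho> j" using sep[OF that] t by linarith
      have "(1 - ?\<rho> j) / ?\<rho> j \<le> (1 - ?\<rho> j) / t"
        using sep[OF that] t pos norm_blaschke_factor_le_1[OF blaschke_zeros_norm_less[OF that] z]
        by (intro divide_left_mono) (auto simp: abs_square_le_1)
      moreover have "ln (1 / ?\<rho> j) \<le> 1 / ?\<rho> j - 1"
        using pos by (intro ln_le_minus_one) simp
      ultimately have "- (1 - ?\<rho> j) / t \<le> ln (?\<rho> j)"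
        using pos by (simp add: ln_div diff_divide_distrib)
      then show ?thesis using pos by (simp add: ln_ge_iff)
    qed
    have "(\<Sum>j\<in>J \<inter> {..<N}. 1 - ?\<rho> j) / t \<le> \<sigma> / t"
      using sum[of "J \<inter> {..<N}"] t by (intro divide_right_mono) auto
    then have "exp (- \<sigma> / t) \<le> exp (\<Sum>j\<in>J \<inter> {..<N}. - (1 - ?\<rho> j) / t)"
      unfolding sum_divide_distrib[symmetric] sum_negf by simp
    also have "\<dots> \<le> (\<Prod>j\<in>J \<inter> {..<N}. ?\<rho> j)"
      using fac by (subst exp_sum) (auto intro!: prod_mono)
    also have "\<dots> = (\<Prod>j<N. if j \<in> J then ?\<rho> j else 1)"
      by (subst Int_commute, subst prod.inter_restrict) auto
    also have "\<dots> = (norm (blaschke_partial J a N z))\<^sup>2"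
      unfolding blaschke_partial_def prod_norm[symmetric] prod_power_distrib
      by (intro prod.cong) auto
    finally show ?thesis .
  qed
  then show "\<exists>N. \<forall>n\<ge>N. exp (- \<sigma> / t) \<le> (norm (blaschke_partial J a n z))\<^sup>2" by blast
qed

text \<open>The zeros are divided out one at a time, at no cost in the bound, and the quotients have
  a normal-family limit. Since \<open>a\<close> is injective on \<open>J\<close>, the prescribed
  zeros are simple, so vanishing at each point is enough.\<close>

lemma blaschke_product_divide:
  assumes inj: "inj_on a J"
    and hol: "F holomorphic_on unit_disc" and bd: "\<And>z. norm z < 1 \<Longrightarrow> norm (F z) \<le> M"
    and F0: "\<And>j. j \<in> J \<Longrightarrow> F (a j) = 0"
  obtains K where "K holomorphic_on unit_disc" "\<And>z. norm z < 1 \<Longrightarrow> norm (K z) \<le> M"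
    "\<And>z. norm z < 1 \<Longrightarrow> F z = blaschke_product J a z * K z"
proof -
  define P where "P N K \<longleftrightarrow> K holomorphic_on unit_disc
    \<and> (\<forall>z. norm z < 1 \<longrightarrow> norm (K z) \<le> M)
    \<and> (\<forall>z. norm z < 1 \<longrightarrow> F z = blaschke_partial J a N z * K z)" for N K
  have "\<exists>K. P N K" for N
  proof (induction N)
    case 0
    have "P 0 F" using hol bd by (simp add: P_def blaschke_partial_def)
    then show ?case by blast
  next
    case (Suc N)
    then obtain K where "P N K" by blast
    then have K: "K holomorphic_on unit_disc" "\<And>z. norm z < 1 \<Longrightarrow> norm (K z) \<le> M"
      "\<And>z. norm z < 1 \<Longrightarrow> F z = blaschke_partial J a N z * K z"
      by (simp_all add: P_def)
    show ?case
    proof (cases "N \<in> J")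
      case False
      then have "P (Suc N) K" using K by (simp add: P_def blaschke_partial_def)
      then show ?thesis by blast
    next
      case True
      note aN = blaschke_zeros_norm_less[OF True]
      \<comment> \<open>The factors already divided out do not vanish at \<open>a N\<close>, so
        \<open>K\<close> inherits the zero of \<open>F\<close> there.\<close>
      have "blaschke_factor (a j) (a N) \<noteq> 0" if "j \<in> J" "j < N" for j
        using blaschke_factor_eq_0_iff[OF blaschke_zeros_norm_less[OF that(1)] aN]
          inj_onD[OF inj, of N j] True that by auto
      then have "blaschke_partial J a N (a N) \<noteq> 0"
        by (simp add: blaschke_partial_def)
      then have KaN: "K (a N) = 0" using K(3)[OF aN] F0[OF True] by simp
      show ?thesis
      proof (rule blaschke_factor_divide[OF K(1,2) aN KaN])
        fix K'
        assume "K' holomorphic_on unit_disc" "\<And>z. norm z < 1 \<Longrightarrow> norm (K' z) \<le> M"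
          "\<And>z. norm z < 1 \<Longrightarrow> K z = blaschke_factor (a N) z * K' z"
        then have "P (Suc N) K'" using K(3) True
          by (simp add: P_def blaschke_partial_def)
        then show ?thesis by blast
      qed
    qed
  qed
  then obtain K where "\<And>N. P N (K N)" by metis
  then have K: "\<And>N. K N holomorphic_on unit_disc"
    "\<And>N z. norm z < 1 \<Longrightarrow> norm (K N z) \<le> M"
    "\<And>N z. norm z < 1 \<Longrightarrow> F z = blaschke_partial J a N z * K N z"
    by (simp_all add: P_def)
  have KM: "norm (K N z) \<le> M" if "z \<in> unit_disc" for N z
    using K(2) that by simp
  obtain k r where k: "k holomorphic_on unit_disc" and r: "strict_mono (r :: nat \<Rightarrow> nat)"
    and lim: "\<And>z. z \<in> unit_disc \<Longrightarrow> (\<lambda>n. K (r n) z) \<longlonglongrightarrow> k z"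
    and kM: "\<And>z. z \<in> unit_disc \<Longrightarrow> norm (k z) \<le> M"
    by (rule Montel_bounded[OF open_ball, where F = K and M = M]) (use K KM in auto)
  have "F z = blaschke_product J a z * k z" if z: "norm z < 1" for z
  proof -
    have "(\<lambda>n. blaschke_partial J a (r n) z * K (r n) z) \<longlonglongrightarrow> blaschke_product J a z * k z"
      using LIMSEQ_subseq_LIMSEQ[OF blaschke_partial_tendsto[OF z] r] lim z
      by (intro tendsto_mult) (auto simp: o_def)
    then have "(\<lambda>n. F z) \<longlonglongrightarrow> blaschke_product J a z * k z"
      using K(3)[OF z] by simp
    then show ?thesis by (simp add: LIMSEQ_const_iff)
  qed
  with k kM that show thesis by auto
qed

end

lemma blaschke_zeros_subset:
  assumes "blaschke_zeros J a" "I \<subseteq> J"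
  shows "blaschke_zeros I a"
  using assms by (auto simp: blaschke_zeros_def intro: summable_on_subset_banach)

lemma blaschke_product_union:
  assumes "blaschke_zeros (I \<union> J) a" "I \<inter> J = {}" "norm z < 1"
  shows "blaschke_product (I \<union> J) a z = blaschke_product I a z * blaschke_product J a z"
proof -
  have "blaschke_zeros I a" "blaschke_zeros J a"
    using assms blaschke_zeros_subset by blast+
  note c = this[THEN blaschke_product_convergent, OF assms(3)]
  show ?thesis
    unfolding blaschke_product_def prodinf_mult[OF c]
    using assms(2) by (intro arg_cong[where f = prodinf] ext) auto
qed

section \<open>Splitting a bounded function on a strip\<close>

lemma Re_Im_linepath_horizontal:
  "Re (linepath (Complex a \<sigma>) (Complex b \<sigma>) x) = a + (b - a) * x"
  "Im (linepath (Complex a \<sigma>) (Complex b \<sigma>) x) = \<sigma>"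
  by (simp_all add: linepath_def algebra_simps)

lemma closed_segment_horizontal:
  assumes "z \<in> closed_segment (Complex a \<sigma>) (Complex b \<sigma>)"
  shows "Im z = \<sigma>"
  using assms Re_Im_linepath_horizontal(2)[of a \<sigma> b] linepath_image_01
  by (metis imageE)

lemma closed_segment_vertical:
  assumes "z \<in> closed_segment (Complex a \<sigma>) (Complex a \<tau>)"
  shows "Re z = a" "Im z \<in> closed_segment \<sigma> \<tau>"
proof -
  from assms obtain u where "0 \<le> u" "u \<le> 1" "z = (1 - u) *\<^sub>R Complex a \<sigma> + u *\<^sub>R Complex a \<tau>"
    by (auto simp: in_segment)
  then show "Re z = a" "Im z \<in> closed_segment \<sigma> \<tau>"
    by (auto simp: in_segment left_diff_distrib intro!: exI[of _ u])
qed

text \<open>The majorant has an arctangent as primitive and total mass \<open>C * pi / g\<close>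
  over the whole line, whence a bound independent of the length of the segment.\<close>

lemma norm_contour_integral_horizontal_le:
  assumes cont: "continuous_on (closed_segment (Complex a \<sigma>) (Complex b \<sigma>)) f"
    and ab: "a < b" and g: "g > 0" and C: "C \<ge> 0"
    and bd: "\<And>z. Im z = \<sigma> \<Longrightarrow> norm (f z) \<le> C / ((Re z - x)\<^sup>2 + g\<^sup>2)"
  shows "norm (contour_integral (linepath (Complex a \<sigma>) (Complex b \<sigma>)) f) \<le> C * pi / g"
proof -
  define l where "l = linepath (Complex a \<sigma>) (Complex b \<sigma>)"
  define u where "u s = (a + (b - a) * s - x) / g" for s
  define I where "I = contour_integral l f"
  have "(f has_contour_integral I) l"
    unfolding I_def l_def
    by (intro has_contour_integral_integral contour_integrable_continuous_linepath cont)
  then have int: "((\<lambda>s. f (l s) * (Complex b \<sigma> - Complex a \<sigma>)) has_integral I) {0..1}"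
    by (simp add: has_contour_integral_linepath l_def)
  have nba: "norm (Complex b \<sigma> - Complex a \<sigma>) = b - a"
    using ab by (simp add: cmod_def)
  have deriv: "((\<lambda>s. C / g * arctan (u s)) has_vector_derivative
      C * (b - a) / ((a + (b - a) * s - x)\<^sup>2 + g\<^sup>2)) (at s within {0..1})" for s
  proof -
    have gu: "g\<^sup>2 * (1 + (u s)\<^sup>2) = (a + (b - a) * s - x)\<^sup>2 + g\<^sup>2"
      using g by (simp add: u_def power_divide algebra_simps)
    have pos: "1 + (u s)\<^sup>2 \<noteq> 0" by (smt (verit) zero_le_power2)
    have "((\<lambda>s. C / g * arctan (u s)) has_real_derivative
      C / g * (inverse (1 + (u s)\<^sup>2) * ((b - a) / g))) (at s within {0..1})"
      unfolding u_def using g by (auto intro!: derivative_eq_intros)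
    also have "C / g * (inverse (1 + (u s)\<^sup>2) * ((b - a) / g))
        = C * (b - a) / (g\<^sup>2 * (1 + (u s)\<^sup>2))"
      using g pos by (simp add: field_simps power2_eq_square)
    finally show ?thesis
      unfolding gu by (simp add: has_real_derivative_iff_has_vector_derivative)
  qed
  have FTC: "((\<lambda>s. C * (b - a) / ((a + (b - a) * s - x)\<^sup>2 + g\<^sup>2)) has_integral
      (C / g * arctan (u 1) - C / g * arctan (u 0))) {0..1}"
    using deriv by (intro fundamental_theorem_of_calculus) auto
  have "norm (f (l s) * (Complex b \<sigma> - Complex a \<sigma>))
      \<le> C * (b - a) / ((a + (b - a) * s - x)\<^sup>2 + g\<^sup>2)" for s
  proof -
    have "norm (f (l s)) \<le> C / ((a + (b - a) * s - x)\<^sup>2 + g\<^sup>2)"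
      using bd[of "l s"] by (simp add: l_def Re_Im_linepath_horizontal)
    from mult_right_mono[OF this, of "b - a"] show ?thesis
      using ab by (simp add: norm_mult nba)
  qed
  then have "norm (integral {0..1} (\<lambda>s. f (l s) * (Complex b \<sigma> - Complex a \<sigma>)))
      \<le> integral {0..1} (\<lambda>s. C * (b - a) / ((a + (b - a) * s - x)\<^sup>2 + g\<^sup>2))"
    using int FTC
    by (intro Henstock_Kurzweil_Integration.integral_norm_bound_integral) (auto simp: integrable_on_def)
  also have "\<dots> = C / g * (arctan (u 1) - arctan (u 0))"
    using integral_unique[OF FTC] by (simp add: right_diff_distrib)
  also have "\<dots> \<le> C / g * pi"
    using arctan_bounded[of "u 1"] arctan_bounded[of "u 0"] g C by (intro mult_left_mono) auto
  finally show ?thesis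
    using integral_unique[OF int] by (simp add: I_def l_def)
qed

text \<open>The Cauchy kernel, modified so as to decay quadratically. Its second pole \<open>\<zeta> = w + 2it\<close> lies
  above every contour that is used, so that it still reproduces holomorphic functions.\<close>

definition strip_kernel :: "real \<Rightarrow> complex \<Rightarrow> complex \<Rightarrow> complex" where
  "strip_kernel t w \<zeta> = 2 * \<i> * of_real t / ((\<zeta> - w) * (2 * \<i> * of_real t - (\<zeta> - w)))"

text \<open>A Cauchy-type integral over a whole horizontal line, cut off at real parts
  \<open>-R\<close> and \<open>R\<close> so that only segments occur; \<open>R\<close> tends to
  infinity in \<open>strip_splitting\<close>.\<close>

definition strip_integral ::
    "(complex \<Rightarrow> complex) \<Rightarrow> real \<Rightarrow> real \<Rightarrow> real \<Rightarrow> complex \<Rightarrow> complex" where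
  "strip_integral \<phi> t \<sigma> R w =
    contour_integral (linepath (Complex (-R) \<sigma>) (Complex R \<sigma>)) (\<lambda>\<zeta>. \<phi> \<zeta> * strip_kernel t w \<zeta>)"

lemma continuous_on_strip_kernel:
  assumes "continuous_on A \<phi>" "\<And>\<zeta>. \<zeta> \<in> A \<Longrightarrow> \<zeta> \<noteq> w" "\<And>\<zeta>. \<zeta> \<in> A \<Longrightarrow> Im \<zeta> < 2 * t + Im w"
  shows "continuous_on A (\<lambda>\<zeta>. \<phi> \<zeta> * strip_kernel t w \<zeta>)"
proof -
  have "2 * \<i> * complex_of_real t - (\<zeta> - w) \<noteq> 0" if "\<zeta> \<in> A" for \<zeta>
    using assms(3)[OF that] by (auto simp: complex_eq_iff)
  then show ?thesis
    unfolding strip_kernel_def using assms(1,2) by (intro continuous_intros) auto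
qed

text \<open>Both poles have vertical distance at least \<open>g\<close> from the line at height
  \<open>\<sigma>\<close>: the pole \<open>w\<close> by hypothesis, the upper one because
  \<open>2 * t - \<sigma> + Im w \<ge> t \<ge> g\<close>. So each factor of the denominator has
  squared modulus at least \<open>D\<close>.\<close>

lemma norm_strip_kernel_le:
  assumes g: "0 < g" "g \<le> t" and d: "g \<le> \<bar>\<sigma> - Im w\<bar>" "\<sigma> \<le> t" "0 \<le> Im w" and z: "Im \<zeta> = \<sigma>"
  shows "norm (strip_kernel t w \<zeta>) \<le> 2 * t / ((Re \<zeta> - Re w)\<^sup>2 + g\<^sup>2)"
proof -
  define D where "D = (Re \<zeta> - Re w)\<^sup>2 + g\<^sup>2"
  define v where "v = 2 * \<i> * complex_of_real t - (\<zeta> - w)"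
  have D: "D > 0" using g by (simp add: D_def add_nonneg_pos)
  have "g\<^sup>2 \<le> (\<sigma> - Im w)\<^sup>2" using g d by (simp add: abs_le_square_iff[symmetric])
  then have 1: "D \<le> (norm (\<zeta> - w))\<^sup>2" by (simp add: D_def cmod_power2 z)
  have "g\<^sup>2 \<le> (2 * t - \<sigma> + Im w)\<^sup>2" using g d by (intro power_mono) auto
  then have 2: "D \<le> (norm v)\<^sup>2"
    by (simp add: D_def v_def cmod_power2 z algebra_simps power2_commute[of "Re w"])
  have "D * D \<le> (norm (\<zeta> - w))\<^sup>2 * (norm v)\<^sup>2"
    using 1 2 D by (intro mult_mono) auto
  then have "D\<^sup>2 \<le> (norm (\<zeta> - w) * norm v)\<^sup>2"
    by (simp add: power_mult_distrib power2_eq_square[of D])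
  then have "D \<le> norm (\<zeta> - w) * norm v"
    by (rule power2_le_imp_le) simp
  then have "2 * t / (norm (\<zeta> - w) * norm v) \<le> 2 * t / D"
    using D g by (intro divide_left_mono mult_pos_pos) auto
  then show ?thesis
    using g by (simp add: strip_kernel_def norm_divide norm_mult D_def v_def)
qed

text \<open>By partial fractions the integral is the Cauchy integral \<open>C\<close> at
  \<open>w\<close> minus \<open>C\<close> at \<open>w + 2 * \<i> * of_real t\<close>. The second
  point always lies above the line at height \<open>\<sigma>\<close>, so only \<open>w\<close>
  itself has to avoid it.\<close>

lemma strip_integral_holomorphic:
  assumes cont: "continuous_on {\<zeta>. Im \<zeta> = \<sigma>} \<phi>" and \<sigma>: "\<sigma> \<le> t" "0 < t"
  shows "strip_integral \<phi> t \<sigma> R holomorphic_on {w. 0 \<le> Im w \<and> Im w \<noteq> \<sigma>}"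
proof -
  define l where "l = linepath (Complex (-R) \<sigma>) (Complex R \<sigma>)"
  define C where "C w = contour_integral l (\<lambda>\<zeta>. \<phi> \<zeta> / (\<zeta> - w))" for w
  have Im_l: "Im z = \<sigma>" if "z \<in> path_image l" for z
    using that closed_segment_horizontal by (auto simp: l_def)
  have cont_l: "continuous_on (path_image l) \<phi>"
    using Im_l by (intro continuous_on_subset[OF cont]) auto
  have intg: "(\<lambda>\<zeta>. \<phi> \<zeta> / (\<zeta> - w)) contour_integrable_on l" if "w \<notin> path_image l" for w
    unfolding l_def using that cont_l
    by (intro contour_integrable_continuous_linepath continuous_intros) (auto simp: l_def)
  have diff: "C field_differentiable at w" if "w \<notin> path_image l" for w
  proof -
    have "(C has_field_derivative
        of_nat 1 * contour_integral l (\<lambda>\<zeta>. \<phi> \<zeta> / (\<zeta> - w) ^ Suc 1)) (at w)"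
    proof (rule Cauchy_next_derivative(2)[OF cont_l, where S = UNIV])
      show "((\<lambda>u. \<phi> u / (u - w) ^ 1) has_contour_integral C w) l"
        if "w \<in> UNIV - path_image l" for w
        unfolding C_def using has_contour_integral_integral[OF intg] that by simp
      show "norm (vector_derivative l (at s)) \<le> norm (Complex R \<sigma> - Complex (-R) \<sigma>)" for s
        by (simp add: l_def)
    qed (use that in \<open>auto simp: l_def\<close>)
    then show ?thesis by (auto simp: field_differentiable_def)
  qed
  have eq: "strip_integral \<phi> t \<sigma> R w = C w - C (w + 2 * \<i> * of_real t)"
    if "0 \<le> Im w" "Im w \<noteq> \<sigma>" for w
  proof -
    have w1: "w \<notin> path_image l" using Im_l[of w] that by auto
    have w2: "w + 2 * \<i> * of_real t \<notin> path_image l"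
      using Im_l[of "w + 2 * \<i> * of_real t"] that \<sigma> by auto
    have "strip_integral \<phi> t \<sigma> R w
        = contour_integral l (\<lambda>\<zeta>. \<phi> \<zeta> / (\<zeta> - w) - \<phi> \<zeta> / (\<zeta> - (w + 2 * \<i> * of_real t)))"
      unfolding strip_integral_def l_def
    proof (rule contour_integral_eq)
      fix \<zeta> assume "\<zeta> \<in> path_image (linepath (Complex (-R) \<sigma>) (Complex R \<sigma>))"
      then have "\<zeta> \<in> path_image l" by (simp add: l_def)
      then have nz: "\<zeta> - w \<noteq> 0" "2 * \<i> * of_real t - (\<zeta> - w) \<noteq> 0"
        using w1 w2 by (auto simp: algebra_simps)
      have "\<zeta> - (w + 2 * \<i> * of_real t) = - (2 * \<i> * of_real t - (\<zeta> - w))" by simp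
      then have "\<phi> \<zeta> / (\<zeta> - w) - \<phi> \<zeta> / (\<zeta> - (w + 2 * \<i> * of_real t))
          = \<phi> \<zeta> * (1 / (\<zeta> - w) + 1 / (2 * \<i> * of_real t - (\<zeta> - w)))"
        by (simp only: divide_minus_right) (simp add: algebra_simps)
      also have "1 / (\<zeta> - w) + 1 / (2 * \<i> * of_real t - (\<zeta> - w)) = strip_kernel t w \<zeta>"
        using nz by (simp add: strip_kernel_def add_frac_eq)
      finally show "\<phi> \<zeta> * strip_kernel t w \<zeta>
          = \<phi> \<zeta> / (\<zeta> - w) - \<phi> \<zeta> / (\<zeta> - (w + 2 * \<i> * of_real t))" ..
    qed
    also have "\<dots> = C w - C (w + 2 * \<i> * of_real t)"
      unfolding C_def by (intro contour_integral_diff intg w1 w2)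
    finally show ?thesis .
  qed
  have "(\<lambda>w. C w - C (w + 2 * \<i> * of_real t)) holomorphic_on {w. 0 \<le> Im w \<and> Im w \<noteq> \<sigma>}"
  proof (intro holomorphic_on_diff)
    show "C holomorphic_on {w. 0 \<le> Im w \<and> Im w \<noteq> \<sigma>}"
      unfolding holomorphic_on_def
    proof
      fix w assume "w \<in> {w. 0 \<le> Im w \<and> Im w \<noteq> \<sigma>}"
      then have "w \<notin> path_image l" using Im_l[of w] by auto
      then show "C field_differentiable at w within {w. 0 \<le> Im w \<and> Im w \<noteq> \<sigma>}"
        by (rule field_differentiable_at_within[OF diff])
    qed
    have 1: "C holomorphic_on {w. Im w > \<sigma>}"
      unfolding holomorphic_on_def
    proof
      fix w assume "w \<in> {w. Im w > \<sigma>}"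
      then have "w \<notin> path_image l" using Im_l[of w] by auto
      then show "C field_differentiable at w within {w. Im w > \<sigma>}"
        by (rule field_differentiable_at_within[OF diff])
    qed
    have 2: "(\<lambda>w. w + 2 * \<i> * of_real t) ` {w. 0 \<le> Im w \<and> Im w \<noteq> \<sigma>} \<subseteq> {w. Im w > \<sigma>}"
      using \<sigma> by auto
    have 3: "(\<lambda>w. w + 2 * \<i> * of_real t) holomorphic_on {w. 0 \<le> Im w \<and> Im w \<noteq> \<sigma>}"
      by (intro holomorphic_intros)
    show "(\<lambda>w. C (w + 2 * \<i> * of_real t)) holomorphic_on {w. 0 \<le> Im w \<and> Im w \<noteq> \<sigma>}"
      using holomorphic_on_compose_gen[OF 3 1 2] by (simp add: o_def)
  qed
  then show ?thesis
    by (rule holomorphic_transform) (use eq in auto)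
qed

text \<open>The bound does not involve \<open>R\<close>, so it survives the passage to the full
  line.\<close>

lemma norm_strip_integral_le:
  assumes cont: "continuous_on {\<zeta>. Im \<zeta> = \<sigma>} \<phi>" and bd: "\<And>\<zeta>. Im \<zeta> = \<sigma> \<Longrightarrow> norm (\<phi> \<zeta>) \<le> M"
    and g: "0 < g" "g \<le> t" and d: "g \<le> \<bar>\<sigma> - Im w\<bar>" "\<sigma> \<le> t" "0 \<le> Im w" and R: "R > 0"
  shows "norm (strip_integral \<phi> t \<sigma> R w) \<le> M * (2 * t) * pi / g"
  unfolding strip_integral_def
proof (rule norm_contour_integral_horizontal_le)
  have Im_l: "Im z = \<sigma>" if "z \<in> closed_segment (Complex (-R) \<sigma>) (Complex R \<sigma>)" for z
    using closed_segment_horizontal[OF that] .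
  have "continuous_on (closed_segment (Complex (-R) \<sigma>) (Complex R \<sigma>)) \<phi>"
    using Im_l by (intro continuous_on_subset[OF cont]) auto
  then show "continuous_on (closed_segment (Complex (-R) \<sigma>) (Complex R \<sigma>))
      (\<lambda>\<zeta>. \<phi> \<zeta> * strip_kernel t w \<zeta>)"
    by (rule continuous_on_strip_kernel) (use Im_l g d in fastforce)+
  have M: "0 \<le> M" using bd[of "Complex 0 \<sigma>"] order_trans[OF norm_ge_zero] by fastforce
  then show "0 \<le> M * (2 * t)" using g by simp
  show "norm (\<phi> z * strip_kernel t w z) \<le> M * (2 * t) / ((Re z - Re w)\<^sup>2 + g\<^sup>2)"
    if "Im z = \<sigma>" for z
    using mult_mono[OF bd[OF that] norm_strip_kernel_le[OF g d that] M] by (simp add: norm_mult)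
qed (use g R in auto)

text \<open>Cauchy's formula on the rectangle between heights \<open>s\<close> and \<open>t\<close>
  and real parts \<open>-R\<close> and \<open>R\<close>. The horizontal sides give the two strip
  integrals; the vertical sides are the error, small by the quadratic decay of the kernel. The bound
  \<open>t\<^sub>0 \<le> 2 * t\<close> keeps the second pole out of the strip
  \<open>S\<close>.\<close>

lemma strip_integral_diff:
  assumes hol: "\<phi> holomorphic_on {w. s\<^sub>0 < Im w \<and> Im w < t\<^sub>0}"
    and bd: "\<And>w. s\<^sub>0 < Im w \<Longrightarrow> Im w < t\<^sub>0 \<Longrightarrow> norm (\<phi> w) \<le> M"
    and s: "0 \<le> s\<^sub>0" "s\<^sub>0 < s" "s < t" "t < t\<^sub>0" "t\<^sub>0 \<le> 2 * t"
    and w: "s < Im w" "Im w < t" and R: "\<bar>Re w\<bar> < R"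
  shows "norm (strip_integral \<phi> t s R w - strip_integral \<phi> t t R w - 2 * pi * \<i> * \<phi> w)
    \<le> 4 * M * t * (t - s) / (R - \<bar>Re w\<bar>)\<^sup>2"
proof -
  define S where "S = {w. s\<^sub>0 < Im w \<and> Im w < t\<^sub>0}"
  define f where "f \<zeta> = \<phi> \<zeta> * strip_kernel t w \<zeta>" for \<zeta>
  define p where "p = Complex (-R) s"
  define q where "q = Complex R s"
  define p' where "p' = Complex (-R) t"
  define q' where "q' = Complex R t"
  define K where "K = M * (2 * t) / (R - \<bar>Re w\<bar>)\<^sup>2"
  have Rw: "0 < R - \<bar>Re w\<bar>" "R > 0" using R by linarith+
  have "convex S"
    unfolding S_def using convex_Int[OF convex_halfspace_Im_gt convex_halfspace_Im_lt] by (simp add: Collect_conj_eq)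
  have "open S"
    unfolding S_def by (simp add: Collect_conj_eq open_Int open_halfspace_Im_gt open_halfspace_Im_lt)
  have wS: "w \<in> S" using w s by (simp add: S_def)
  have M: "0 \<le> M" using order_trans[OF norm_ge_zero bd[of w]] w s by simp
  have K: "0 \<le> K" using M s by (simp add: K_def)
  have nz: "2 * \<i> * complex_of_real t - (\<zeta> - w) \<noteq> 0" if "\<zeta> \<in> S" for \<zeta>
    using that s w by (auto simp: S_def complex_eq_iff)
  have cont: "continuous_on A f" if "A \<subseteq> S" "w \<notin> A" for A
    unfolding f_def
  proof (rule continuous_on_strip_kernel)
    show "continuous_on A \<phi>"
      using that holomorphic_on_imp_continuous_on[OF hol] by (auto simp: S_def intro: continuous_on_subset)
  qed (use that w s in \<open>auto simp: S_def\<close>)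
  have side_bd: "norm (f \<zeta>) \<le> K" if "\<zeta> \<in> S" "\<bar>Re \<zeta>\<bar> = R" for \<zeta>
  proof -
    have 1: "R - \<bar>Re w\<bar> \<le> norm (\<zeta> - w)"
      using abs_Re_le_cmod[of "\<zeta> - w"] that by simp
    have 2: "R - \<bar>Re w\<bar> \<le> norm (2 * \<i> * complex_of_real t - (\<zeta> - w))"
      using abs_Re_le_cmod[of "2 * \<i> * complex_of_real t - (\<zeta> - w)"] that by simp
    have "norm (strip_kernel t w \<zeta>) \<le> 2 * t / (R - \<bar>Re w\<bar>)\<^sup>2"
      unfolding strip_kernel_def norm_divide norm_mult power2_eq_square
      using Rw s 1 2 by (intro frac_le mult_mono) auto
    moreover have "norm (\<phi> \<zeta>) \<le> M" using that bd by (simp add: S_def)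
    ultimately show ?thesis
      using mult_mono[of "norm (\<phi> \<zeta>)" M "norm (strip_kernel t w \<zeta>)" "2 * t / (R - \<bar>Re w\<bar>)\<^sup>2"] M
      by (simp add: f_def norm_mult K_def)
  qed
  have seg: "closed_segment p q \<subseteq> S - {w}" "closed_segment p' q' \<subseteq> S - {w}"
    "closed_segment q q' \<subseteq> S - {w}" "closed_segment p' p \<subseteq> S - {w}"
    using w s R closed_segment_horizontal closed_segment_vertical
    by (fastforce simp: S_def p_def q_def p'_def q'_def closed_segment_eq_real_ivl)+
  have sides: "\<bar>Re \<zeta>\<bar> = R" if "\<zeta> \<in> closed_segment q q' \<union> closed_segment p' p" for \<zeta>
    using that Rw closed_segment_vertical(1) by (force simp: p_def q_def p'_def q'_def)
  note cf = cont[of "closed_segment _ _"]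
  have int: "f contour_integrable_on linepath p q" "f contour_integrable_on linepath q' p'"
    "f contour_integrable_on linepath q q'" "f contour_integrable_on linepath p' p"
    using seg closed_segment_commute[of p' q']
    by (auto intro!: contour_integrable_continuous_linepath cf)
  \<comment> \<open>The integrand \<open>f\<close> freed of its pole at \<open>w\<close>, so that
    Cauchy's formula applies; the kernel is normalised so that
    \<open>\<psi> w = \<phi> w\<close>.\<close>
  define \<psi> where "\<psi> \<zeta> = \<phi> \<zeta> * (2 * \<i> * of_real t) / (2 * \<i> * of_real t - (\<zeta> - w))" for \<zeta>
  have \<psi>_hol: "\<psi> holomorphic_on S"
    unfolding \<psi>_def using nz hol by (intro holomorphic_intros) (auto simp: S_def)
  have rect: "rectpath p q' = linepath p q +++ linepath q q' +++ linepath q' p' +++ linepath p' p"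
    by (simp add: rectpath_def Let_def p_def q_def p'_def q'_def)
  have "((\<lambda>\<zeta>. \<psi> \<zeta> / (\<zeta> - w)) has_contour_integral
      (2 * pi * \<i> * winding_number (rectpath p q') w * \<psi> w)) (rectpath p q')"
  proof (rule Cauchy_integral_formula_convex_simple[OF \<open>convex S\<close> \<psi>_hol])
    show "w \<in> interior S" using wS \<open>open S\<close> by (simp add: interior_open)
    have "path_image (rectpath p q')
        = closed_segment p q \<union> closed_segment q q' \<union> closed_segment q' p' \<union> closed_segment p' p"
      by (simp add: rect path_image_join Un_assoc)
    then show "path_image (rectpath p q') \<subseteq> S - {w}"
      using seg closed_segment_commute[of p' q'] by auto
  qed auto
  moreover have "winding_number (rectpath p q') w = 1"
    using w R by (intro winding_number_rectpath) (auto simp: in_box_complex_iff p_def q'_def)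
  moreover have "\<psi> w = \<phi> w" using s by (simp add: \<psi>_def)
  moreover have "\<psi> \<zeta> / (\<zeta> - w) = f \<zeta>" for \<zeta>
    by (simp add: \<psi>_def f_def strip_kernel_def mult.commute)
  ultimately have "contour_integral (rectpath p q') f = 2 * pi * \<i> * \<phi> w"
    by (simp add: contour_integral_unique)
  moreover have "contour_integral (rectpath p q') f
    = contour_integral (linepath p q) f + contour_integral (linepath q q') f
      + contour_integral (linepath q' p') f + contour_integral (linepath p' p) f"
    unfolding rect using int by (simp add: contour_integrable_join)
  moreover have "contour_integral (linepath q' p') f = - contour_integral (linepath p' q') f"
    using seg closed_segment_commute[of p' q'] by (intro contour_integral_reverse_linepath cf) auto
  ultimately have eq: "contour_integral (linepath p q) f - contour_integral (linepath p' q') f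
      - 2 * pi * \<i> * \<phi> w
      = - (contour_integral (linepath q q') f + contour_integral (linepath p' p) f)"
    by (simp add: algebra_simps)
  have "norm (contour_integral (linepath q q') f) \<le> K * norm (q' - q)"
    using seg sides by (intro contour_integral_bound_linepath int K side_bd) auto
  moreover have "norm (contour_integral (linepath p' p) f) \<le> K * norm (p - p')"
    using seg sides by (intro contour_integral_bound_linepath int K side_bd) auto
  moreover have "norm (q' - q) = t - s" "norm (p - p') = t - s"
    using s by (simp_all add: q_def q'_def p_def p'_def cmod_def)
  ultimately have "norm (contour_integral (linepath q q') f + contour_integral (linepath p' p) f)
      \<le> K * (t - s) + K * (t - s)"
    by (intro norm_triangle_mono) simp_all
  also have "\<dots> = 4 * M * t * (t - s) / (R - \<bar>Re w\<bar>)\<^sup>2"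
    by (simp add: K_def field_simps)
  finally show ?thesis
    unfolding strip_integral_def f_def[symmetric] p_def[symmetric] q_def[symmetric]
      p'_def[symmetric] q'_def[symmetric] eq norm_minus_cancel .
qed

text \<open>The integral over the lower line \<open>s\<close> is analytic above it, the one over the
  upper line \<open>t\<close> is analytic below it, and by Cauchy's formula they differ by
  \<open>\<phi>\<close>. Gaps of width at least \<open>g\<close> between the lines of integration
  and the domains of \<open>u\<close> and \<open>l\<close> give the bounds.\<close>

lemma strip_splitting:
  assumes hol: "\<phi> holomorphic_on {w. s\<^sub>0 < Im w \<and> Im w < t\<^sub>0}"
    and bd: "\<And>w. s\<^sub>0 < Im w \<Longrightarrow> Im w < t\<^sub>0 \<Longrightarrow> norm (\<phi> w) \<le> M"
    and s: "0 \<le> s\<^sub>0" "s\<^sub>0 < s" "s < s'" "s' < t'" "t' < t" "t < t\<^sub>0" "t\<^sub>0 \<le> 2 * t"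
    and g: "0 < g" "g \<le> s' - s" "g \<le> t - t'"
  obtains u l where "u holomorphic_on {w. s' < Im w}" "l holomorphic_on {w. 0 < Im w \<and> Im w < t'}"
    "\<And>w. s' < Im w \<Longrightarrow> norm (u w) \<le> M * t / g"
    "\<And>w. 0 < Im w \<Longrightarrow> Im w < t' \<Longrightarrow> norm (l w) \<le> M * t / g"
    "\<And>w. s' < Im w \<Longrightarrow> Im w < t' \<Longrightarrow> l w - u w = \<phi> w"
proof -
  \<comment> \<open>The sign is chosen so that \<open>Q t\<close> minus \<open>Q s\<close> tends to
    \<open>\<phi>\<close>; the half-length \<open>Suc n\<close> is always positive.\<close>
  define Q where "Q \<sigma> n w = - strip_integral \<phi> t \<sigma> (real (Suc n)) w / (2 * pi * \<i>)" for \<sigma> n w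
  have cont: "continuous_on {\<zeta>. Im \<zeta> = \<sigma>} \<phi>" if "s\<^sub>0 < \<sigma>" "\<sigma> < t\<^sub>0" for \<sigma>
    using that by (intro continuous_on_subset[OF holomorphic_on_imp_continuous_on[OF hol]]) auto
  have Q_bd: "norm (Q \<sigma> n w) \<le> M * t / g"
    if "s\<^sub>0 < \<sigma>" "\<sigma> \<le> t" "g \<le> \<bar>\<sigma> - Im w\<bar>" "0 \<le> Im w" for \<sigma> n w
  proof -
    have "norm (strip_integral \<phi> t \<sigma> (real (Suc n)) w) \<le> M * (2 * t) * pi / g"
      using that s g by (intro norm_strip_integral_le cont bd) auto
    then show ?thesis
      by (simp add: Q_def norm_divide norm_mult field_simps)
  qed
  have Q_hol: "Q \<sigma> n holomorphic_on A"
    if "s\<^sub>0 < \<sigma>" "\<sigma> \<le> t" "A \<subseteq> {w. 0 \<le> Im w \<and> Im w \<noteq> \<sigma>}" for \<sigma> n A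
    unfolding Q_def using that s
    by (intro holomorphic_intros holomorphic_on_subset[OF strip_integral_holomorphic[OF cont]]) auto
  have Q_diff: "(\<lambda>n. Q t n w - Q s n w) \<longlonglongrightarrow> \<phi> w" if w: "s' < Im w" "Im w < t'" for w
  proof (rule LIM_zero_cancel, rule Lim_null_comparison)
    let ?B = "\<lambda>n. 4 * M * t * (t - s) / (real (Suc n) - \<bar>Re w\<bar>)\<^sup>2 / (2 * pi)"
    show "?B \<longlonglongrightarrow> 0" by real_asymp
    show "\<forall>\<^sub>F n in sequentially. norm (Q t n w - Q s n w - \<phi> w) \<le> ?B n"
    proof (rule eventually_mono[OF eventually_gt_at_top[of "nat \<lceil>\<bar>Re w\<bar>\<rceil>"]])
      fix n assume "n > nat \<lceil>\<bar>Re w\<bar>\<rceil>"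
      then have "\<bar>Re w\<bar> < real (Suc n)" by linarith
      then have b: "norm (strip_integral \<phi> t s (real (Suc n)) w - strip_integral \<phi> t t (real (Suc n)) w
          - 2 * pi * \<i> * \<phi> w) \<le> 4 * M * t * (t - s) / (real (Suc n) - \<bar>Re w\<bar>)\<^sup>2"
        using s w by (intro strip_integral_diff[OF hol bd]) auto
      have "Q t n w - Q s n w - \<phi> w = (strip_integral \<phi> t s (real (Suc n)) w
          - strip_integral \<phi> t t (real (Suc n)) w - 2 * pi * \<i> * \<phi> w) / (2 * pi * \<i>)"
        by (simp add: Q_def diff_divide_distrib)
      then have "norm (Q t n w - Q s n w - \<phi> w) = norm (strip_integral \<phi> t s (real (Suc n)) w
          - strip_integral \<phi> t t (real (Suc n)) w - 2 * pi * \<i> * \<phi> w) / (2 * pi)"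
        by (simp add: norm_divide norm_mult)
      then show "norm (Q t n w - Q s n w - \<phi> w) \<le> ?B n"
        using divide_right_mono[OF b, of "2 * pi"] by simp
    qed
  qed
  have open_U: "open {w. s' < Im w}" by (rule open_halfspace_Im_gt)
  have open_L: "open {w. 0 < Im w \<and> Im w < t'}"
    by (simp add: Collect_conj_eq open_Int open_halfspace_Im_gt open_halfspace_Im_lt)
  obtain l r where l: "l holomorphic_on {w. 0 < Im w \<and> Im w < t'}" and r: "strict_mono (r :: nat \<Rightarrow> nat)"
    and l_lim: "\<And>w. w \<in> {w. 0 < Im w \<and> Im w < t'} \<Longrightarrow> (\<lambda>n. Q t (r n) w) \<longlonglongrightarrow> l w"
    and l_bd: "\<And>w. w \<in> {w. 0 < Im w \<and> Im w < t'} \<Longrightarrow> norm (l w) \<le> M * t / g"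
  proof (rule Montel_bounded[OF open_L, where F = "Q t" and M = "M * t / g"])
    show "Q t n holomorphic_on {w. 0 < Im w \<and> Im w < t'}" for n
      using s by (intro Q_hol) auto
    show "norm (Q t n z) \<le> M * t / g" if "z \<in> {w. 0 < Im w \<and> Im w < t'}" for n z
      using that s g by (intro Q_bd) auto
  qed auto
  \<comment> \<open>The second subsequence is taken from the first, so that both limits are reached
    along the common indices \<open>r (r' n)\<close>.\<close>
  obtain u r' where u: "u holomorphic_on {w. s' < Im w}" and r': "strict_mono (r' :: nat \<Rightarrow> nat)"
    and u_lim: "\<And>w. w \<in> {w. s' < Im w} \<Longrightarrow> (\<lambda>n. Q s (r (r' n)) w) \<longlonglongrightarrow> u w"
    and u_bd: "\<And>w. w \<in> {w. s' < Im w} \<Longrightarrow> norm (u w) \<le> M * t / g"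
  proof (rule Montel_bounded[OF open_U, where F = "\<lambda>n. Q s (r n)" and M = "M * t / g"])
    show "Q s (r n) holomorphic_on {w. s' < Im w}" for n
      using s by (intro Q_hol) auto
    show "norm (Q s (r n) z) \<le> M * t / g" if "z \<in> {w. s' < Im w}" for n z
      using that s g by (intro Q_bd) auto
  qed auto
  have "l w - u w = \<phi> w" if w: "s' < Im w" "Im w < t'" for w
  proof (rule LIMSEQ_unique)
    have "(\<lambda>n. Q t (r (r' n)) w) \<longlonglongrightarrow> l w"
      using LIMSEQ_subseq_LIMSEQ[OF l_lim r'] w s by (auto simp: o_def)
    then show "(\<lambda>n. Q t (r (r' n)) w - Q s (r (r' n)) w) \<longlonglongrightarrow> l w - u w"
      using u_lim w by (intro tendsto_diff) auto
    show "(\<lambda>n. Q t (r (r' n)) w - Q s (r (r' n)) w) \<longlonglongrightarrow> \<phi> w"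
      using LIMSEQ_subseq_LIMSEQ[OF Q_diff[OF w] strict_mono_o[OF r r']] by (simp add: o_def)
  qed
  then show thesis using that u l u_bd l_bd by simp
qed

section \<open>Extension modulo an inner function\<close>

text \<open>The function \<open>e\<close> lives above height \<open>a\<close>, its extension
  \<open>E\<close> on the whole half-plane. The multiplier \<open>k\<close> is required only above
  \<open>s\<close>; \<open>halfplane_divide\<close> carries it down to the boundary later. Since
  \<open>C\<close> does not depend on \<open>e\<close>, small functions have small extensions, which
  is what the sharp property uses.\<close>

definition bounded_extension :: "(complex \<Rightarrow> complex) \<Rightarrow> real \<Rightarrow> real \<Rightarrow> real \<Rightarrow> bool" where
  "bounded_extension \<Theta> a s C \<longleftrightarrow>
    (\<forall>e \<epsilon>. e holomorphic_on {w. a < Im w} \<and> (\<forall>w. a < Im w \<longrightarrow> norm (e w) \<le> \<epsilon>) \<longrightarrow>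
      (\<exists>E k. E holomorphic_on {w. 0 < Im w} \<and> (\<forall>w. 0 < Im w \<longrightarrow> norm (E w) \<le> C * \<epsilon>) \<and>
        k holomorphic_on {w. s < Im w} \<and> (\<forall>w. s < Im w \<longrightarrow> norm (k w) \<le> C * \<epsilon>) \<and>
        (\<forall>w. s < Im w \<longrightarrow> E w = e w + \<Theta> w * k w)))"

lemma bounded_extensionE:
  assumes "bounded_extension \<Theta> a s C" "e holomorphic_on {w. a < Im w}"
    "\<And>w. a < Im w \<Longrightarrow> norm (e w) \<le> \<epsilon>"
  obtains E k where "E holomorphic_on {w. 0 < Im w}" "\<And>w. 0 < Im w \<Longrightarrow> norm (E w) \<le> C * \<epsilon>"
    "k holomorphic_on {w. s < Im w}" "\<And>w. s < Im w \<Longrightarrow> norm (k w) \<le> C * \<epsilon>"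
    "\<And>w. s < Im w \<Longrightarrow> E w = e w + \<Theta> w * k w"
  using assms unfolding bounded_extension_def by blast

text \<open>The splitting of \<open>e / \<Theta>\<close> has bounds linear in
  \<open>\<epsilon>\<close>, so \<open>C\<close> depends only on \<open>c\<close>, \<open>h\<close>
  and \<open>a\<close>.\<close>

lemma halfplane_extension:
  fixes \<Theta> :: "complex \<Rightarrow> complex"
  assumes \<Theta>: "\<Theta> holomorphic_on {w. 0 < Im w}" "\<And>w. 0 < Im w \<Longrightarrow> norm (\<Theta> w) \<le> 1"
    and c: "0 < c" "\<And>w. 0 < Im w \<Longrightarrow> Im w < h \<Longrightarrow> c \<le> norm (\<Theta> w)"
    and a: "0 \<le> a" "a < h"
  obtains C s where "0 < C" "a < s" "s < h" "bounded_extension \<Theta> a s C"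
proof -
  \<comment> \<open>Starting no lower than \<open>h / 2\<close> ensures
    \<open>h \<le> 2 * (a' + 4 * d)\<close>, the condition that keeps the second pole of the kernel
    away. Five steps of length \<open>d\<close> from \<open>a'\<close> to \<open>h\<close> give the
    six heights of \<open>strip_splitting\<close>.\<close>
  define a' where "a' = max a (h / 2)"
  define d where "d = (h - a') / 5"
  \<comment> \<open>The summand 1 pays for \<open>e\<close>, the other one for \<open>u\<close> or
    \<open>l\<close>.\<close>
  define C where "C = 1 + h / (c * d)"
  have a': "a \<le> a'" "h / 2 \<le> a'" "a' < h" "0 < h" using a by (auto simp: a'_def)
  have d: "0 < d" using a' by (simp add: d_def)
  have h: "h = a' + 5 * d" by (simp add: d_def field_simps)
  have C: "0 < C" using a' c d by (simp add: C_def add_pos_nonneg)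
  show thesis
  proof (rule that[of C "a' + 2 * d"])
    show "bounded_extension \<Theta> a (a' + 2 * d) C"
      unfolding bounded_extension_def
    proof (intro allI impI, elim conjE)
      fix e \<epsilon>
      assume e: "e holomorphic_on {w. a < Im w}" and "\<forall>w. a < Im w \<longrightarrow> norm (e w) \<le> \<epsilon>"
      then have \<epsilon>: "\<And>w. a < Im w \<Longrightarrow> norm (e w) \<le> \<epsilon>" by blast
      have \<epsilon>0: "0 \<le> \<epsilon>" using order_trans[OF norm_ge_zero \<epsilon>[of "Complex 0 (a + 1)"]] by simp
      have nz: "\<Theta> w \<noteq> 0" if "0 < Im w" "Im w < h" for w
        using c(2)[OF that] c(1) by auto
      have \<phi>_hol: "(\<lambda>w. e w / \<Theta> w) holomorphic_on {w. a' < Im w \<and> Im w < h}"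
        using nz a a'
        by (intro holomorphic_intros holomorphic_on_subset[OF e] holomorphic_on_subset[OF \<Theta>(1)]) auto
      have \<phi>_bd: "norm (e w / \<Theta> w) \<le> \<epsilon> / c" if "a' < Im w" "Im w < h" for w
        unfolding norm_divide using that a a' c \<epsilon>0 by (intro frac_le \<epsilon> c(2)) auto
      have order: "0 \<le> a'" "a' < a' + d" "a' + d < a' + 2 * d" "a' + 2 * d < a' + 3 * d"
        "a' + 3 * d < a' + 4 * d" "a' + 4 * d < h" "h \<le> 2 * (a' + 4 * d)" "0 < d"
        "d \<le> a' + 2 * d - (a' + d)" "d \<le> a' + 4 * d - (a' + 3 * d)"
        using d a a' h by auto
      obtain u l where u: "u holomorphic_on {w. a' + 2 * d < Im w}"
        and l: "l holomorphic_on {w. 0 < Im w \<and> Im w < a' + 3 * d}"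
        and u_bd: "\<And>w. a' + 2 * d < Im w \<Longrightarrow> norm (u w) \<le> \<epsilon> / c * (a' + 4 * d) / d"
        and l_bd: "\<And>w. 0 < Im w \<Longrightarrow> Im w < a' + 3 * d \<Longrightarrow> norm (l w) \<le> \<epsilon> / c * (a' + 4 * d) / d"
        and lu: "\<And>w. a' + 2 * d < Im w \<Longrightarrow> Im w < a' + 3 * d \<Longrightarrow> l w - u w = e w / \<Theta> w"
        by (rule strip_splitting[OF \<phi>_hol \<phi>_bd order]) auto
      have B: "\<epsilon> / c * (a' + 4 * d) / d \<le> \<epsilon> * (h / (c * d))"
      proof -
        have "\<epsilon> / c * (a' + 4 * d) / d = \<epsilon> * ((a' + 4 * d) / (c * d))" by simp
        also have "\<dots> \<le> \<epsilon> * (h / (c * d))"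
          using \<epsilon>0 c d order by (intro mult_left_mono divide_right_mono) auto
        finally show ?thesis .
      qed
      have u_bd': "norm (u w) \<le> \<epsilon> * (h / (c * d))" if "a' + 2 * d < Im w" for w
        using u_bd[OF that] B by linarith
      have l_bd': "norm (l w) \<le> \<epsilon> * (h / (c * d))" if "0 < Im w" "Im w < a' + 3 * d" for w
        using l_bd[OF that] B by linarith
      have C\<epsilon>: "C * \<epsilon> = \<epsilon> + \<epsilon> * (h / (c * d))" by (simp add: C_def algebra_simps)
      define L where "L = {w. 0 < Im w \<and> Im w < a' + 3 * d}"
      define U where "U = {w. a' + 2 * d < Im w}"
      define E where "E w = (if w \<in> U then e w + \<Theta> w * u w else \<Theta> w * l w)" for w
      have LU: "U \<union> L = {w. 0 < Im w}" using order by (auto simp: L_def U_def)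
      have "E holomorphic_on U \<union> L"
        unfolding E_def
      proof (rule holomorphic_on_If_Un)
        show "(\<lambda>w. e w + \<Theta> w * u w) holomorphic_on U"
          using u order a' unfolding U_def
          by (intro holomorphic_intros holomorphic_on_subset[OF e] holomorphic_on_subset[OF \<Theta>(1)]) auto
        show "(\<lambda>w. \<Theta> w * l w) holomorphic_on L"
          using l unfolding L_def
          by (intro holomorphic_intros holomorphic_on_subset[OF \<Theta>(1)]) auto
        show "open U" unfolding U_def by (rule open_halfspace_Im_gt)
        show "open L"
          unfolding L_def by (simp add: Collect_conj_eq open_Int open_halfspace_Im_gt open_halfspace_Im_lt)
        show "e w + \<Theta> w * u w = \<Theta> w * l w" if "w \<in> U" "w \<in> L" for w
        proof -
          have "\<Theta> w * (l w - u w) = e w"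
            using lu[of w] nz[of w] that order by (simp add: U_def L_def)
          then show ?thesis by (simp add: algebra_simps)
        qed
      qed
      then have E_hol: "E holomorphic_on {w. 0 < Im w}" by (simp add: LU)
      have E_bd: "norm (E w) \<le> C * \<epsilon>" if "0 < Im w" for w
      proof (cases "w \<in> U")
        case True
        have "norm (\<Theta> w * u w) \<le> 1 * (\<epsilon> * (h / (c * d)))"
          unfolding norm_mult using True that by (intro mult_mono \<Theta>(2) u_bd') (auto simp: U_def)
        moreover have "norm (e w) \<le> \<epsilon>" using True order a' by (intro \<epsilon>) (auto simp: U_def)
        ultimately show ?thesis
          using norm_triangle_ineq[of "e w" "\<Theta> w * u w"] True by (simp add: E_def C\<epsilon>)
      next
        case False
        then have "norm (\<Theta> w * l w) \<le> 1 * (\<epsilon> * (h / (c * d)))"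
          unfolding norm_mult using that order by (intro mult_mono \<Theta>(2) l_bd') (auto simp: U_def)
        then show ?thesis using False \<epsilon>0 by (simp add: E_def C\<epsilon>)
      qed
      show "\<exists>E k. E holomorphic_on {w. 0 < Im w} \<and> (\<forall>w. 0 < Im w \<longrightarrow> norm (E w) \<le> C * \<epsilon>) \<and>
          k holomorphic_on {w. a' + 2 * d < Im w} \<and> (\<forall>w. a' + 2 * d < Im w \<longrightarrow> norm (k w) \<le> C * \<epsilon>) \<and>
          (\<forall>w. a' + 2 * d < Im w \<longrightarrow> E w = e w + \<Theta> w * k w)"
      proof (intro exI conjI allI impI)
        show "norm (u w) \<le> C * \<epsilon>" if "a' + 2 * d < Im w" for w
          using u_bd'[OF that] \<epsilon>0 by (simp add: C\<epsilon>)
        show "E w = e w + \<Theta> w * u w" if "a' + 2 * d < Im w" for w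
          using that by (simp add: E_def U_def)
      qed (use E_hol E_bd u in auto)
    qed
  qed (use a' d C h in auto)
qed

text \<open>Below \<open>h\<close> the quotient \<open>F / \<Theta>\<close> is bounded by
  \<open>M / c\<close>; above \<open>s\<close> the given \<open>k\<close> plays its part. As
  \<open>s < h\<close>, the two regions overlap and cover the half-plane.\<close>

lemma halfplane_divide:
  assumes \<Theta>: "\<Theta> holomorphic_on {w. 0 < Im w}"
    and c: "0 < c" "\<And>w. 0 < Im w \<Longrightarrow> Im w < h \<Longrightarrow> c \<le> norm (\<Theta> w)"
    and F: "F holomorphic_on {w. 0 < Im w}" "\<And>w. 0 < Im w \<Longrightarrow> norm (F w) \<le> M"
    and k: "k holomorphic_on {w. s < Im w}" "\<And>w. s < Im w \<Longrightarrow> norm (k w) \<le> N"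
    and s: "0 \<le> s" "s < h" and eq: "\<And>w. s < Im w \<Longrightarrow> F w = \<Theta> w * k w"
  obtains K B where "K holomorphic_on {w. 0 < Im w}" "\<And>w. 0 < Im w \<Longrightarrow> norm (K w) \<le> B"
    "\<And>w. 0 < Im w \<Longrightarrow> F w = \<Theta> w * K w"
proof -
  define L where "L = {w. 0 < Im w \<and> Im w < h}"
  define U where "U = {w. s < Im w}"
  define K where "K w = (if w \<in> U then k w else F w / \<Theta> w)" for w
  have LU: "U \<union> L = {w. 0 < Im w}" using s by (auto simp: L_def U_def)
  have nz: "\<Theta> w \<noteq> 0" if "0 < Im w" "Im w < h" for w
    using c(2)[OF that] c(1) by auto
  have "K holomorphic_on U \<union> L"
    unfolding K_def
  proof (rule holomorphic_on_If_Un)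
    show "(\<lambda>w. F w / \<Theta> w) holomorphic_on L"
      using nz unfolding L_def
      by (intro holomorphic_intros holomorphic_on_subset[OF F(1)] holomorphic_on_subset[OF \<Theta>]) auto
    show "open U" unfolding U_def by (rule open_halfspace_Im_gt)
    show "open L"
      unfolding L_def by (simp add: Collect_conj_eq open_Int open_halfspace_Im_gt open_halfspace_Im_lt)
    show "k w = F w / \<Theta> w" if "w \<in> U" "w \<in> L" for w
      using eq[of w] nz[of w] that by (simp add: U_def L_def)
  qed (use k in \<open>simp add: U_def\<close>)
  moreover have "norm (K w) \<le> max N (M / c)" if "0 < Im w" for w
  proof (cases "w \<in> U")
    case True
    then show ?thesis using k(2)[of w] by (simp add: K_def U_def)
  next
    case False
    have M: "0 \<le> M" using order_trans[OF norm_ge_zero F(2)[OF that]] .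
    have "norm (F w / \<Theta> w) \<le> M / c"
      unfolding norm_divide using False that s M by (intro frac_le F(2) c) (auto simp: U_def)
    then show ?thesis using False by (simp add: K_def)
  qed
  moreover have "F w = \<Theta> w * K w" if "0 < Im w" for w
    using that eq[of w] nz[of w] s by (auto simp: K_def U_def)
  ultimately show thesis unfolding LU by (rule that)
qed

section \<open>The Cayley transform\<close>

definition cayley :: "complex \<Rightarrow> complex" where
  "cayley w = (w - \<i>) / (w + \<i>)"

definition inv_cayley :: "complex \<Rightarrow> complex" where
  "inv_cayley z = \<i> * (1 + z) / (1 - z)"

lemma cayley_denominator: "0 < Im w \<Longrightarrow> w + \<i> \<noteq> 0"
  by (auto simp: complex_eq_iff)

lemma norm_add_ii_gt: "0 < Im w \<Longrightarrow> norm (w - \<i>) < norm (w + \<i>)"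
  by (rule power2_less_imp_less; (simp add: cmod_power2)?) (simp add: power2_eq_square algebra_simps)

lemma norm_cayley_less_1: "0 < Im w \<Longrightarrow> norm (cayley w) < 1"
  using norm_add_ii_gt[of w] cayley_denominator[of w] by (simp add: cayley_def norm_divide)

lemma cayley_holomorphic: "cayley holomorphic_on {w. 0 < Im w}"
  unfolding cayley_def using cayley_denominator by (intro holomorphic_intros) auto

lemma inv_cayley_holomorphic: "inv_cayley holomorphic_on unit_disc"
  unfolding inv_cayley_def by (intro holomorphic_intros) auto

lemma cayley_inv_cayley: "norm z < 1 \<Longrightarrow> cayley (inv_cayley z) = z"
proof -
  assume "norm z < 1"
  then have z: "1 - z \<noteq> 0" by auto
  have "inv_cayley z - \<i> = 2 * \<i> * z / (1 - z)" "inv_cayley z + \<i> = 2 * \<i> / (1 - z)"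
    using z by (simp_all add: inv_cayley_def field_simps)
  then show ?thesis using z by (simp add: cayley_def)
qed

lemma inv_cayley_cayley: "0 < Im w \<Longrightarrow> inv_cayley (cayley w) = w"
proof -
  assume w: "0 < Im w"
  have "1 + cayley w = 2 * w / (w + \<i>)" "1 - cayley w = 2 * \<i> / (w + \<i>)"
    using cayley_denominator[OF w] by (simp_all add: cayley_def field_simps)
  then show ?thesis using cayley_denominator[OF w] by (simp add: inv_cayley_def)
qed

lemma Im_inv_cayley_pos:
  assumes "norm z < 1"
  shows "0 < Im (inv_cayley z)"
proof -
  have z: "1 - z \<noteq> 0" using assms by auto
  have "Im (inv_cayley z) = (1 - (norm z)\<^sup>2) / (norm (1 - z))\<^sup>2"
    unfolding inv_cayley_def cmod_power2 by (simp add: Im_divide power2_eq_square algebra_simps)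
  also have "\<dots> > 0"
    using assms z by (intro divide_pos_pos) (auto simp: abs_square_less_1)
  finally show ?thesis .
qed

lemma diff_cnj_nonzero: "0 < Im v \<Longrightarrow> 0 < Im w \<Longrightarrow> w - cnj v \<noteq> 0"
  by (auto simp: complex_eq_iff)

text \<open>Conformal invariance of the pseudohyperbolic distance; the right-hand side is its
  half-plane form.\<close>

lemma norm_blaschke_factor_cayley:
  assumes v: "0 < Im v" and w: "0 < Im w"
  shows "norm (blaschke_factor (cayley v) (cayley w)) = norm (w - v) / norm (w - cnj v)"
proof -
  have nz: "v + \<i> \<noteq> 0" "w + \<i> \<noteq> 0" "cnj v - \<i> \<noteq> 0"
    using cayley_denominator[OF v] cayley_denominator[OF w] v by (auto simp: complex_eq_iff)
  have 1: "cayley v - cayley w = 2 * \<i> * (v - w) / ((v + \<i>) * (w + \<i>))"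
    using nz by (simp add: cayley_def field_simps)
  have gen: "1 - A / B * (C / D) = (B * D - A * C) / (B * D)"
    if "B \<noteq> 0" "D \<noteq> 0" for A B C D :: complex
    using that by (simp add: field_simps)
  have "cnj (cayley v) = (cnj v + \<i>) / (cnj v - \<i>)" by (simp add: cayley_def)
  then have "1 - cnj (cayley v) * cayley w
      = ((cnj v - \<i>) * (w + \<i>) - (cnj v + \<i>) * (w - \<i>)) / ((cnj v - \<i>) * (w + \<i>))"
    unfolding cayley_def[of w] using gen[OF nz(3,2)] by simp
  also have "(cnj v - \<i>) * (w + \<i>) - (cnj v + \<i>) * (w - \<i>) = 2 * \<i> * (cnj v - w)"
    by (simp add: algebra_simps)
  finally have 2: "1 - cnj (cayley v) * cayley w
      = 2 * \<i> * (cnj v - w) / ((cnj v - \<i>) * (w + \<i>))" .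
  have 3: "norm (cnj v - \<i>) = norm (v + \<i>)"
    by (metis complex_cnj_add complex_cnj_i complex_mod_cnj diff_conv_add_uminus)
  show ?thesis
    unfolding norm_blaschke_factor 1 2 norm_divide norm_mult 3
    using nz diff_cnj_nonzero[OF v w] by (simp add: norm_minus_commute)
qed

lemma norm_diff_cnj: "(norm (w - cnj v))\<^sup>2 = (norm (w - v))\<^sup>2 + 4 * Im v * Im w"
  unfolding cmod_power2 by (simp add: power2_eq_square algebra_simps)

lemma one_minus_blaschke_factor_cayley:
  assumes v: "0 < Im v" and w: "0 < Im w"
  shows "1 - (norm (blaschke_factor (cayley v) (cayley w)))\<^sup>2
    = 4 * Im v * Im w / (norm (w - cnj v))\<^sup>2"
proof -
  have "norm (w - cnj v) \<noteq> 0" using diff_cnj_nonzero[OF v w] by simp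
  then have "1 - (norm (blaschke_factor (cayley v) (cayley w)))\<^sup>2
      = ((norm (w - cnj v))\<^sup>2 - (norm (w - v))\<^sup>2) / (norm (w - cnj v))\<^sup>2"
    by (simp add: norm_blaschke_factor_cayley[OF v w] power_divide diff_divide_distrib)
  then show ?thesis by (simp add: norm_diff_cnj)
qed

section \<open>The zeros\<close>

text \<open>An index codes a pair: the first component plus 1 is the row number \<open>m\<close>, so
  that rows start at 1, and the second codes the integer \<open>j\<close> giving the position in the
  row.\<close>

definition zero_height :: "nat \<Rightarrow> nat" where
  "zero_height n = Suc (fst (prod_decode n))"

text \<open>With height \<open>h = m\<^sup>4\<close> and spacing \<open>d = m\<^sup>3\<close> of the rows, \<open>d / h\<close> tends to \<open>0\<close>, which gives
  density, and \<open>h / d\<^sup>2 = 1 / m\<^sup>2\<close> is summable, which gives the Blaschke condition and the lower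
  bounds for the product.\<close>

definition zero_point :: "nat \<Rightarrow> complex" where
  "zero_point n = Complex (of_int (int_decode (snd (prod_decode n))) * real (zero_height n) ^ 3)
    (real (zero_height n) ^ 4)"

definition zero_seq :: "nat \<Rightarrow> complex" where
  "zero_seq n = cayley (zero_point n)"

lemma zero_height_pos: "1 \<le> zero_height n"
  by (simp add: zero_height_def)

lemma Im_zero_point: "Im (zero_point n) = real (zero_height n) ^ 4"
  by (simp add: zero_point_def)

lemma Im_zero_point_ge_1: "1 \<le> Im (zero_point n)"
  using zero_height_pos[of n] by (simp add: Im_zero_point)

lemma Im_zero_point_pos: "0 < Im (zero_point n)"
  using Im_zero_point_ge_1[of n] by linarith

lemma zero_point_exists:
  assumes "1 \<le> m"
  obtains n where "zero_height n = m" "zero_point n = Complex (of_int j * real m ^ 3) (real m ^ 4)"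
proof
  define n where "n = prod_encode (m - 1, int_encode j)"
  show "zero_height n = m" using assms by (simp add: n_def zero_height_def)
  then show "zero_point n = Complex (of_int j * real m ^ 3) (real m ^ 4)"
    by (simp add: zero_point_def) (simp add: n_def)
qed

lemma zero_index_eqI:
  assumes "fst (prod_decode n) = fst (prod_decode n')"
    "int_decode (snd (prod_decode n)) = int_decode (snd (prod_decode n'))"
  shows "n = n'"
proof -
  have "prod_decode n = prod_decode n'"
    using assms inj_int_decode[of UNIV] by (intro prod_eqI) (auto dest: injD)
  then show ?thesis using inj_prod_decode[of UNIV] by (auto dest: injD)
qed

text \<open>Within a row the spacing is \<open>m ^ 3\<close>, at least 1; heights of distinct rows
  are distinct integers.\<close>

lemma zero_point_dist:
  assumes "n \<noteq> n'"
  shows "1 \<le> norm (zero_point n - zero_point n')"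
proof (cases "zero_height n = zero_height n'")
  case True
  define j where "j = int_decode (snd (prod_decode n))"
  define j' where "j' = int_decode (snd (prod_decode n'))"
  have "j \<noteq> j'"
    using zero_index_eqI[of n n'] assms True by (auto simp: zero_height_def j_def j'_def)
  then have "1 \<le> \<bar>j - j'\<bar>" by linarith
  then have "1 \<le> \<bar>real_of_int (j - j')\<bar>" by linarith
  moreover have "1 \<le> real (zero_height n) ^ 3" using zero_height_pos[of n] by simp
  ultimately have "1 * 1 \<le> \<bar>real_of_int (j - j')\<bar> * real (zero_height n) ^ 3"
    by (intro mult_mono) auto
  also have "\<dots> = \<bar>Re (zero_point n - zero_point n')\<bar>"
    using True by (simp add: zero_point_def j_def j'_def abs_mult flip: left_diff_distrib)
  also have "\<dots> \<le> norm (zero_point n - zero_point n')" by (rule abs_Re_le_cmod)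
  finally show ?thesis by simp
next
  case False
  then have "zero_height n ^ 4 \<noteq> zero_height n' ^ 4" by (simp add: power_eq_iff_eq_base)
  then have "1 \<le> \<bar>int (zero_height n ^ 4) - int (zero_height n' ^ 4)\<bar>" by linarith
  then have "1 \<le> \<bar>real_of_int (int (zero_height n ^ 4) - int (zero_height n' ^ 4))\<bar>" by linarith
  then have "1 \<le> \<bar>Im (zero_point n - zero_point n')\<bar>" by (simp add: Im_zero_point)
  also have "\<dots> \<le> norm (zero_point n - zero_point n')" by (rule abs_Im_le_cmod)
  finally show ?thesis .
qed

lemma inj_zero_seq: "inj zero_seq"
proof (rule injI)
  fix n n' assume "zero_seq n = zero_seq n'"
  then have "zero_point n = zero_point n'"
    using inv_cayley_cayley[OF Im_zero_point_pos] by (metis zero_seq_def)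
  then show "n = n'" using zero_point_dist[of n n'] by (cases "n = n'") auto
qed

section \<open>Uniform bounds for sums over the zeros\<close>

text \<open>Shifting by the floor of \<open>x\<close> reduces to \<open>x\<close> in the unit
  interval, at the cost of a factor 3 against the unshifted terms. The integers are then split by
  sign, and each half is bounded by the series \<open>f\<close>.\<close>

lemma sum_inverse_shifted_squares_bounded:
  "\<exists>C>0. \<forall>K x. finite (K :: int set) \<longrightarrow> (\<Sum>k\<in>K. 1 / (1 + (x - of_int k)\<^sup>2)) \<le> (C :: real)"
proof -
  define f where "f i = 1 / (1 + (real i)\<^sup>2)" for i :: nat
  have f: "summable f"
  proof (rule summable_comparison_test'[where N = 1])
    show "summable (\<lambda>i. inverse (real i ^ 2))" by (rule inverse_power_summable) simp
    show "norm (f i) \<le> inverse (real i ^ 2)" if "1 \<le> i" for i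
      using that unfolding f_def norm_divide inverse_eq_divide by (intro frac_le) auto
  qed
  have half: "(\<Sum>k\<in>K. f (nat \<bar>k\<bar>)) \<le> suminf f"
    if "finite K" "K \<subseteq> {0..} \<or> K \<subseteq> {..<0}" for K :: "int set"
  proof -
    have "inj_on (\<lambda>k. nat \<bar>k\<bar>) K"
    proof (rule inj_onI)
      fix x y assume "x \<in> K" "y \<in> K" "nat \<bar>x\<bar> = nat \<bar>y\<bar>"
      moreover from this have "(0 \<le> x \<and> 0 \<le> y) \<or> (x < 0 \<and> y < 0)" using that(2) by auto
      ultimately show "x = y" by linarith
    qed
    then have "(\<Sum>k\<in>K. f (nat \<bar>k\<bar>)) = sum f ((\<lambda>k. nat \<bar>k\<bar>) ` K)"
      by (simp add: sum.reindex)
    also have "\<dots> \<le> suminf f"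
      using f that(1) by (intro sum_le_suminf) (auto simp: f_def)
    finally show ?thesis .
  qed
  have "(\<Sum>k\<in>K. 1 / (1 + (x - of_int k)\<^sup>2)) \<le> 6 * suminf f + 1"
    if K: "finite K" for K :: "int set" and x :: real
  proof -
    define n where "n = \<lfloor>x\<rfloor>"
    define K' where "K' = (\<lambda>k. k - n) ` K"
    have "1 / (1 + (x - of_int k)\<^sup>2) \<le> 3 * f (nat \<bar>k - n\<bar>)" for k
    proof -
      define \<theta> where "\<theta> = x - of_int n"
      have "0 \<le> \<theta>" "\<theta> < 1" unfolding \<theta>_def n_def by linarith+
      then have "\<theta>\<^sup>2 \<le> 1" by (simp add: abs_square_le_1)
      \<comment> \<open>Expanding this square gives the next inequality, the bound of the square of
        \<open>k - n\<close> by those of \<open>x - k\<close> and \<open>\<theta>\<close>.\<close>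
      have "0 \<le> (2 * \<theta> - (of_int (k - n) :: real))\<^sup>2" by simp
      then have "(real_of_int (k - n))\<^sup>2 \<le> 2 * (\<theta> - of_int (k - n))\<^sup>2 + 2 * \<theta>\<^sup>2"
        by (simp add: power2_eq_square algebra_simps)
      moreover have "\<theta> - of_int (k - n) = x - of_int k" by (simp add: \<theta>_def)
      ultimately have "1 + (real_of_int (k - n))\<^sup>2 \<le> 3 * (1 + (x - of_int k)\<^sup>2)"
        using \<open>\<theta>\<^sup>2 \<le> 1\<close> zero_le_power2[of "x - of_int k"]
        by (simp only: distrib_left)
      moreover have "(real (nat \<bar>k - n\<bar>))\<^sup>2 = (real_of_int (k - n))\<^sup>2" by simp
      ultimately show ?thesis
        by (simp add: f_def divide_simps add_pos_nonneg del: of_int_diff)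
    qed
    then have "(\<Sum>k\<in>K. 1 / (1 + (x - of_int k)\<^sup>2)) \<le> (\<Sum>k\<in>K. 3 * f (nat \<bar>k - n\<bar>))"
      by (rule sum_mono)
    also have "\<dots> = 3 * (\<Sum>k\<in>K'. f (nat \<bar>k\<bar>))"
      unfolding K'_def by (subst sum.reindex) (auto simp: inj_on_def sum_distrib_left)
    also have "(\<Sum>k\<in>K'. f (nat \<bar>k\<bar>))
        = (\<Sum>k\<in>K' \<inter> {0..}. f (nat \<bar>k\<bar>)) + (\<Sum>k\<in>K' \<inter> {..<0}. f (nat \<bar>k\<bar>))"
      using K by (subst sum.union_disjoint[symmetric]) (auto simp: K'_def intro!: sum.cong)
    also have "\<dots> \<le> suminf f + suminf f"
      using K by (intro add_mono half) (auto simp: K'_def)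
    finally show ?thesis by simp
  qed
  moreover have "0 < 6 * suminf f + 1"
    using suminf_nonneg[OF f] by (simp add: f_def add_nonneg_pos)
  ultimately show ?thesis by blast
qed

text \<open>Scaling row \<open>m\<close> by its spacing turns its sum into one over shifted integers
  with the factor \<open>m ^ 4 / m ^ 6\<close>; these factors are summable over the rows, uniformly
  in \<open>x\<close>.\<close>

lemma sum_zero_points_bounded:
  "\<exists>S>0. \<forall>I x. finite I \<longrightarrow>
    (\<Sum>n\<in>I. Im (zero_point n) / ((x - Re (zero_point n))\<^sup>2 + (Im (zero_point n))\<^sup>2)) \<le> S"
proof -
  obtain C :: real where C: "C > 0"
    "\<And>K x. finite (K :: int set) \<Longrightarrow> (\<Sum>k\<in>K. 1 / (1 + (x - of_int k)\<^sup>2)) \<le> C"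
    using sum_inverse_shifted_squares_bounded by blast
  define g where "g m = C * inverse (real (Suc m) ^ 2)" for m
  have g: "summable g"
    unfolding g_def using inverse_power_summable[of 2, where 'a = real]
    by (intro summable_mult) (subst summable_Suc_iff, simp)
  have g0: "0 \<le> g m" for m using C by (simp add: g_def)
  \<comment> \<open>The majorant of the term with row number \<open>Suc m\<close> and position
    \<open>j\<close>: the summand \<open>m\<^sup>2\<close> left after scaling a row is replaced by
    1.\<close>
  define T where "T x p = (case p of (m, j) \<Rightarrow>
    inverse (real (Suc m) ^ 2) * (1 / (1 + (x / real (Suc m) ^ 3 - of_int j)\<^sup>2)))" for x :: real and p
  have "(\<Sum>n\<in>I. Im (zero_point n) / ((x - Re (zero_point n))\<^sup>2 + (Im (zero_point n))\<^sup>2))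
      \<le> suminf g + 1" if I: "finite I" for I x
  proof -
    define q where "q n = (fst (prod_decode n), int_decode (snd (prod_decode n)))" for n
    have "inj_on q I"
      using zero_index_eqI by (auto simp: q_def inj_on_def)
    have le: "Im (zero_point n) / ((x - Re (zero_point n))\<^sup>2 + (Im (zero_point n))\<^sup>2) \<le> T x (q n)" for n
    proof -
      define m where "m = real (zero_height n)"
      define j where "j = real_of_int (int_decode (snd (prod_decode n)))"
      have m: "1 \<le> m" using zero_height_pos[of n] by (simp add: m_def)
      have "(x - j * m ^ 3)\<^sup>2 + (m ^ 4)\<^sup>2 = m ^ 6 * ((x / m ^ 3 - j)\<^sup>2 + m\<^sup>2)"
      proof -
        have "x - j * m ^ 3 = m ^ 3 * (x / m ^ 3 - j)" using m by (simp add: field_simps)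
        then have "(x - j * m ^ 3)\<^sup>2 = m ^ 6 * (x / m ^ 3 - j)\<^sup>2"
          by (simp only: power_mult_distrib flip: power_mult) simp
        then show ?thesis by (simp add: distrib_left flip: power_mult power_add)
      qed
      then have "m ^ 4 / ((x - j * m ^ 3)\<^sup>2 + (m ^ 4)\<^sup>2) = inverse (m\<^sup>2) * (1 / (m\<^sup>2 + (x / m ^ 3 - j)\<^sup>2))"
        using m by (simp add: field_simps eval_nat_numeral)
      also have "\<dots> \<le> inverse (m\<^sup>2) * (1 / (1 + (x / m ^ 3 - j)\<^sup>2))"
        using m by (intro mult_left_mono divide_left_mono mult_pos_pos add_pos_nonneg) auto
      finally show ?thesis
        by (simp add: T_def q_def zero_point_def m_def j_def zero_height_def)
    qed
    have T0: "0 \<le> T x p" for p by (auto simp: T_def split: prod.split)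
    \<comment> \<open>The finite index set is enlarged to a finite product of rows and positions, so
      that the sum can be taken row by row.\<close>
    define M where "M = fst ` q ` I"
    define J where "J = snd ` q ` I"
    have fin: "finite M" "finite J" using I by (auto simp: M_def J_def)
    have "(\<Sum>n\<in>I. Im (zero_point n) / ((x - Re (zero_point n))\<^sup>2 + (Im (zero_point n))\<^sup>2))
        \<le> (\<Sum>n\<in>I. T x (q n))"
      using le by (rule sum_mono)
    also have "\<dots> = sum (T x) (q ` I)" using \<open>inj_on q I\<close> by (simp add: sum.reindex)
    also have "\<dots> \<le> sum (T x) (M \<times> J)"
    proof (rule sum_mono2)
      show "q ` I \<subseteq> M \<times> J" unfolding M_def J_def by (rule subset_fst_snd)
    qed (use fin T0 in auto)
    also have "\<dots> = (\<Sum>m\<in>M. \<Sum>j\<in>J. T x (m, j))" by (simp add: sum.cartesian_product)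
    also have "\<dots> \<le> (\<Sum>m\<in>M. g m)"
    proof (rule sum_mono)
      fix m
      have "(\<Sum>j\<in>J. T x (m, j)) = inverse (real (Suc m) ^ 2)
          * (\<Sum>j\<in>J. 1 / (1 + (x / real (Suc m) ^ 3 - of_int j)\<^sup>2))"
        by (simp only: T_def prod.case sum_distrib_left)
      also have "\<dots> \<le> inverse (real (Suc m) ^ 2) * C"
        using C(2)[OF fin(2)] by (intro mult_left_mono) auto
      finally show "(\<Sum>j\<in>J. T x (m, j)) \<le> g m" by (simp add: g_def mult.commute)
    qed
    also have "\<dots> \<le> suminf g" using fin g g0 by (intro sum_le_suminf) auto
    finally show ?thesis by simp
  qed
  moreover have "0 < suminf g + 1" using suminf_nonneg[OF g g0] by simp
  ultimately show ?thesis by blast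
qed

definition zeros_sum_bound :: real where
  "zeros_sum_bound = (SOME S. S > 0 \<and> (\<forall>I x. finite I \<longrightarrow>
    (\<Sum>n\<in>I. Im (zero_point n) / ((x - Re (zero_point n))\<^sup>2 + (Im (zero_point n))\<^sup>2)) \<le> S))"

lemma zeros_sum_bound:
  shows "0 < zeros_sum_bound"
    and "finite I \<Longrightarrow>
      (\<Sum>n\<in>I. Im (zero_point n) / ((x - Re (zero_point n))\<^sup>2 + (Im (zero_point n))\<^sup>2)) \<le> zeros_sum_bound"
  using someI_ex[OF sum_zero_points_bounded] unfolding zeros_sum_bound_def by blast+

text \<open>Moving \<open>w\<close> vertically down to the real axis brings it closer to all
  reflected zeros in the lower half-plane, so the boundary bound applies.\<close>

lemma sum_zero_points_le:
  assumes w: "0 < Im w" and I: "finite I"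
  shows "(\<Sum>n\<in>I. Im (zero_point n) / (norm (w - cnj (zero_point n)))\<^sup>2) \<le> zeros_sum_bound"
proof -
  have "Im (zero_point n) / (norm (w - cnj (zero_point n)))\<^sup>2
      \<le> Im (zero_point n) / ((Re w - Re (zero_point n))\<^sup>2 + (Im (zero_point n))\<^sup>2)" for n
  proof -
    have "(Im (zero_point n))\<^sup>2 \<le> (Im w + Im (zero_point n))\<^sup>2"
      using w Im_zero_point_pos[of n] by (intro power_mono) auto
    then show ?thesis
      using Im_zero_point_pos[of n] w unfolding cmod_power2
      by (intro divide_left_mono mult_pos_pos add_nonneg_pos) auto
  qed
  then have "(\<Sum>n\<in>I. Im (zero_point n) / (norm (w - cnj (zero_point n)))\<^sup>2)
      \<le> (\<Sum>n\<in>I. Im (zero_point n) / ((Re w - Re (zero_point n))\<^sup>2 + (Im (zero_point n))\<^sup>2))"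
    by (rule sum_mono)
  also have "\<dots> \<le> zeros_sum_bound" by (rule zeros_sum_bound(2)[OF I])
  finally show ?thesis .
qed

text \<open>The bound is linear in the height of \<open>w\<close>, hence uniform on every strip of
  bounded height.\<close>

lemma sum_one_minus_blaschke_factor_le:
  assumes w: "0 < Im w" and I: "finite I"
  shows "(\<Sum>n\<in>I. 1 - (norm (blaschke_factor (zero_seq n) (cayley w)))\<^sup>2)
    \<le> 4 * Im w * zeros_sum_bound"
proof -
  have "(\<Sum>n\<in>I. 1 - (norm (blaschke_factor (zero_seq n) (cayley w)))\<^sup>2)
      = 4 * Im w * (\<Sum>n\<in>I. Im (zero_point n) / (norm (w - cnj (zero_point n)))\<^sup>2)"
    unfolding zero_seq_def one_minus_blaschke_factor_cayley[OF Im_zero_point_pos w] sum_distrib_left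
    by (intro sum.cong) auto
  also have "\<dots> \<le> 4 * Im w * zeros_sum_bound"
    using w by (intro mult_left_mono sum_zero_points_le I) auto
  finally show ?thesis .
qed

lemma norm_zero_seq_less_1: "norm (zero_seq n) < 1"
  by (simp add: zero_seq_def norm_cayley_less_1 Im_zero_point_pos)

text \<open>The preceding sum is evaluated at \<open>\<i>\<close>, which the Cayley transform sends
  to the origin: there the factor of a zero \<open>a\<close> has modulus \<open>norm a\<close>, and
  \<open>1 - norm a\<close> is at most \<open>1 - (norm a)\<^sup>2\<close>.\<close>

lemma blaschke_zeros_zero_seq: "blaschke_zeros J zero_seq"
proof (rule blaschke_zeros_subset[of UNIV])
  have "(\<Sum>n\<in>I. 1 - norm (zero_seq n)) \<le> 4 * zeros_sum_bound" if "finite I" for I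
  proof -
    have "1 - norm (zero_seq n) \<le> 1 - (norm (blaschke_factor (zero_seq n) (cayley \<i>)))\<^sup>2" for n
    proof -
      have "(norm (zero_seq n))\<^sup>2 \<le> norm (zero_seq n)"
        using norm_zero_seq_less_1[of n] by (simp add: power2_eq_square mult_left_le)
      then show ?thesis by (simp add: norm_blaschke_factor cayley_def)
    qed
    then have "(\<Sum>n\<in>I. 1 - norm (zero_seq n))
        \<le> (\<Sum>n\<in>I. 1 - (norm (blaschke_factor (zero_seq n) (cayley \<i>)))\<^sup>2)"
      by (rule sum_mono)
    also have "\<dots> \<le> 4 * zeros_sum_bound"
      using sum_one_minus_blaschke_factor_le[of \<i>, OF _ that] by simp
    finally show ?thesis .
  qed
  then have "(\<lambda>n. 1 - norm (zero_seq n)) summable_on UNIV"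
    using norm_zero_seq_less_1 less_imp_le
    by (intro nonneg_bdd_above_summable_on) (auto simp: bdd_above_def)
  then show "blaschke_zeros UNIV zero_seq"
    by (simp add: blaschke_zeros_def norm_zero_seq_less_1)
qed simp

section \<open>The Blaschke products in half-plane coordinates\<close>

abbreviation halfplane_blaschke :: "nat set \<Rightarrow> complex \<Rightarrow> complex" where
  "halfplane_blaschke J w \<equiv> blaschke_product J zero_seq (cayley w)"

lemma halfplane_blaschke_holomorphic: "halfplane_blaschke J holomorphic_on {w. 0 < Im w}"
  using holomorphic_on_compose_gen[OF cayley_holomorphic
      blaschke_product_holomorphic[OF blaschke_zeros_zero_seq]] norm_cayley_less_1
  by (force simp: o_def)

lemma norm_halfplane_blaschke_le_1: "0 < Im w \<Longrightarrow> norm (halfplane_blaschke J w) \<le> 1"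
  by (intro norm_blaschke_product_le_1[OF blaschke_zeros_zero_seq] norm_cayley_less_1)

text \<open>Points below \<open>h\<close> have pseudohyperbolic distance at least 1/3 from zeros at
  height at least \<open>2 * h\<close>, and the sum over the zeros is bounded on the strip;
  \<open>norm_blaschke_product_ge\<close> combines the two.\<close>

lemma halfplane_blaschke_bounded_below:
  assumes h: "0 < h" and J: "\<And>n. n \<in> J \<Longrightarrow> 2 * h \<le> Im (zero_point n)"
  obtains c where "0 < c" "\<And>w. 0 < Im w \<Longrightarrow> Im w < h \<Longrightarrow> c \<le> norm (halfplane_blaschke J w)"
proof -
  define c where "c = sqrt (exp (- (4 * h * zeros_sum_bound) / (1 / 9)))"
  show thesis
  proof (rule that)
    show "0 < c" by (simp add: c_def)
    fix w assume w: "0 < Im w" "Im w < h"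
    have "exp (- (4 * h * zeros_sum_bound) / (1 / 9)) \<le> (norm (halfplane_blaschke J w))\<^sup>2"
    proof (rule norm_blaschke_product_ge[OF blaschke_zeros_zero_seq norm_cayley_less_1[OF w(1)]])
      fix n assume "n \<in> J"
      define v where "v = zero_point n"
      have v: "2 * Im w < Im v" using J[OF \<open>n \<in> J\<close>] w by (simp add: v_def)
      have "(norm (w - cnj v))\<^sup>2 \<le> 9 * (norm (w - v))\<^sup>2"
      proof -
        \<comment> \<open>The difference of the two sides of the claim is this product plus
          \<open>8 * (Re w - Re v)\<^sup>2\<close>; the product factors the difference of squares of
          \<open>3 * (Im v - Im w)\<close> and \<open>Im v + Im w\<close>.\<close>
        have "0 \<le> (2 * Im v - 4 * Im w) * (4 * Im v - 2 * Im w)"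
          using v w by (intro mult_nonneg_nonneg) auto
        moreover have "0 \<le> 8 * (Re w - Re v)\<^sup>2" by simp
        ultimately show ?thesis
          unfolding cmod_power2 by (simp add: power2_eq_square algebra_simps)
      qed
      moreover have "0 < (norm (w - cnj v))\<^sup>2"
        using diff_cnj_nonzero[of v w] v w by simp
      moreover have "(norm (blaschke_factor (zero_seq n) (cayley w)))\<^sup>2
          = (norm (w - v))\<^sup>2 / (norm (w - cnj v))\<^sup>2"
        using v w by (simp add: zero_seq_def norm_blaschke_factor_cayley power_divide flip: v_def)
      ultimately show "1 / 9 \<le> (norm (blaschke_factor (zero_seq n) (cayley w)))\<^sup>2"
        by (simp only: pos_le_divide_eq)
    next
      fix I :: "nat set" assume "finite I"
      have "(\<Sum>n\<in>I. 1 - (norm (blaschke_factor (zero_seq n) (cayley w)))\<^sup>2)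
          \<le> 4 * Im w * zeros_sum_bound"
        by (rule sum_one_minus_blaschke_factor_le[OF w(1) \<open>finite I\<close>])
      also have "\<dots> \<le> 4 * h * zeros_sum_bound"
        using w zeros_sum_bound(1) by (intro mult_right_mono) auto
      finally show "(\<Sum>n\<in>I. 1 - (norm (blaschke_factor (zero_seq n) (cayley w)))\<^sup>2)
          \<le> 4 * h * zeros_sum_bound" .
    qed simp
    then show "c \<le> norm (halfplane_blaschke J w)"
      unfolding c_def by (intro real_le_lsqrt) auto
  qed
qed

section \<open>Hyperbolic density of the zeros\<close>

lemma fourth_root_floor:
  assumes "1 \<le> (y :: real)"
  obtains m :: nat where "1 \<le> m" "real m ^ 4 \<le> y" "y < (real m + 1) ^ 4"
proof
  define r where "r = root 4 y"
  define m where "m = nat \<lfloor>r\<rfloor>"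
  have r: "1 \<le> r" "r ^ 4 = y" using assms by (simp_all add: r_def)
  then have m: "real m \<le> r" "r < real m + 1" unfolding m_def by linarith+
  show "1 \<le> m" using r unfolding m_def by linarith
  show "real m ^ 4 \<le> y" using m r power_mono[of "real m" r 4] by simp
  show "y < (real m + 1) ^ 4" using m r power_strict_mono[of r "real m + 1" 4] by simp
qed

lemma zero_point_near:
  assumes m: "1 \<le> m"
  obtains n where "zero_height n = m" "\<bar>x - Re (zero_point n)\<bar> \<le> real m ^ 3 / 2"
proof -
  define j where "j = \<lfloor>x / real m ^ 3 + 1 / 2\<rfloor>"
  obtain n where n: "zero_height n = m" "zero_point n = Complex (of_int j * real m ^ 3) (real m ^ 4)"
    by (rule zero_point_exists[OF m])
  have "\<bar>x / real m ^ 3 - of_int j\<bar> \<le> 1 / 2" unfolding j_def by linarith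
  moreover have "x - of_int j * real m ^ 3 = (x / real m ^ 3 - of_int j) * real m ^ 3"
    using m by (simp add: field_simps)
  ultimately have "\<bar>x - of_int j * real m ^ 3\<bar> \<le> 1 / 2 * real m ^ 3"
    using m by (simp only: abs_mult) (intro mult_mono, auto)
  with n show thesis using that by simp
qed

text \<open>If \<open>w\<close> lies between the rows \<open>m\<close> and \<open>m + 1\<close>,
  some zero of row \<open>m\<close> is within \<open>16 * m ^ 3\<close>, while the distance to its
  reflection is at least \<open>2 * m ^ 4\<close>. The ratio is at most
  \<open>8 / m\<close>.\<close>

lemma zeros_dense:
  assumes K: "1 \<le> K" and w: "real K ^ 4 \<le> Im w"
  obtains n where "norm (blaschke_factor (zero_seq n) (cayley w)) \<le> 8 / real K"
proof -
  have "1 \<le> real K ^ 4" using K by simp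
  then have "1 \<le> Im w" using w by linarith
  then obtain m where m: "1 \<le> m" "real m ^ 4 \<le> Im w" "Im w < (real m + 1) ^ 4"
    by (rule fourth_root_floor)
  obtain n where n: "zero_height n = m" "\<bar>Re w - Re (zero_point n)\<bar> \<le> real m ^ 3 / 2"
    by (rule zero_point_near[OF m(1)])
  define v where "v = zero_point n"
  have v: "Im v = real m ^ 4" using n by (simp add: v_def Im_zero_point)
  have m1: "1 \<le> real m" using m by simp
  have "real K < real m + 1"
    using power_less_imp_less_base[of "real K" 4 "real m + 1"] w m by simp
  then have Km: "real K \<le> real m" by simp
  have "real m \<le> real m ^ 3" "real m ^ 2 \<le> real m ^ 3" "1 \<le> real m ^ 3"
    using m1 self_le_power[of "real m" 3] power_increasing[of 2 3 "real m"] by auto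
  \<comment> \<open>The binomial coefficients below the top one add up to 4 + 6 + 4 + 1 =
    15.\<close>
  then have "(real m + 1) ^ 4 - real m ^ 4 \<le> 15 * real m ^ 3"
    by (simp add: power4_eq_xxxx power3_eq_cube power2_eq_square algebra_simps)
  then have im: "\<bar>Im w - Im v\<bar> \<le> 15 * real m ^ 3" using m v by simp
  have "norm (w - v) \<le> \<bar>Re (w - v)\<bar> + \<bar>Im (w - v)\<bar>" by (rule cmod_le)
  also have "\<dots> \<le> real m ^ 3 / 2 + 15 * real m ^ 3"
    using n im by (simp add: v_def)
  also have "\<dots> \<le> 16 * real m ^ 3" by simp
  finally have 1: "norm (w - v) \<le> 16 * real m ^ 3" .
  have "2 * real m ^ 4 \<le> \<bar>Im (w - cnj v)\<bar>" using m v by simp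
  also have "\<dots> \<le> norm (w - cnj v)" by (rule abs_Im_le_cmod)
  finally have 2: "2 * real m ^ 4 \<le> norm (w - cnj v)" .
  have "norm (blaschke_factor (zero_seq n) (cayley w)) = norm (w - v) / norm (w - cnj v)"
    unfolding zero_seq_def v_def using \<open>1 \<le> Im w\<close>
    by (intro norm_blaschke_factor_cayley Im_zero_point_pos) auto
  also have "\<dots> \<le> 16 * real m ^ 3 / (2 * real m ^ 4)"
    using 1 2 m1 by (intro frac_le) auto
  also have "\<dots> = 8 / real m" using m1 by (simp add: field_simps eval_nat_numeral)
  also have "\<dots> \<le> 8 / real K" using Km K by (intro divide_left_mono) auto
  finally show thesis by (rule that)
qed

text \<open>Already above height \<open>\<nu>\<close> every point has a zero at pseudohyperbolic
  distance bounded away from 1. Below height 1 a nearest point of the first row serves; above it one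
  in the last row not higher than \<open>w\<close>.\<close>

lemma zeros_near:
  assumes \<nu>: "0 < \<nu>" "\<nu> \<le> 1 / 10" and w: "\<nu> \<le> Im w"
  obtains n where "\<nu> / 2 \<le> 1 - (norm (blaschke_factor (zero_seq n) (cayley w)))\<^sup>2"
proof -
  have Iw: "0 < Im w" using \<nu> w by linarith
  have eq: "1 - (norm (blaschke_factor (zero_seq n) (cayley w)))\<^sup>2
      = 4 * Im (zero_point n) * Im w / ((Re w - Re (zero_point n))\<^sup>2 + (Im w + Im (zero_point n))\<^sup>2)" for n
    unfolding zero_seq_def one_minus_blaschke_factor_cayley[OF Im_zero_point_pos Iw]
    by (simp add: cmod_power2)
  show thesis
  proof (cases "Im w < 1")
    case True
    obtain n where n: "zero_height n = 1" "\<bar>Re w - Re (zero_point n)\<bar> \<le> real 1 ^ 3 / 2"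
      by (rule zero_point_near[of 1]) auto
    have "(Re w - Re (zero_point n))\<^sup>2 \<le> 1"
      using n by (simp add: abs_square_le_1)
    moreover have "(Im w + 1)\<^sup>2 \<le> 2\<^sup>2" using True Iw by (intro power_mono) auto
    ultimately have "(Re w - Re (zero_point n))\<^sup>2 + (Im w + 1)\<^sup>2 \<le> 8" by simp
    moreover have "0 < (Re w - Re (zero_point n))\<^sup>2 + (Im w + 1)\<^sup>2"
      using Iw by (intro add_nonneg_pos) auto
    ultimately have "4 * \<nu> / 8 \<le> 4 * Im w / ((Re w - Re (zero_point n))\<^sup>2 + (Im w + 1)\<^sup>2)"
      using w Iw by (intro frac_le) auto
    then show thesis using n by (intro that[of n]) (simp add: eq Im_zero_point)
  next
    case False
    then obtain m where m: "1 \<le> m" "real m ^ 4 \<le> Im w" "Im w < (real m + 1) ^ 4"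
      using fourth_root_floor[of "Im w"] by (metis not_less)
    obtain n where n: "zero_height n = m" "\<bar>Re w - Re (zero_point n)\<bar> \<le> real m ^ 3 / 2"
      by (rule zero_point_near[OF m(1)])
    have m1: "1 \<le> real m" using m by simp
    have "real m ^ 3 \<le> real m ^ 4" using m1 by (intro power_increasing) auto
    then have "\<bar>Re w - Re (zero_point n)\<bar> \<le> \<bar>Im w\<bar>" using n m False by linarith
    then have "(Re w - Re (zero_point n))\<^sup>2 \<le> (Im w)\<^sup>2" by (simp add: abs_le_square_iff)
    moreover have "(Im w + real m ^ 4)\<^sup>2 \<le> (2 * Im w)\<^sup>2" using m Iw by (intro power_mono) auto
    ultimately have 1: "(Re w - Re (zero_point n))\<^sup>2 + (Im w + real m ^ 4)\<^sup>2 \<le> 5 * (Im w)\<^sup>2"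
      by (simp add: power_mult_distrib)
    have "(real m + 1) ^ 4 \<le> (2 * real m) ^ 4" using m1 by (intro power_mono) auto
    then have 2: "Im w \<le> 16 * real m ^ 4" using m by (simp add: power_mult_distrib)
    \<comment> \<open>Above height 1 the lower bound is the absolute constant 1/20, so
      \<open>\<nu> \<le> 1 / 10\<close> makes the claimed bound valid there too.\<close>
    have "\<nu> / 2 \<le> 1 / 20" using \<nu> by simp
    also have "\<dots> = 4 * (Im w / 16) * Im w / (5 * (Im w)\<^sup>2)"
      using Iw by (simp add: field_simps power2_eq_square)
    also have "\<dots> \<le> 4 * real m ^ 4 * Im w / ((Re w - Re (zero_point n))\<^sup>2 + (Im w + real m ^ 4)\<^sup>2)"
      using 1 2 Iw m1 by (intro frac_le mult_right_mono mult_left_mono add_nonneg_pos) auto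
    finally show thesis using n by (intro that[of n]) (simp add: eq Im_zero_point)
  qed
qed

section \<open>Invertibility modulo the high and modulo the low zeros\<close>

text \<open>The extension of \<open>1 / F\<close> modulo the product is the inverse. Zeros no lower
  than \<open>2 * (a + 1)\<close> keep the product bounded below up to \<open>a + 1\<close>, which
  leaves a strip above \<open>a\<close> for the splitting.\<close>

lemma high_zeros_invertible:
  assumes F: "F holomorphic_on {w. 0 < Im w}" "\<And>w. 0 < Im w \<Longrightarrow> norm (F w) \<le> M"
    and \<eta>: "0 < \<eta>" "0 \<le> a" "\<And>w. a < Im w \<Longrightarrow> \<eta> \<le> norm (F w)"
    and J: "\<And>n. n \<in> J \<Longrightarrow> 2 * (a + 1) \<le> Im (zero_point n)"
  obtains g K B where "g holomorphic_on {w. 0 < Im w}" "K holomorphic_on {w. 0 < Im w}"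
    "\<And>w. 0 < Im w \<Longrightarrow> norm (g w) \<le> B" "\<And>w. 0 < Im w \<Longrightarrow> norm (K w) \<le> B"
    "\<And>w. 0 < Im w \<Longrightarrow> F w * g w - 1 = halfplane_blaschke J w * K w"
proof -
  let ?\<Theta> = "halfplane_blaschke J"
  have "0 < a + 1" using \<eta> by simp
  then obtain c where c: "0 < c" "\<And>w. 0 < Im w \<Longrightarrow> Im w < a + 1 \<Longrightarrow> c \<le> norm (?\<Theta> w)"
    by (rule halfplane_blaschke_bounded_below[OF _ J]) blast+
  obtain C s where C: "0 < C" and s: "a < s" "s < a + 1" and ext: "bounded_extension ?\<Theta> a s C"
    by (rule halfplane_extension[OF halfplane_blaschke_holomorphic norm_halfplane_blaschke_le_1 c \<eta>(2)])
      auto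
  have nz: "F w \<noteq> 0" if "a < Im w" for w using \<eta>(3)[OF that] \<eta>(1) by auto
  have e_hol: "(\<lambda>w. 1 / F w) holomorphic_on {w. a < Im w}"
    using nz \<eta> by (intro holomorphic_intros holomorphic_on_subset[OF F(1)]) auto
  have e_bd: "norm (1 / F w) \<le> 1 / \<eta>" if "a < Im w" for w
    unfolding norm_divide using \<eta>(3)[OF that] \<eta>(1) by (intro frac_le) auto
  obtain E k where E: "E holomorphic_on {w. 0 < Im w}" "\<And>w. 0 < Im w \<Longrightarrow> norm (E w) \<le> C * (1 / \<eta>)"
    and k: "k holomorphic_on {w. s < Im w}" "\<And>w. s < Im w \<Longrightarrow> norm (k w) \<le> C * (1 / \<eta>)"
    and Ek: "\<And>w. s < Im w \<Longrightarrow> E w = 1 / F w + ?\<Theta> w * k w"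
    by (rule bounded_extensionE[OF ext e_hol e_bd]) blast+
  have M: "0 \<le> M" using order_trans[OF norm_ge_zero F(2)[of \<i>]] by simp
  have FE_bd: "norm (F w * E w - 1) \<le> M * (C * (1 / \<eta>)) + 1" if "0 < Im w" for w
  proof -
    have "norm (F w * E w) \<le> M * (C * (1 / \<eta>))"
      unfolding norm_mult using that M by (intro mult_mono F E) auto
    then show ?thesis using norm_triangle_ineq4[of "F w * E w" 1] by simp
  qed
  have Fk_bd: "norm (F w * k w) \<le> M * (C * (1 / \<eta>))" if "s < Im w" for w
    unfolding norm_mult using that M s \<eta> by (intro mult_mono F k) auto
  have eq: "F w * E w - 1 = ?\<Theta> w * (F w * k w)" if "s < Im w" for w
    using nz[of w] that s by (simp add: Ek algebra_simps)
  obtain K B where K: "K holomorphic_on {w. 0 < Im w}" "\<And>w. 0 < Im w \<Longrightarrow> norm (K w) \<le> B"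
    "\<And>w. 0 < Im w \<Longrightarrow> F w * E w - 1 = ?\<Theta> w * K w"
  proof (rule halfplane_divide[OF halfplane_blaschke_holomorphic c _ FE_bd _ Fk_bd _ s(2) eq])
    show "(\<lambda>w. F w * E w - 1) holomorphic_on {w. 0 < Im w}"
      using F E by (intro holomorphic_intros)
    show "(\<lambda>w. F w * k w) holomorphic_on {w. s < Im w}"
      using s \<eta> by (intro holomorphic_intros k holomorphic_on_subset[OF F(1)]) auto
    show "0 \<le> s" using s \<eta> by simp
  qed auto
  show thesis
  proof (rule that[OF E(1) K(1)])
    show "norm (E w) \<le> max B (C * (1 / \<eta>))" if "0 < Im w" for w using E(2)[OF that] by simp
    show "norm (K w) \<le> max B (C * (1 / \<eta>))" if "0 < Im w" for w using K(2)[OF that] by simp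
  qed (use K in auto)
qed

text \<open>Carleson's interpolation condition for finitely many rows: distances at least 1 and
  heights at most \<open>m ^ 4\<close> separate the zeros pseudohyperbolically, and the sum over the
  zeros is bounded at these heights.\<close>

lemma low_zeros_separated:
  obtains c where "0 < c"
    "\<And>j. zero_height j \<le> m \<Longrightarrow> c \<le> norm (halfplane_blaschke ({n. zero_height n \<le> m} - {j}) (zero_point j))"
proof -
  \<comment> \<open>This comes from \<open>norm_diff_cnj\<close>: the squared distance to a
    reflected zero exceeds that to the zero by at most \<open>4 * m ^ 8\<close>, and the latter is
    at least 1.\<close>
  define t where "t = 1 / (1 + 4 * (real m ^ 4 * real m ^ 4))"
  define \<sigma> where "\<sigma> = 4 * real m ^ 4 * zeros_sum_bound"
  have t: "0 < t" by (simp add: t_def add_pos_nonneg)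
  show thesis
  proof (rule that[of "sqrt (exp (- \<sigma> / t))"])
    fix j assume j: "zero_height j \<le> m"
    define w where "w = zero_point j"
    have w: "0 < Im w" "Im w \<le> real m ^ 4"
      using j Im_zero_point_pos by (simp_all add: w_def Im_zero_point power_mono)
    have "exp (- \<sigma> / t) \<le> (norm (halfplane_blaschke ({n. zero_height n \<le> m} - {j}) w))\<^sup>2"
    proof (rule norm_blaschke_product_ge[OF blaschke_zeros_zero_seq norm_cayley_less_1[OF w(1)] t])
      fix n assume n: "n \<in> {n. zero_height n \<le> m} - {j}"
      define v where "v = zero_point n"
      have v: "0 < Im v" "Im v \<le> real m ^ 4"
        using n Im_zero_point_pos by (simp_all add: v_def Im_zero_point power_mono)
      have "1 \<le> norm (w - v)" using zero_point_dist[of j n] n by (simp add: w_def v_def)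
      then have d: "1 \<le> (norm (w - v))\<^sup>2" by simp
      have "Im v * Im w \<le> real m ^ 4 * real m ^ 4" using v w by (intro mult_mono) auto
      also have "\<dots> \<le> real m ^ 4 * real m ^ 4 * (norm (w - v))\<^sup>2"
        using d by (simp add: mult_le_cancel_left1)
      finally have "(norm (w - cnj v))\<^sup>2 \<le> (1 + 4 * (real m ^ 4 * real m ^ 4)) * (norm (w - v))\<^sup>2"
        by (simp add: norm_diff_cnj algebra_simps)
      moreover have "0 < (norm (w - cnj v))\<^sup>2" using diff_cnj_nonzero[OF v(1) w(1)] by simp
      moreover have "0 < 1 + 4 * (real m ^ 4 * real m ^ 4)" by (simp add: add_pos_nonneg)
      ultimately have "t \<le> (norm (w - v))\<^sup>2 / (norm (w - cnj v))\<^sup>2"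
        unfolding t_def by (simp add: divide_simps mult.commute)
      then show "t \<le> (norm (blaschke_factor (zero_seq n) (cayley w)))\<^sup>2"
        using norm_blaschke_factor_cayley[OF v(1) w(1)]
        by (simp add: zero_seq_def v_def power_divide)
    next
      fix I :: "nat set" assume "finite I"
      have "(\<Sum>n\<in>I. 1 - (norm (blaschke_factor (zero_seq n) (cayley w)))\<^sup>2)
          \<le> 4 * Im w * zeros_sum_bound"
        by (rule sum_one_minus_blaschke_factor_le[OF w(1) \<open>finite I\<close>])
      also have "\<dots> \<le> \<sigma>"
        unfolding \<sigma>_def using w zeros_sum_bound(1) by (intro mult_right_mono) auto
      finally show "(\<Sum>n\<in>I. 1 - (norm (blaschke_factor (zero_seq n) (cayley w)))\<^sup>2) \<le> \<sigma>" .
    qed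
    then show "sqrt (exp (- \<sigma> / t))
        \<le> norm (halfplane_blaschke ({n. zero_height n \<le> m} - {j}) (zero_point j))"
      unfolding w_def by (intro real_le_lsqrt) auto
  qed simp
qed

text \<open>The functions \<open>P j\<close> in the proof are P. Beurling functions: \<open>P j\<close> is \<open>1\<close> at the \<open>j\<close>th point and
  vanishes at the others, and the sum of their moduli is bounded.\<close>

lemma low_zeros_interpolation:
  assumes \<eta>: "\<And>n. zero_height n \<le> m \<Longrightarrow> norm (v n) \<le> A"
  obtains g B where "g holomorphic_on {w. 0 < Im w}" "\<And>w. 0 < Im w \<Longrightarrow> norm (g w) \<le> B"
    "\<And>n. zero_height n \<le> m \<Longrightarrow> g (zero_point n) = v n"
proof -
  define J where "J = {n. zero_height n \<le> m}"
  obtain c where c: "0 < c" "\<And>j. j \<in> J \<Longrightarrow> c \<le> norm (halfplane_blaschke (J - {j}) (zero_point j))"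
    unfolding J_def by (rule low_zeros_separated) auto
  define b where "b j = halfplane_blaschke (J - {j}) (zero_point j)" for j
  define y where "y j = Im (zero_point j)" for j
  \<comment> \<open>The Blaschke quotient alone already has the right values. The squared factor
    equals 1 at the \<open>j\<close>th point and has modulus \<open>4 * (y j)\<^sup>2\<close> over a
    squared distance; with \<open>y j \<le> m ^ 4\<close> this gives terms with bounded
    sums.\<close>
  define P where "P j w = halfplane_blaschke (J - {j}) w / b j
    * (2 * \<i> * of_real (y j) / (w - cnj (zero_point j)))\<^sup>2" for j w
  define g where "g N w = (\<Sum>j\<in>J \<inter> {..<N}. v j * P j w)" for N :: nat and w
  \<comment> \<open>For \<open>m = 0\<close> there are no low zeros and \<open>A\<close> may be
    negative, hence \<open>max A 0\<close>.\<close>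
  define B where "B = max A 0 / c * (4 * real m ^ 4 * zeros_sum_bound)"
  have y: "0 < y j" for j by (simp add: y_def Im_zero_point_pos)
  have ym: "y j \<le> real m ^ 4" if "j \<in> J" for j
    using that by (simp add: y_def J_def Im_zero_point power_mono)
  have b: "b j \<noteq> 0" if "j \<in> J" for j using c(2)[OF that] c(1) by (auto simp: b_def)
  have P_hol: "P j holomorphic_on {w. 0 < Im w}" if "j \<in> J" for j
    unfolding P_def using diff_cnj_nonzero[OF Im_zero_point_pos] b[OF that]
    by (intro holomorphic_intros halfplane_blaschke_holomorphic) auto
  have P_diag: "P j (zero_point j) = 1" if "j \<in> J" for j
  proof -
    have "zero_point j - cnj (zero_point j) = 2 * \<i> * of_real (y j)"
      by (simp add: complex_eq_iff y_def)
    then show ?thesis using b[OF that] y[of j] by (simp add: P_def b_def)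
  qed
  have P_off: "P j (zero_point i) = 0" if "i \<in> J" "i \<noteq> j" for i j
    using blaschke_product_zero[OF blaschke_zeros_zero_seq, of i "J - {j}"] that
    by (simp add: P_def zero_seq_def)
  have P_bd: "norm (v j * P j w) \<le> max A 0 / c * (4 * real m ^ 4) * (y j / (norm (w - cnj (zero_point j)))\<^sup>2)"
    if "j \<in> J" "0 < Im w" for j w
  proof -
    have "norm (halfplane_blaschke (J - {j}) w / b j) \<le> 1 / c"
      unfolding norm_divide b_def using that c norm_halfplane_blaschke_le_1 by (intro frac_le) auto
    moreover have "norm (v j) \<le> max A 0" using \<eta> that by (auto simp: J_def le_max_iff_disj)
    ultimately have 1: "norm (v j) * norm (halfplane_blaschke (J - {j}) w / b j) \<le> max A 0 * (1 / c)"
      by (intro mult_mono) auto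
    have "norm ((2 * \<i> * of_real (y j) / (w - cnj (zero_point j)))\<^sup>2)
        = 4 * (y j * y j) / (norm (w - cnj (zero_point j)))\<^sup>2"
      using y[of j] by (simp add: norm_power norm_divide norm_mult power_divide power2_eq_square)
    also have "\<dots> \<le> 4 * (real m ^ 4 * y j) / (norm (w - cnj (zero_point j)))\<^sup>2"
      using y[of j] ym[OF that(1)] by (intro divide_right_mono mult_left_mono mult_right_mono) auto
    finally have 2: "norm ((2 * \<i> * of_real (y j) / (w - cnj (zero_point j)))\<^sup>2)
        \<le> 4 * real m ^ 4 * (y j / (norm (w - cnj (zero_point j)))\<^sup>2)" by simp
    have "norm (v j * P j w) \<le> max A 0 * (1 / c)
        * (4 * real m ^ 4 * (y j / (norm (w - cnj (zero_point j)))\<^sup>2))"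
      unfolding P_def norm_mult mult.assoc[symmetric, of "norm (v j)"]
      using c by (intro mult_mono[OF 1[unfolded norm_mult] 2]) auto
    then show ?thesis by (simp add: mult.assoc)
  qed
  have g_hol: "g N holomorphic_on {w. 0 < Im w}" for N
    unfolding g_def using P_hol by (intro holomorphic_intros) auto
  have g_bd: "norm (g N w) \<le> B" if "0 < Im w" for N w
  proof -
    have "norm (g N w) \<le> (\<Sum>j\<in>J \<inter> {..<N}.
        max A 0 / c * (4 * real m ^ 4) * (y j / (norm (w - cnj (zero_point j)))\<^sup>2))"
      unfolding g_def using P_bd that by (intro sum_norm_le) auto
    also have "\<dots> \<le> max A 0 / c * (4 * real m ^ 4) * zeros_sum_bound"
      unfolding sum_distrib_left[symmetric] y_def
      using c that by (intro mult_left_mono sum_zero_points_le) auto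
    finally show ?thesis by (simp add: B_def mult.assoc)
  qed
  obtain G r where G: "G holomorphic_on {w. 0 < Im w}" and r: "strict_mono (r :: nat \<Rightarrow> nat)"
    and lim: "\<And>w. w \<in> {w. 0 < Im w} \<Longrightarrow> (\<lambda>n. g (r n) w) \<longlonglongrightarrow> G w"
    and G_bd: "\<And>w. w \<in> {w. 0 < Im w} \<Longrightarrow> norm (G w) \<le> B"
    by (rule Montel_bounded[OF open_halfspace_Im_gt, where F = g and M = B]) (use g_hol g_bd in auto)
  have "G (zero_point i) = v i" if i: "i \<in> J" for i
  proof (rule LIMSEQ_unique)
    show "(\<lambda>n. g (r n) (zero_point i)) \<longlonglongrightarrow> G (zero_point i)"
      using lim Im_zero_point_pos by simp
    have "g N (zero_point i) = v i" if "i < N" for N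
    proof -
      have "g N (zero_point i) = (\<Sum>j\<in>J \<inter> {..<N}. if j = i then v i else 0)"
        unfolding g_def using P_off[OF i] P_diag[OF i] by (intro sum.cong) auto
      then show ?thesis using that i by simp
    qed
    then have "g (r n) (zero_point i) = v i" if "Suc i \<le> n" for n
      using seq_suble[OF r, of n] that by simp
    then show "(\<lambda>n. g (r n) (zero_point i)) \<longlonglongrightarrow> v i"
      by (intro tendsto_eventually eventually_at_top_linorderI[of "Suc i"]) auto
  qed
  with G G_bd show thesis by (intro that[of G B]) (auto simp: J_def)
qed

text \<open>Interpolating \<open>1 / F\<close> by a bounded \<open>g\<close> makes
  \<open>F * g - 1\<close> vanish at all low zeros, which are simple; dividing by their Blaschke
  product in the disc gives \<open>K\<close>.\<close>

lemma low_zeros_invertible: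
  assumes F: "F holomorphic_on {w. 0 < Im w}" "\<And>w. 0 < Im w \<Longrightarrow> norm (F w) \<le> M"
    and \<eta>: "0 < \<eta>" "\<And>n. zero_height n \<le> m \<Longrightarrow> \<eta> \<le> norm (F (zero_point n))"
  obtains g K B where "g holomorphic_on {w. 0 < Im w}" "K holomorphic_on {w. 0 < Im w}"
    "\<And>w. 0 < Im w \<Longrightarrow> norm (g w) \<le> B" "\<And>w. 0 < Im w \<Longrightarrow> norm (K w) \<le> B"
    "\<And>w. 0 < Im w \<Longrightarrow> F w * g w - 1 = halfplane_blaschke {n. zero_height n \<le> m} w * K w"
proof -
  define J where "J = {n. zero_height n \<le> m}"
  have v: "norm (1 / F (zero_point n)) \<le> 1 / \<eta>" if "zero_height n \<le> m" for n
    unfolding norm_divide using \<eta>(2)[OF that] \<eta>(1) by (intro frac_le) auto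
  obtain g B where g: "g holomorphic_on {w. 0 < Im w}" "\<And>w. 0 < Im w \<Longrightarrow> norm (g w) \<le> B"
    "\<And>n. zero_height n \<le> m \<Longrightarrow> g (zero_point n) = 1 / F (zero_point n)"
    by (rule low_zeros_interpolation[OF v]) blast+
  define H where "H w = F w * g w - 1" for w
  have M: "0 \<le> M" using order_trans[OF norm_ge_zero F(2)[of \<i>]] by simp
  have H_hol: "H holomorphic_on {w. 0 < Im w}"
    unfolding H_def by (intro holomorphic_intros F g)
  have H_bd: "norm (H w) \<le> M * B + 1" if "0 < Im w" for w
  proof -
    have "norm (F w * g w) \<le> M * B"
      unfolding norm_mult using that M by (intro mult_mono F g) auto
    then show ?thesis using norm_triangle_ineq4[of "F w * g w" 1] by (simp add: H_def)
  qed
  have Hi_hol: "(H \<circ> inv_cayley) holomorphic_on unit_disc"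
    by (rule holomorphic_on_compose_gen[OF inv_cayley_holomorphic H_hol])
      (use Im_inv_cayley_pos in auto)
  have Hi_bd: "norm ((H \<circ> inv_cayley) z) \<le> M * B + 1" if "norm z < 1" for z
    using H_bd[OF Im_inv_cayley_pos[OF that]] by simp
  have Hi_zero: "(H \<circ> inv_cayley) (zero_seq n) = 0" if "n \<in> J" for n
  proof -
    have h: "zero_height n \<le> m" using that by (simp add: J_def)
    have "F (zero_point n) \<noteq> 0" using \<eta>(2)[OF h] \<eta>(1) by auto
    then show ?thesis
      using g(3)[OF h] by (simp add: zero_seq_def inv_cayley_cayley[OF Im_zero_point_pos] H_def)
  qed
  have inj: "inj_on zero_seq J" using inj_zero_seq by (rule inj_on_subset) simp
  obtain K where K: "K holomorphic_on unit_disc" "\<And>z. norm z < 1 \<Longrightarrow> norm (K z) \<le> M * B + 1"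
    "\<And>z. norm z < 1 \<Longrightarrow> (H \<circ> inv_cayley) z = blaschke_product J zero_seq z * K z"
    by (rule blaschke_product_divide[OF blaschke_zeros_zero_seq inj Hi_hol Hi_bd Hi_zero]) blast+
  show thesis
  proof (rule that[OF g(1)])
    show "(\<lambda>w. K (cayley w)) holomorphic_on {w. 0 < Im w}"
      using holomorphic_on_compose_gen[OF cayley_holomorphic K(1)] norm_cayley_less_1
      by (force simp: o_def)
    show "norm (g w) \<le> max B (M * B + 1)" if "0 < Im w" for w using g(2)[OF that] by simp
    show "norm (K (cayley w)) \<le> max B (M * B + 1)" if "0 < Im w" for w
      using K(2)[OF norm_cayley_less_1[OF that]] by simp
    show "F w * g w - 1 = halfplane_blaschke {n. zero_height n \<le> m} w * K (cayley w)"
      if "0 < Im w" for w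
      using K(3)[OF norm_cayley_less_1[OF that]] inv_cayley_cayley[OF that]
      by (simp add: H_def J_def)
  qed
qed

section \<open>Bounded analytic functions\<close>

lemma Hinf_norm_upper:
  assumes "f \<in> Hinf" "norm z < 1"
  shows "norm (f z) \<le> Hinf_norm f"
proof -
  have "bdd_above ((\<lambda>z. norm (f z)) ` unit_disc)"
    using assms(1) by (auto simp: Hinf_def bounded_iff bdd_above_def)
  then show ?thesis
    unfolding Hinf_norm_def using assms(2) by (intro cSUP_upper) auto
qed

lemma Hinf_norm_nonneg: "f \<in> Hinf \<Longrightarrow> 0 \<le> Hinf_norm f"
  using order_trans[OF norm_ge_zero Hinf_norm_upper[of f 0]] by simp

lemma Hinf_norm_least:
  assumes "\<And>z. norm z < 1 \<Longrightarrow> norm (f z) \<le> B"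
  shows "Hinf_norm f \<le> B"
  unfolding Hinf_norm_def using assms by (intro cSUP_least) auto

lemma HinfI:
  assumes "f holomorphic_on unit_disc" "\<And>z. norm z < 1 \<Longrightarrow> norm (f z) \<le> B"
  shows "f \<in> Hinf"
  using assms by (auto simp: Hinf_def bounded_iff intro!: exI[of _ B])

lemma Hinf_holomorphic: "f \<in> Hinf \<Longrightarrow> f holomorphic_on unit_disc"
  by (simp add: Hinf_def)

lemma Hinf_add:
  assumes "f \<in> Hinf" "g \<in> Hinf"
  shows "(\<lambda>z. f z + g z) \<in> Hinf"
proof (rule HinfI)
  show "norm (f z + g z) \<le> Hinf_norm f + Hinf_norm g" if "norm z < 1" for z
    using assms that by (intro norm_triangle_mono Hinf_norm_upper)
  show "(\<lambda>z. f z + g z) holomorphic_on unit_disc"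
    by (intro holomorphic_on_add assms[THEN Hinf_holomorphic])
qed

lemma Hinf_mult:
  assumes "f \<in> Hinf" "g \<in> Hinf"
  shows "(\<lambda>z. f z * g z) \<in> Hinf"
proof (rule HinfI)
  show "norm (f z * g z) \<le> Hinf_norm f * Hinf_norm g" if "norm z < 1" for z
    unfolding norm_mult using assms that by (intro mult_mono Hinf_norm_upper Hinf_norm_nonneg) auto
  show "(\<lambda>z. f z * g z) holomorphic_on unit_disc"
    by (intro holomorphic_on_mult assms[THEN Hinf_holomorphic])
qed

lemma Hinf_inv_cayley:
  assumes "g holomorphic_on {w. 0 < Im w}" "\<And>w. 0 < Im w \<Longrightarrow> norm (g w) \<le> B"
  shows "(\<lambda>z. g (inv_cayley z)) \<in> Hinf"
proof (rule HinfI)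
  show "(\<lambda>z. g (inv_cayley z)) holomorphic_on unit_disc"
    using holomorphic_on_compose_gen[OF inv_cayley_holomorphic assms(1)] Im_inv_cayley_pos
    by (force simp: o_def)
  show "norm (g (inv_cayley z)) \<le> B" if "norm z < 1" for z
    using assms(2) Im_inv_cayley_pos[OF that] by simp
qed

lemma Hinf_cayley:
  assumes "f \<in> Hinf"
  shows "(\<lambda>w. f (cayley w)) holomorphic_on {w. 0 < Im w}"
    and "0 < Im w \<Longrightarrow> norm (f (cayley w)) \<le> Hinf_norm f"
proof -
  show "(\<lambda>w. f (cayley w)) holomorphic_on {w. 0 < Im w}"
    using holomorphic_on_compose_gen[OF cayley_holomorphic Hinf_holomorphic[OF assms]] norm_cayley_less_1
    by (force simp: o_def)
  show "0 < Im w \<Longrightarrow> norm (f (cayley w)) \<le> Hinf_norm f"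
    by (intro Hinf_norm_upper assms norm_cayley_less_1)
qed

section \<open>The quotient norm\<close>

lemma quotient_norm_le:
  assumes "f \<in> Hinf" "\<Theta> \<in> Hinf"
  shows "quotient_norm \<Theta> f \<le> Hinf_norm f"
proof -
  have "Hinf_norm (\<lambda>z. f z + g z * \<Theta> z) \<ge> 0" if "g \<in> Hinf" for g
    using assms that by (intro Hinf_norm_nonneg Hinf_add Hinf_mult)
  then have "bdd_below ((\<lambda>g. Hinf_norm (\<lambda>z. f z + g z * \<Theta> z)) ` Hinf)"
    by (auto simp: bdd_below_def)
  moreover have "(\<lambda>_. 0) \<in> Hinf" by (rule HinfI[of _ 0]) auto
  ultimately show ?thesis
    unfolding quotient_norm_def by (rule order_trans[OF cINF_lower]) simp
qed

text \<open>The strict inequality yields an actual representative, whether or not the infimum is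
  attained.\<close>

lemma quotient_norm_lessE:
  assumes "f \<in> Hinf" "\<Theta> \<in> Hinf" "quotient_norm \<Theta> f < r"
  obtains g where "g \<in> Hinf" "Hinf_norm (\<lambda>z. f z + g z * \<Theta> z) < r"
proof -
  have "Hinf_norm (\<lambda>z. f z + g z * \<Theta> z) \<ge> 0" if "g \<in> Hinf" for g
    using assms that by (intro Hinf_norm_nonneg Hinf_add Hinf_mult)
  then have "bdd_below ((\<lambda>g. Hinf_norm (\<lambda>z. f z + g z * \<Theta> z)) ` Hinf)"
    by (auto simp: bdd_below_def)
  then show thesis
    using assms(1,3) that unfolding quotient_norm_def by (subst (asm) cINF_less_iff) auto
qed

lemma inf_on_zeros_blaschke_le:
  assumes "blaschke_zeros J a" "j \<in> J"
  shows "inf_on_zeros (blaschke_product J a) f \<le> ereal (norm (f (a j)))"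
  unfolding inf_on_zeros_def using blaschke_zero_set[OF assms(1)] assms(2) by (intro INF_lower) auto

section \<open>The weak embedding property\<close>

lemma WEP_zero_seq: "WEP (blaschke_product UNIV zero_seq)"
  unfolding WEP_def
proof (intro ballI impI)
  fix f assume f: "f \<in> Hinf" and pos: "0 < inf_on_zeros (blaschke_product UNIV zero_seq) f"
  obtain \<eta> where \<eta>: "0 < \<eta>" "ereal \<eta> < inf_on_zeros (blaschke_product UNIV zero_seq) f"
    using ereal_dense2[OF pos] by (auto simp: zero_ereal_def)
  have f_zero: "\<eta> \<le> norm (f (zero_seq n))" for n
    using less_le_trans[OF \<eta>(2) inf_on_zeros_blaschke_le[OF blaschke_zeros_zero_seq UNIV_I, of f n]]
    by simp
  \<comment> \<open>The summand 1 makes \<open>M\<close> positive and puts the values of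
    \<open>f / M\<close> into the open disc, as the Schwarz-Pick inequality requires.\<close>
  define M where "M = Hinf_norm f + 1"
  have M: "0 < M" using Hinf_norm_nonneg[OF f] by (simp add: M_def)
  have fM: "norm (f z / of_real M) < 1" if "norm z < 1" for z
    using Hinf_norm_upper[OF f that] M by (simp add: norm_divide M_def)
  have fM_hol: "(\<lambda>z. f z / of_real M) holomorphic_on unit_disc"
    using Hinf_holomorphic[OF f] M by (intro holomorphic_intros) auto
  \<comment> \<open>Chosen so that the oscillation bound \<open>16 * M / K\<close> below is at most
    \<open>\<eta> / 2\<close>.\<close>
  define K where "K = nat \<lceil>32 * M / \<eta>\<rceil> + 1"
  have K: "1 \<le> K" "32 * M / \<eta> \<le> real K" unfolding K_def by linarith+
  define a where "a = real K ^ 4"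
  have a: "0 \<le> a" by (simp add: a_def)
  have large: "\<eta> / 2 \<le> norm (f (cayley w))" if "a < Im w" for w
  proof -
    have w: "0 < Im w" using that a by linarith
    have w_high: "real K ^ 4 \<le> Im w" using that by (simp add: a_def)
    obtain n where n: "norm (blaschke_factor (zero_seq n) (cayley w)) \<le> 8 / real K"
      by (rule zeros_dense[OF K(1) w_high])
    let ?F = "\<lambda>z. f z / of_real M"
    have "norm (?F (cayley w) - ?F (zero_seq n)) \<le> 8 / real K * 2"
      using Schwarz_Pick_diff[OF fM_hol fM norm_zero_seq_less_1 norm_cayley_less_1[OF w], of n] n
      by linarith
    moreover have "?F (cayley w) - ?F (zero_seq n) = (f (cayley w) - f (zero_seq n)) / of_real M"
      by (simp add: diff_divide_distrib)
    ultimately have "norm (f (cayley w) - f (zero_seq n)) \<le> 16 * M / real K"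
      using M by (simp add: norm_divide field_simps)
    also have "\<dots> \<le> \<eta> / 2"
      using K \<eta> M by (simp add: field_simps)
    finally show ?thesis
      using f_zero[of n] norm_triangle_ineq2[of "f (zero_seq n)" "f (cayley w)"]
      by (simp add: norm_minus_commute)
  qed
  \<comment> \<open>This separates high from low rows: every row after \<open>m\<close> is high
    enough for \<open>high_zeros_invertible\<close>.\<close>
  define m where "m = nat \<lceil>2 * (a + 1)\<rceil>"
  have high: "2 * (a + 1) \<le> Im (zero_point n)" if "n \<in> {n. m < zero_height n}" for n
  proof -
    have "2 * (a + 1) \<le> real m" unfolding m_def by linarith
    also have "\<dots> \<le> real (zero_height n) ^ 1" using that by simp
    also have "\<dots> \<le> real (zero_height n) ^ 4" using zero_height_pos[of n] by (intro power_increasing) auto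
    finally show ?thesis by (simp add: Im_zero_point)
  qed
  let ?F = "\<lambda>w. f (cayley w)"
  note F = Hinf_cayley[OF f]
  have \<eta>2: "0 < \<eta> / 2" using \<eta> by simp
  obtain g K B where g: "g holomorphic_on {w. 0 < Im w}" "\<And>w. 0 < Im w \<Longrightarrow> norm (g w) \<le> B"
    and K: "K holomorphic_on {w. 0 < Im w}" "\<And>w. 0 < Im w \<Longrightarrow> norm (K w) \<le> B"
    and gK: "\<And>w. 0 < Im w \<Longrightarrow> ?F w * g w - 1 = halfplane_blaschke {n. m < zero_height n} w * K w"
    by (rule high_zeros_invertible[OF F \<eta>2 a large high]) blast+
  have F_low: "\<eta> \<le> norm (?F (zero_point n))" for n
    using f_zero[of n] by (simp add: zero_seq_def)
  obtain g' K' B' where g': "g' holomorphic_on {w. 0 < Im w}" "\<And>w. 0 < Im w \<Longrightarrow> norm (g' w) \<le> B'"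
    and K': "K' holomorphic_on {w. 0 < Im w}" "\<And>w. 0 < Im w \<Longrightarrow> norm (K' w) \<le> B'"
    and gK': "\<And>w. 0 < Im w \<Longrightarrow> ?F w * g' w - 1 = halfplane_blaschke {n. zero_height n \<le> m} w * K' w"
    by (rule low_zeros_invertible[OF F \<eta>(1) F_low]) blast+
  \<comment> \<open>Here \<open>1 - f * h\<close> factors as
    \<open>(1 - f * g) * (1 - f * g')\<close>, a multiple of both partial Blaschke products; this
    also explains the sign in \<open>k\<close>.\<close>
  define h where "h z = g (inv_cayley z) + g' (inv_cayley z) - f z * (g (inv_cayley z) * g' (inv_cayley z))" for z
  define k where "k z = - 1 * (K (inv_cayley z) * K' (inv_cayley z))" for z
  have const: "(\<lambda>_. - 1) \<in> Hinf" by (rule HinfI[of _ 1]) auto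
  note H = Hinf_inv_cayley[OF g] Hinf_inv_cayley[OF g'] Hinf_inv_cayley[OF K] Hinf_inv_cayley[OF K']
  have "(\<lambda>z. g (inv_cayley z) + g' (inv_cayley z)
      + - 1 * (f z * (g (inv_cayley z) * g' (inv_cayley z)))) \<in> Hinf"
    by (intro Hinf_add Hinf_mult H f const)
  then have h: "h \<in> Hinf" by (simp add: h_def[abs_def])
  have k: "k \<in> Hinf"
    unfolding k_def[abs_def] by (intro Hinf_mult H const)
  have "f z * h z = 1 + k z * blaschke_product UNIV zero_seq z" if "z \<in> unit_disc" for z
  proof -
    define w where "w = inv_cayley z"
    have w: "0 < Im w" "cayley w = z"
      using that by (simp_all add: w_def Im_inv_cayley_pos cayley_inv_cayley)
    have un: "{n. m < zero_height n} \<union> {n. zero_height n \<le> m} = UNIV" by auto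
    have "blaschke_product UNIV zero_seq z = halfplane_blaschke {n. m < zero_height n} w * halfplane_blaschke {n. zero_height n \<le> m} w"
      unfolding w(2) using that
      by (subst un[symmetric], subst blaschke_product_union) (auto simp: blaschke_zeros_zero_seq)
    moreover have "f z * h z - 1 = - ((?F w * g w - 1) * (?F w * g' w - 1))"
      by (simp add: h_def w(2) flip: w_def) (simp add: algebra_simps)
    ultimately show ?thesis
      unfolding gK[OF w(1)] gK'[OF w(1)] by (simp add: k_def w_def[symmetric] algebra_simps)
  qed
  then have "quotient_inverse (blaschke_product UNIV zero_seq) f h"
    using h k unfolding quotient_inverse_def quotient_eq_def by blast
  then show "\<exists>h. quotient_inverse (blaschke_product UNIV zero_seq) f h" by blast
qed

section \<open>The sharp invertibility property\<close>

text \<open>By Schwarz-Pick, \<open>F a\<close> and \<open>F z\<close> are no farther apart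
  pseudohyperbolically than \<open>a\<close> and \<open>z\<close>. With
  \<open>1 - norm (F z)\<close> as lower bound for the denominator, one factor
  \<open>1 - norm (F z)\<close> cancels.\<close>

lemma Schwarz_Pick_lower_bound:
  assumes hol: "F holomorphic_on unit_disc" and bd: "\<And>z. norm z < 1 \<Longrightarrow> norm (F z) < 1"
    and a: "norm a < 1" and z: "norm z < 1"
    and \<kappa>: "0 < \<kappa>" "\<kappa> \<le> 1 - (norm (blaschke_factor a z))\<^sup>2"
  shows "1 - norm (F z) \<le> 4 * (1 - norm (F a)) / \<kappa>"
proof -
  let ?c = "F a" and ?v = "F z"
  have n: "norm ?c < 1" "norm ?v < 1" using bd a z by auto
  have nz: "norm (1 - cnj ?c * ?v) > 0" using one_minus_cnj_mult_nonzero[OF n] by simp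
  have "norm (blaschke_factor ?c ?v) \<le> norm (blaschke_factor a z)"
    using Schwarz_Pick_blaschke_factor[OF hol bd a z] nz
    by (simp add: norm_blaschke_factor[of ?c] divide_le_eq norm_minus_commute)
  then have "(norm (blaschke_factor ?c ?v))\<^sup>2 \<le> (norm (blaschke_factor a z))\<^sup>2"
    by (intro power_mono) auto
  then have 1: "\<kappa> \<le> (1 - (norm ?c)\<^sup>2) * (1 - (norm ?v)\<^sup>2) / (norm (1 - cnj ?c * ?v))\<^sup>2"
    using \<kappa> one_minus_norm_blaschke_factor[OF n] by linarith
  have "norm ?c * norm ?v \<le> norm ?v" using n by (simp add: mult_left_le_one_le)
  then have "1 - norm ?v \<le> norm (1 - cnj ?c * ?v)"
    using norm_triangle_ineq2[of 1 "cnj ?c * ?v"] by (simp add: norm_mult)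
  then have "(1 - norm ?v)\<^sup>2 \<le> (norm (1 - cnj ?c * ?v))\<^sup>2"
    using n by (intro power_mono) auto
  then have "\<kappa> * (1 - norm ?v)\<^sup>2 \<le> \<kappa> * (norm (1 - cnj ?c * ?v))\<^sup>2"
    using \<kappa> by (intro mult_left_mono) auto
  also have "\<dots> \<le> (1 - (norm ?c)\<^sup>2) * (1 - (norm ?v)\<^sup>2)"
    using 1 nz by (simp add: pos_le_divide_eq)
  also have "\<dots> = ((1 + norm ?c) * (1 + norm ?v)) * ((1 - norm ?c) * (1 - norm ?v))"
    by (simp add: power2_eq_square algebra_simps)
  also have "\<dots> \<le> (2 * 2) * ((1 - norm ?c) * (1 - norm ?v))"
    using n by (intro mult_right_mono mult_mono) auto
  finally have "(\<kappa> * (1 - norm ?v)) * (1 - norm ?v) \<le> (4 * (1 - norm ?c)) * (1 - norm ?v)"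
    by (simp add: power2_eq_square mult.assoc del: right_diff_distrib_numeral)
  then have "\<kappa> * (1 - norm ?v) \<le> 4 * (1 - norm ?c)"
    by (rule mult_right_le_imp_le) (use n in simp)
  then show ?thesis using \<kappa> by (simp add: pos_le_divide_eq mult.commute)
qed

text \<open>Above height 1/4 a vertical shift by \<open>\<nu>\<close> has pseudohyperbolic length at
  most \<open>2 * \<nu>\<close>, since the distance to the reflected point is at least 1/2.\<close>

lemma halfplane_Schwarz_Pick_vertical:
  assumes hol: "F holomorphic_on unit_disc" and bd: "\<And>z. norm z < 1 \<Longrightarrow> norm (F z) < 1"
    and w: "1 / 4 < Im w" and \<nu>: "0 < \<nu>"
  shows "norm (F (cayley (w + \<i> * of_real \<nu>)) - F (cayley w)) \<le> 4 * \<nu>"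
proof -
  define v where "v = w + \<i> * of_real \<nu>"
  have pos: "0 < Im w" "0 < Im v" using w \<nu> by (auto simp: v_def)
  have "norm (F (cayley v) - F (cayley w)) \<le> 2 * norm (blaschke_factor (cayley w) (cayley v))"
    using pos by (intro Schwarz_Pick_diff hol bd norm_cayley_less_1)
  also have "norm (blaschke_factor (cayley w) (cayley v)) = \<nu> / norm (v - cnj w)"
  proof -
    have "norm (v - w) = \<nu>" using \<nu> by (simp add: v_def norm_mult)
    then show ?thesis by (simp add: norm_blaschke_factor_cayley[OF pos])
  qed
  also have "2 * (\<nu> / norm (v - cnj w)) \<le> 2 * (\<nu> / (1 / 2))"
  proof (intro mult_left_mono divide_left_mono)
    have "Im (v - cnj w) \<le> norm (v - cnj w)" using abs_Im_le_cmod[of "v - cnj w"] by simp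
    then show "1 / 2 \<le> norm (v - cnj w)" using w \<nu> by (simp add: v_def)
    then show "0 < norm (v - cnj w) * (1 / 2)" by linarith
  qed (use \<nu> in simp_all)
  finally show ?thesis by (simp add: v_def)
qed

text \<open>Below height \<open>\<nu>\<close> nothing prevents \<open>F\<close> from vanishing. The
  shift by \<open>\<nu>\<close> makes the reciprocal available everywhere, and the error
  \<open>e\<close> it causes is small where the extension needs it.\<close>

lemma near_unimodular_invertible:
  assumes ext: "bounded_extension (halfplane_blaschke UNIV) (1 / 4) s C" and C: "0 < C"
    and s: "1 / 4 < s" "s < 1 / 2"
    and c: "0 < c" "\<And>w. 0 < Im w \<Longrightarrow> Im w < 1 / 2 \<Longrightarrow> c \<le> norm (halfplane_blaschke UNIV w)"
    and hol: "F holomorphic_on unit_disc" and bd: "\<And>z. norm z < 1 \<Longrightarrow> norm (F z) < 1"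
    and \<nu>: "0 < \<nu>" and \<epsilon>: "0 < \<epsilon>" "\<epsilon> \<le> 1" and C\<nu>: "C * (8 * \<nu>) \<le> \<epsilon> / 4"
    and low: "\<And>w. \<nu> \<le> Im w \<Longrightarrow> 1 / (1 + \<epsilon> / 3) \<le> norm (F (cayley w))"
  obtains g k B where "g holomorphic_on {w. 0 < Im w}" "k holomorphic_on {w. 0 < Im w}"
    "\<And>w. 0 < Im w \<Longrightarrow> norm (g w) \<le> 1 + \<epsilon>" "\<And>w. 0 < Im w \<Longrightarrow> norm (k w) \<le> B"
    "\<And>w. 0 < Im w \<Longrightarrow> F (cayley w) * g w = 1 + k w * halfplane_blaschke UNIV w"
proof -
  let ?\<Theta> = "halfplane_blaschke UNIV" and ?H = "{w. 0 < Im w}"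
  define \<phi> where "\<phi> w = F (cayley w)" for w
  define \<tau> where "\<tau> w = w + \<i> * of_real \<nu>" for w
  define e where "e w = 1 - \<phi> w / \<phi> (\<tau> w)" for w
  have "(F \<circ> cayley) holomorphic_on ?H"
    by (rule holomorphic_on_compose_gen[OF cayley_holomorphic hol]) (use norm_cayley_less_1 in auto)
  then have \<phi>_hol: "\<phi> holomorphic_on ?H" by (simp add: o_def \<phi>_def[abs_def])
  have "(\<phi> \<circ> \<tau>) holomorphic_on ?H"
    using \<nu> unfolding \<tau>_def
    by (intro holomorphic_on_compose_gen[OF _ \<phi>_hol] holomorphic_intros) auto
  then have \<tau>_hol: "(\<lambda>w. \<phi> (\<tau> w)) holomorphic_on ?H" by (simp add: o_def)
  have low': "1 / (1 + \<epsilon> / 3) \<le> norm (\<phi> (\<tau> w))" if "0 < Im w" for w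
    using low[of "\<tau> w"] that by (simp add: \<phi>_def \<tau>_def)
  have pos: "0 < 1 / (1 + \<epsilon> / 3)" using \<epsilon> by (simp add: add_pos_pos)
  have nz: "\<phi> (\<tau> w) \<noteq> 0" if "0 < Im w" for w
    using low'[OF that] pos by auto
  have inv: "norm (1 / \<phi> (\<tau> w)) \<le> 1 + \<epsilon> / 3" if "0 < Im w" for w
  proof -
    have "0 < norm (\<phi> (\<tau> w))" using low'[OF that] pos by linarith
    moreover have "1 \<le> norm (\<phi> (\<tau> w)) * (1 + \<epsilon> / 3)"
      using low'[OF that] \<epsilon> by (simp only: pos_divide_le_eq add_pos_pos zero_less_one divide_pos_pos zero_less_numeral)
    ultimately show ?thesis by (simp only: norm_divide norm_one pos_divide_le_eq mult.commute)
  qed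
  have \<phi>_bd: "norm (\<phi> w) \<le> 1" if "0 < Im w" for w
    using bd[OF norm_cayley_less_1[OF that]] by (simp add: \<phi>_def)
  have e_hol: "e holomorphic_on ?H"
    unfolding e_def using nz by (intro holomorphic_intros \<phi>_hol \<tau>_hol) auto
  \<comment> \<open>This crude bound down to the boundary makes \<open>E - e\<close> bounded on the
    whole half-plane, as the division by the Blaschke product requires.\<close>
  have e_bd: "norm (e w) \<le> 3" if "0 < Im w" for w
  proof -
    have "norm (\<phi> w * (1 / \<phi> (\<tau> w))) \<le> 1 * (1 + \<epsilon> / 3)"
      unfolding norm_mult using that by (intro mult_mono \<phi>_bd inv) auto
    then show ?thesis
      using norm_triangle_ineq4[of 1 "\<phi> w / \<phi> (\<tau> w)"] \<epsilon> by (simp add: e_def)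
  qed
  have e_small: "norm (e w) \<le> 8 * \<nu>" if "1 / 4 < Im w" for w
  proof -
    have w: "0 < Im w" using that by linarith
    have "e w = (\<phi> (\<tau> w) - \<phi> w) * (1 / \<phi> (\<tau> w))"
      using nz[OF w] by (simp add: e_def field_simps)
    moreover have "norm (\<phi> (\<tau> w) - \<phi> w) \<le> 4 * \<nu>"
      unfolding \<phi>_def \<tau>_def by (rule halfplane_Schwarz_Pick_vertical[OF hol bd that \<nu>])
    moreover have "norm (1 / \<phi> (\<tau> w)) \<le> 2" using inv[OF w] \<epsilon> by linarith
    ultimately have "norm (e w) \<le> 4 * \<nu> * 2"
      using \<nu> by (simp only: norm_mult) (intro mult_mono, auto)
    then show ?thesis by simp
  qed
  have "e holomorphic_on {w. 1 / 4 < Im w}"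
    by (rule holomorphic_on_subset[OF e_hol]) auto
  then obtain E k where E: "E holomorphic_on ?H" "\<And>w. 0 < Im w \<Longrightarrow> norm (E w) \<le> C * (8 * \<nu>)"
    and k: "k holomorphic_on {w. s < Im w}" "\<And>w. s < Im w \<Longrightarrow> norm (k w) \<le> C * (8 * \<nu>)"
    and Ek: "\<And>w. s < Im w \<Longrightarrow> E w = e w + ?\<Theta> w * k w"
    by (rule bounded_extensionE[OF ext _ e_small]) blast+
  have E_bd: "norm (E w) \<le> \<epsilon> / 4" if "0 < Im w" for w using E(2)[OF that] C\<nu> by linarith
  have Ee_hol: "(\<lambda>w. E w - e w) holomorphic_on ?H" by (intro holomorphic_intros E e_hol)
  have Ee_bd: "norm (E w - e w) \<le> 4" if "0 < Im w" for w
    using norm_triangle_ineq4[of "E w" "e w"] E_bd[OF that] e_bd[OF that] \<epsilon> by linarith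
  have Ee: "E w - e w = ?\<Theta> w * k w" if "s < Im w" for w using Ek[OF that] by simp
  have s0: "0 \<le> s" using s by simp
  obtain K B where K: "K holomorphic_on ?H" "\<And>w. 0 < Im w \<Longrightarrow> norm (K w) \<le> B"
    "\<And>w. 0 < Im w \<Longrightarrow> E w - e w = ?\<Theta> w * K w"
    by (rule halfplane_divide[OF halfplane_blaschke_holomorphic c Ee_hol Ee_bd k s0 s(2) Ee]) blast+
  have E1: "1 - \<epsilon> / 4 \<le> norm (1 - E w)" if "0 < Im w" for w
    using norm_triangle_ineq2[of 1 "E w"] E_bd[OF that] by simp
  have E1': "1 / norm (1 - E w) \<le> 1 / (1 - \<epsilon> / 4)" if "0 < Im w" for w
    using E1[OF that] \<epsilon> by (intro divide_left_mono mult_pos_pos) auto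
  have E1_nz: "1 - E w \<noteq> 0" if "0 < Im w" for w
    using E1[OF that] \<epsilon> by auto
  show thesis
  proof (rule that)
    show "(\<lambda>w. 1 / \<phi> (\<tau> w) / (1 - E w)) holomorphic_on ?H"
      using nz E1_nz by (intro holomorphic_intros \<tau>_hol E) auto
    show "(\<lambda>w. K w / (1 - E w)) holomorphic_on ?H"
      using E1_nz by (intro holomorphic_intros K E) auto
    show "norm (1 / \<phi> (\<tau> w) / (1 - E w)) \<le> 1 + \<epsilon>" if "0 < Im w" for w
    proof -
      have "norm (1 / \<phi> (\<tau> w) / (1 - E w)) = norm (1 / \<phi> (\<tau> w)) * (1 / norm (1 - E w))"
        by (simp add: norm_divide norm_mult)
      also have "\<dots> \<le> (1 + \<epsilon> / 3) * (1 / (1 - \<epsilon> / 4))"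
        using that \<epsilon> by (intro mult_mono inv E1') auto
      also have "\<dots> \<le> 1 + \<epsilon>"
      proof -
        have "\<epsilon> * \<epsilon> \<le> \<epsilon> * 1" using \<epsilon> by (intro mult_left_mono) auto
        moreover have "(1 + \<epsilon>) * (1 - \<epsilon> / 4) = 1 + 3 * \<epsilon> / 4 - \<epsilon> * \<epsilon> / 4"
          by (simp add: field_simps)
        ultimately have "1 + \<epsilon> / 3 \<le> (1 + \<epsilon>) * (1 - \<epsilon> / 4)" using \<epsilon> by linarith
        then show ?thesis using \<epsilon> by (simp add: pos_divide_le_eq)
      qed
      finally show ?thesis .
    qed
    show "norm (K w / (1 - E w)) \<le> B * (1 / (1 - \<epsilon> / 4))" if "0 < Im w" for w
    proof -
      have "norm (K w / (1 - E w)) = norm (K w) * (1 / norm (1 - E w))" by (simp add: norm_divide)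
      also have "\<dots> \<le> B * (1 / (1 - \<epsilon> / 4))"
        using that order_trans[OF norm_ge_zero K(2)[OF that]] by (intro mult_mono K E1') auto
      finally show ?thesis .
    qed
    show "F (cayley w) * (1 / \<phi> (\<tau> w) / (1 - E w)) = 1 + K w / (1 - E w) * ?\<Theta> w"
      if "0 < Im w" for w
    proof -
      \<comment> \<open>As \<open>1 - e = (1 - E) + (E - e)\<close> and \<open>E - e\<close> is a
        multiple of the Blaschke product, division by \<open>1 - E\<close> leaves 1 plus such a
        multiple.\<close>
      have "F (cayley w) * (1 / \<phi> (\<tau> w) / (1 - E w)) = (1 - e w) / (1 - E w)"
        by (simp add: e_def \<phi>_def)
      also have "1 - e w = (1 - E w) + ?\<Theta> w * K w" using K(3)[OF that] by (simp add: algebra_simps)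
      finally show ?thesis using E1_nz[OF that] by (simp add: add_divide_distrib mult.commute)
    qed
  qed
qed

lemma SIP_zero_seq: "SIP (blaschke_product UNIV zero_seq)"
  unfolding SIP_def
proof (intro allI impI)
  let ?\<Theta> = "blaschke_product UNIV zero_seq"
  fix \<epsilon>\<^sub>0 :: real assume "0 < \<epsilon>\<^sub>0"
  define \<epsilon> where "\<epsilon> = min \<epsilon>\<^sub>0 1"
  have \<epsilon>: "0 < \<epsilon>" "\<epsilon> \<le> 1" "\<epsilon> \<le> \<epsilon>\<^sub>0" using \<open>0 < \<epsilon>\<^sub>0\<close> by (auto simp: \<epsilon>_def)
  have \<Theta>: "?\<Theta> \<in> Hinf" by (rule blaschke_product_Hinf[OF blaschke_zeros_zero_seq])
  \<comment> \<open>All zeros have height at least 1, so the full product is bounded below up to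
    height 1/2.\<close>
  obtain c where c: "0 < c" "\<And>w. 0 < Im w \<Longrightarrow> Im w < 1 / 2 \<Longrightarrow> c \<le> norm (halfplane_blaschke UNIV w)"
    by (rule halfplane_blaschke_bounded_below[of "1 / 2" UNIV]) (use Im_zero_point_ge_1 in auto)
  obtain C s where C: "0 < C" and s: "1 / 4 < s" "s < 1 / 2"
    and ext: "bounded_extension (halfplane_blaschke UNIV) (1 / 4) s C"
    by (rule halfplane_extension[OF halfplane_blaschke_holomorphic norm_halfplane_blaschke_le_1 c,
          where a = "1 / 4" and h = "1 / 2"]) auto
  \<comment> \<open>The bound 1/10 serves \<open>zeros_near\<close>; the other term keeps the
    extension \<open>E\<close> below \<open>\<epsilon> / 4\<close>.\<close>
  define \<nu> where "\<nu> = min (1 / 10) (\<epsilon> / (32 * C))"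
  have \<nu>: "0 < \<nu>" "\<nu> \<le> 1 / 10" using \<epsilon> C by (auto simp: \<nu>_def)
  have "\<nu> \<le> \<epsilon> / (32 * C)" by (simp add: \<nu>_def)
  then have C\<nu>: "C * (8 * \<nu>) \<le> \<epsilon> / 4" using C by (simp add: field_simps)
  \<comment> \<open>The constant turns the loss \<open>4 * (2 * \<delta>) / (\<nu> / 2)\<close>
    between a zero and a nearby point into \<open>\<epsilon> / 6\<close>.\<close>
  define \<delta> where "\<delta> = \<nu> * \<epsilon> / 96"
  have \<delta>: "0 < \<delta>" using \<nu> \<epsilon> by (simp add: \<delta>_def)
  show "\<exists>\<delta>>0. \<forall>f\<in>Hinf. quotient_norm ?\<Theta> f \<le> 1 \<and> ereal (1 - \<delta>) \<le> inf_on_zeros ?\<Theta> f \<longrightarrow>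
      (\<exists>h. quotient_inverse ?\<Theta> f h \<and> quotient_norm ?\<Theta> h \<le> 1 + \<epsilon>\<^sub>0)"
  proof (intro exI[of _ \<delta>] conjI ballI impI \<delta>)
    fix f assume f: "f \<in> Hinf"
      and "quotient_norm ?\<Theta> f \<le> 1 \<and> ereal (1 - \<delta>) \<le> inf_on_zeros ?\<Theta> f"
    then have f_norm: "quotient_norm ?\<Theta> f < 1 + \<delta>" and f_inf: "ereal (1 - \<delta>) \<le> inf_on_zeros ?\<Theta> f"
      using \<delta> by auto
    have f_zero: "1 - \<delta> \<le> norm (f (zero_seq n))" for n
      using order_trans[OF f_inf inf_on_zeros_blaschke_le[OF blaschke_zeros_zero_seq UNIV_I, of f n]] by simp
    obtain G where G: "G \<in> Hinf" "Hinf_norm (\<lambda>z. f z + G z * ?\<Theta> z) < 1 + \<delta>"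
      by (rule quotient_norm_lessE[OF f \<Theta> f_norm])
    \<comment> \<open>A representative of the coset with norm below \<open>1 + \<delta>\<close>; it
      has the values of \<open>f\<close> at the zeros, and scaling it gives a map \<open>F\<close>
      into the open disc.\<close>
    define f\<^sub>1 where "f\<^sub>1 z = f z + G z * ?\<Theta> z" for z
    have f1: "f\<^sub>1 \<in> Hinf" unfolding f\<^sub>1_def[abs_def] by (intro Hinf_add Hinf_mult f G \<Theta>)
    define F where "F z = f\<^sub>1 z / of_real (1 + \<delta>)" for z
    have F_hol: "F holomorphic_on unit_disc"
      unfolding F_def using Hinf_holomorphic[OF f1] \<delta>
      by (intro holomorphic_intros) (auto simp: add_eq_0_iff simp del: of_real_add)
    have F_norm: "norm (F z) = norm (f\<^sub>1 z) / (1 + \<delta>)" for z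
      using \<delta> by (simp add: F_def norm_divide del: of_real_add)
    have F_bd: "norm (F z) < 1" if "norm z < 1" for z
      using Hinf_norm_upper[OF f1 that] G(2) \<delta> by (simp add: F_norm f\<^sub>1_def[abs_def])
    have F_zero: "1 - norm (F (zero_seq n)) \<le> 2 * \<delta>" for n
    proof -
      have "f\<^sub>1 (zero_seq n) = f (zero_seq n)"
        using blaschke_product_zero[OF blaschke_zeros_zero_seq, of n UNIV] by (simp add: f\<^sub>1_def)
      then have "(1 - \<delta>) / (1 + \<delta>) \<le> norm (F (zero_seq n))"
        using f_zero[of n] \<delta> by (simp add: F_norm divide_right_mono)
      moreover have "1 - 2 * \<delta> \<le> (1 - \<delta>) / (1 + \<delta>)"
      proof -
        have "(1 - 2 * \<delta>) * (1 + \<delta>) \<le> 1 - \<delta>" using \<delta> by (simp add: algebra_simps)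
        then show ?thesis using pos_le_divide_eq[of "1 + \<delta>" "1 - 2 * \<delta>" "1 - \<delta>"] \<delta> by linarith
      qed
      ultimately show ?thesis by linarith
    qed
    have F_low: "1 / (1 + \<epsilon> / 3) \<le> norm (F (cayley w))" if w: "\<nu> \<le> Im w" for w
    proof -
      obtain n where n: "\<nu> / 2 \<le> 1 - (norm (blaschke_factor (zero_seq n) (cayley w)))\<^sup>2"
        by (rule zeros_near[OF \<nu> w])
      have "1 - norm (F (cayley w)) \<le> 4 * (1 - norm (F (zero_seq n))) / (\<nu> / 2)"
        using \<nu> w n by (intro Schwarz_Pick_lower_bound[OF F_hol F_bd norm_zero_seq_less_1])
          (auto intro: norm_cayley_less_1)
      also have "\<dots> \<le> 4 * (2 * \<delta>) / (\<nu> / 2)"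
        using F_zero[of n] \<nu> by (intro divide_right_mono mult_left_mono) auto
      also have "\<dots> = \<epsilon> / 6" using \<nu> by (simp add: \<delta>_def)
      finally have "1 - \<epsilon> / 6 \<le> norm (F (cayley w))" by simp
      moreover have "1 / (1 + \<epsilon> / 3) \<le> 1 - \<epsilon> / 6"
      proof -
        have "\<epsilon> * \<epsilon> \<le> \<epsilon> * 1" using \<epsilon> by (intro mult_left_mono) auto
        moreover have "(1 - \<epsilon> / 6) * (1 + \<epsilon> / 3) = 1 + \<epsilon> / 6 - \<epsilon> * \<epsilon> / 18"
          by (simp add: field_simps)
        ultimately have "1 \<le> (1 - \<epsilon> / 6) * (1 + \<epsilon> / 3)" using \<epsilon> by linarith
        then show ?thesis using \<epsilon> by (simp add: pos_divide_le_eq add_pos_pos)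
      qed
      ultimately show ?thesis by linarith
    qed
    obtain g k B where g: "g holomorphic_on {w. 0 < Im w}" "\<And>w. 0 < Im w \<Longrightarrow> norm (g w) \<le> 1 + \<epsilon>"
      and k: "k holomorphic_on {w. 0 < Im w}" "\<And>w. 0 < Im w \<Longrightarrow> norm (k w) \<le> B"
      and gk: "\<And>w. 0 < Im w \<Longrightarrow> F (cayley w) * g w = 1 + k w * halfplane_blaschke UNIV w"
      by (rule near_unimodular_invertible[OF ext C s c F_hol F_bd \<nu>(1) \<epsilon>(1,2) C\<nu> F_low]) blast+
    define h where "h z = of_real (1 / (1 + \<delta>)) * g (inv_cayley z)" for z
    \<comment> \<open>The term with \<open>G\<close> accounts for the passage from
      \<open>f\<^sub>1\<close> back to \<open>f\<close>.\<close>
    define q where "q z = k (inv_cayley z) + - 1 * (G z * h z)" for z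
    have const: "(\<lambda>_. w) \<in> Hinf" for w by (rule HinfI[of _ "norm w"]) auto
    have h: "h \<in> Hinf"
      unfolding h_def[abs_def] by (intro Hinf_mult const Hinf_inv_cayley[OF g])
    have q: "q \<in> Hinf"
      unfolding q_def[abs_def] by (intro Hinf_mult Hinf_add const Hinf_inv_cayley[OF k] G h)
    have "f z * h z = 1 + q z * ?\<Theta> z" if "z \<in> unit_disc" for z
    proof -
      have w: "0 < Im (inv_cayley z)" "cayley (inv_cayley z) = z"
        using that by (simp_all add: Im_inv_cayley_pos cayley_inv_cayley)
      have "f\<^sub>1 z * h z = F z * g (inv_cayley z)" by (simp add: F_def h_def divide_simps del: of_real_add)
      also have "\<dots> = 1 + k (inv_cayley z) * ?\<Theta> z" using gk[OF w(1)] by (simp add: w(2))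
      finally show ?thesis by (simp add: f\<^sub>1_def q_def algebra_simps)
    qed
    then have inv: "quotient_inverse ?\<Theta> f h"
      using h q unfolding quotient_inverse_def quotient_eq_def by blast
    have "quotient_norm ?\<Theta> h \<le> Hinf_norm h" by (rule quotient_norm_le[OF h \<Theta>])
    also have "\<dots> \<le> 1 + \<epsilon>\<^sub>0"
    proof (rule Hinf_norm_least)
      fix z :: complex assume z: "norm z < 1"
      have "norm (h z) = norm (g (inv_cayley z)) / (1 + \<delta>)"
        using \<delta> by (simp add: h_def norm_mult norm_divide del: of_real_add)
      also have "\<dots> \<le> norm (g (inv_cayley z)) / 1"
        using \<delta> by (intro divide_left_mono) auto
      also have "\<dots> \<le> 1 + \<epsilon>\<^sub>0" using g(2)[OF Im_inv_cayley_pos[OF z]] \<epsilon> by simp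
      finally show "norm (h z) \<le> 1 + \<epsilon>\<^sub>0" .
    qed
    finally show "\<exists>h. quotient_inverse ?\<Theta> f h \<and> quotient_norm ?\<Theta> h \<le> 1 + \<epsilon>\<^sub>0"
      using inv by blast
  qed
qed

section \<open>Failure of the Carleson condition\<close>

text \<open>On sets outside the sigma-algebra \<open>emeasure\<close> is 0 by default, so a lower
  bound for the mass of a box rests on this.\<close>

lemma carleson_box_measurable: "carleson_box \<alpha> \<beta> \<in> sets borel"
proof -
  have "compact (cis ` {\<alpha>..\<beta>})"
    by (intro compact_continuous_image continuous_intros) auto
  then have [measurable]: "cis ` {\<alpha>..\<beta>} \<in> sets borel"
    by (intro borel_closed compact_imp_closed)
  have [measurable]: "unit_disc \<in> sets borel" by simp
  have "(\<lambda>z :: complex. z / of_real (norm z)) \<in> borel_measurable borel" by measurable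
  then have 1: "(\<lambda>z :: complex. z / of_real (norm z)) -` (cis ` {\<alpha>..\<beta>}) \<in> sets borel"
    using measurable_sets[of "\<lambda>z. z / of_real (norm z)" borel borel "cis ` {\<alpha>..\<beta>}"] by simp
  have 2: "{z :: complex. 1 - norm z \<le> \<beta> - \<alpha>} \<in> sets borel"
    by (intro borel_closed closed_Collect_le continuous_intros)
  have "carleson_box \<alpha> \<beta> = unit_disc \<inter> (\<lambda>z. z / of_real (norm z)) -` (cis ` {\<alpha>..\<beta>})
      \<inter> {z. 1 - norm z \<le> \<beta> - \<alpha>}"
    by (auto simp: carleson_box_def)
  then show ?thesis using 1 2 by auto
qed

lemma emeasure_zeros_measure_ge:
  assumes "\<And>n. n \<in> N \<Longrightarrow> a n \<in> carleson_box \<alpha> \<beta>" "finite N"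
    and "\<And>n. n \<in> N \<Longrightarrow> r \<le> 1 - norm (a n)" "0 \<le> r"
  shows "ennreal (real (card N) * r) \<le> emeasure (zeros_measure UNIV a) (carleson_box \<alpha> \<beta>)"
proof -
  let ?P = "point_measure UNIV (\<lambda>n. ennreal (1 - norm (a n)))"
  have "ennreal (real (card N) * r) = (\<Sum>n\<in>N. ennreal r)"
    using assms(4) by (simp add: ennreal_mult ennreal_of_nat_eq_real_of_nat)
  also have "\<dots> \<le> (\<Sum>n\<in>N. ennreal (1 - norm (a n)))"
    using assms(3) by (intro sum_mono ennreal_leI)
  also have "\<dots> = emeasure ?P N"
    using assms(2) by (subst emeasure_point_measure_finite2) auto
  also have "\<dots> \<le> emeasure ?P (a -` carleson_box \<alpha> \<beta> \<inter> space ?P)"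
    using assms(1) by (intro emeasure_mono) (auto simp: space_point_measure sets_point_measure)
  also have "\<dots> = emeasure (zeros_measure UNIV a) (carleson_box \<alpha> \<beta>)"
    unfolding zeros_measure_def
    by (subst emeasure_distr) (auto simp: carleson_box_measurable measurable_def space_point_measure sets_point_measure)
  finally show ?thesis .
qed

text \<open>Such a point has real part at least 1/2 and imaginary part at most \<open>r\<close> in
  modulus, so its argument, an arctangent, is at most \<open>2 * r\<close> in modulus.\<close>

lemma near_1_in_carleson_box:
  assumes z: "norm z < 1" and r: "norm (1 - z) \<le> r" "r \<le> 1 / 2"
  shows "z \<in> carleson_box (- 2 * r) (2 * r)"
proof -
  have re: "1 / 2 \<le> Re z" using abs_Re_le_cmod[of "1 - z"] r by simp
  have im: "\<bar>Im z\<bar> \<le> r" using abs_Im_le_cmod[of "1 - z"] r by simp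
  define \<theta> where "\<theta> = arctan (Im z / Re z)"
  have nz: "z \<noteq> 0" using re by auto
  have "\<bar>\<theta>\<bar> \<le> \<bar>Im z / Re z\<bar>" unfolding \<theta>_def by (rule abs_arctan_le)
  also have "\<dots> = \<bar>Im z\<bar> / Re z" using re by simp
  also have "\<dots> \<le> r / (1 / 2)" using re im by (intro frac_le) auto
  finally have "\<theta> \<in> {- 2 * r..2 * r}" by (auto simp: abs_le_iff)
  moreover have "z / of_real (norm z) = cis \<theta>"
  proof -
    have "\<theta> = Arg z" unfolding \<theta>_def using re by (intro arg_conv_arctan[symmetric]) auto
    then show ?thesis using nz cis_Arg[OF nz] by (simp add: sgn_div_norm scaleR_conv_of_real divide_inverse mult.commute)
  qed
  moreover have "1 - norm z \<le> 2 * r - - 2 * r"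
    using norm_triangle_ineq2[of 1 z] r order_trans[OF norm_ge_zero r(1)] by simp
  ultimately show ?thesis using z by (auto simp: carleson_box_def)
qed

text \<open>The first \<open>m\<close> points of row \<open>m\<close> lie in a box over an arc of
  length \<open>8 / m ^ 4\<close>, and each has mass at least \<open>2 / (5 * m ^ 4)\<close>. The
  ratio of mass to length grows like \<open>m\<close>.\<close>

lemma not_carleson_newman_zero_seq: "\<not> carleson_newman UNIV zero_seq"
proof
  assume "carleson_newman UNIV zero_seq"
  then obtain C where C: "0 < C" and box: "\<And>\<alpha> \<beta>. \<alpha> < \<beta> \<Longrightarrow> \<beta> - \<alpha> \<le> 2 * pi \<Longrightarrow>
      emeasure (zeros_measure UNIV zero_seq) (carleson_box \<alpha> \<beta>) \<le> ennreal (C * (\<beta> - \<alpha>))"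
    by (auto simp: carleson_newman_def carleson_measure_def)
  \<comment> \<open>The box inequality will force \<open>m \<le> 20 * C\<close>; the summand 2 makes
    \<open>y\<close> at least 16, so that \<open>r\<close> stays below 1/2.\<close>
  define m where "m = nat \<lceil>20 * C\<rceil> + 2"
  have m: "2 \<le> m" "20 * C < real m" unfolding m_def by linarith+
  define y where "y = real m ^ 4"
  have "2 ^ 4 \<le> y" unfolding y_def using m by (intro power_mono) auto
  then have y: "16 \<le> y" by simp
  \<comment> \<open>A point \<open>v\<close> at height \<open>y\<close> has Cayley image at distance
    \<open>2 / norm (v + \<i>)\<close> from 1, which is at most \<open>2 / y\<close>.\<close>
  define r where "r = 2 / y"
  have r: "0 < r" "r \<le> 1 / 2" using y by (auto simp: r_def field_simps)
  define idx where "idx j = prod_encode (m - 1, int_encode (int j))" for j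
  define N where "N = idx ` {..<m}"
  have "inj_on idx {..<m}" by (auto simp: idx_def inj_on_def int_encode_eq)
  then have card: "card N = m" by (simp add: N_def card_image)
  have pt: "zero_point (idx j) = Complex (real j * real m ^ 3) y" for j
    using m by (simp add: zero_point_def zero_height_def idx_def y_def)
  have in_box: "zero_seq n \<in> carleson_box (- 2 * r) (2 * r)" if "n \<in> N" for n
  proof (rule near_1_in_carleson_box[OF norm_zero_seq_less_1 _ r(2)])
    from that obtain j where n: "n = idx j" by (auto simp: N_def)
    have nz: "zero_point n + \<i> \<noteq> 0" by (rule cayley_denominator[OF Im_zero_point_pos])
    then have "1 - zero_seq n = 2 * \<i> / (zero_point n + \<i>)"
      by (simp add: zero_seq_def cayley_def field_simps)
    moreover have "y \<le> norm (zero_point n + \<i>)"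
      using abs_Im_le_cmod[of "zero_point n + \<i>"] y by (simp add: n pt)
    ultimately show "norm (1 - zero_seq n) \<le> r"
      using y by (simp add: norm_divide norm_mult r_def frac_le)
  qed
  have mass: "2 / (5 * y) \<le> 1 - norm (zero_seq n)" if "n \<in> N" for n
  proof -
    from that obtain j where n: "n = idx j" "j < m" by (auto simp: N_def)
    \<comment> \<open>For \<open>j < m\<close> the real part is at most \<open>y\<close>, so the
      squared distance from \<open>\<i>\<close> to the reflected point is at most
      \<open>y\<^sup>2 + (1 + y)\<^sup>2\<close>, hence at most
      \<open>5 * y\<^sup>2\<close>.\<close>
    have "real j * real m ^ 3 \<le> real m * real m ^ 3" using n by (intro mult_right_mono) auto
    then have "(real j * real m ^ 3)\<^sup>2 \<le> y\<^sup>2"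
      by (intro power_mono) (auto simp: y_def eval_nat_numeral)
    moreover have "(1 + y)\<^sup>2 \<le> (2 * y)\<^sup>2" using y by (intro power_mono) auto
    ultimately have d: "(norm (\<i> - cnj (zero_point n)))\<^sup>2 \<le> 5 * y\<^sup>2"
      by (simp add: cmod_power2 n pt power_mult_distrib)
    have "4 / (5 * y) = 4 * y / (5 * y\<^sup>2)" using y by (simp add: power2_eq_square)
    also have "\<dots> \<le> 4 * y / (norm (\<i> - cnj (zero_point n)))\<^sup>2"
      using d y diff_cnj_nonzero[OF Im_zero_point_pos, of \<i> n] by (intro divide_left_mono) auto
    also have "\<dots> = 1 - (norm (blaschke_factor (zero_seq n) (cayley \<i>)))\<^sup>2"
      using one_minus_blaschke_factor_cayley[OF Im_zero_point_pos, of \<i> n] by (simp add: zero_seq_def n pt)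
    also have "\<dots> = 1 - (norm (zero_seq n))\<^sup>2" by (simp add: norm_blaschke_factor cayley_def)
    also have "\<dots> \<le> 2 * (1 - norm (zero_seq n))"
      using zero_le_power2[of "1 - norm (zero_seq n)"] by (simp add: power2_eq_square algebra_simps)
    finally show ?thesis by simp
  qed
  have "ennreal (real (card N) * (2 / (5 * y)))
      \<le> emeasure (zeros_measure UNIV zero_seq) (carleson_box (- 2 * r) (2 * r))"
    using y by (intro emeasure_zeros_measure_ge in_box mass) (auto simp: N_def)
  also have "\<dots> \<le> ennreal (C * (2 * r - - 2 * r))"
    using r pi_gt3 by (intro box) auto
  finally have "real m * (2 / (5 * y)) \<le> C * (2 * r - - 2 * r)"
    using C r by (simp add: card)
  also have "\<dots> = 8 * C / y" by (simp add: r_def)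
  finally have "real m \<le> 20 * C" using y by (simp add: field_simps)
  with m show False by simp
qed

theorem proposition6p5:
  shows "\<exists>J a. blaschke_zeros J a \<and>
           SIP (blaschke_product J a) \<and> WEP (blaschke_product J a) \<and>
           \<not> carleson_newman J a"
  using blaschke_zeros_zero_seq SIP_zero_seq WEP_zero_seq not_carleson_newman_zero_seq by blast

end
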